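(* Let $(\omega^1,\omega^2,\omega^3,\omega^4)$ be a coframe on a 4-manifold $\widetilde M$ with structure equations $$\begin{aligned} d\omega^1&=\omega^1\wedge\omega^4-C\,\omega^1\wedge\omega^3+\omega^2\wedge\omega^3,\\ d\omega^2&=\omega^2\wedge\omega^4+C\,\omega^2\wedge\omega^3+\epsilon\,\omega^1\wedge\omega^3,\\ d\omega^3&=0,\\ d\omega^4&=E\,\omega^1\wedge\omega^2.\end{aligned}$$ Then on any open set $U\subset\widetilde M$ such that $E>0$ there exists a local coordinate chart $(x,y,z,w)$, on a possibly smaller open set, such that $$\begin{aligned}\omega^1&=K\,dx+L\,dy,\\ \omega^2&=C\,\omega^1-\left(\frac{\partial K}{\partial z}\,dx+\frac{\partial L}{\partial z}\,dy\right),\\ \omega^3&=dz,\\ \omega^4&=\frac{1}{2w}\,dw-\left(K^2\frac{\partial}{\partial z}\left(\frac fK\right)\right)dx-\left(L^2\frac{\partial}{\partial z}\left(\frac fL\right)\right)dy,\end{aligned}$$ where $$\begin{aligned} f&=\frac{w}{W_0\det(h)}\left(\frac{\partial L}{\partial x}-\frac{\partial K}{\partial y}\right),\\ K&=\frac{1}{\sqrt w}\left(h_{11}(x,y)Q_1(z)+h_{12}(x,y)Q_2(z)\right),\\ L&=\frac{1}{\sqrt w}\left(h_{21}(x,y)Q_1(z)+h_{22}(x,y)Q_2(z)\right),\end{aligned}$$ for some invertible $2\times2$ matrix $h(x,y)=[h_{ij}]$ of smooth functions of the two variables $x$ and $y$; the functions $Q_1,Q_2$ are linearly independent solutions of $$\frac{d^2Q}{dz^2}=\left(C^2+\epsilon+\frac{dC}{dz}\right)Q,$$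 and $W_0\neq0$ is the (constant) Wronskian of $Q_1$ and $Q_2$ for some initial conditions.
   Context: Here $\epsilon=\pm1$, and $C,E$ are smooth functions on $\widetilde M$ with $dC=C_3\,\omega^3$, $C_3\neq0$, $dC_3\wedge\omega^3=0$, so locally $C$ is a function of $z$ alone, where $\omega^3=dz$. These structure equations arise on the 4-dimensional bundle of adapted coframes of a bi-contact structure on a 3-manifold in the case where $dC\wedge\omega^1\wedge\omega^2\neq0$ and $dC\wedge dC_3=0$. The expressions $K^2\partial_z(f/K)$ and $L^2\partial_z(f/L)$ are to be read as $K\,\partial_zf-f\,\partial_zK$ and $L\,\partial_zf-f\,\partial_zL$. *)

theory Defs
  imports "HOL-Analysis.Analysis"
begin

section \<open>Smooth functions on open sets\<close>

primrec cont_diff_on ::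
  "nat \<Rightarrow> 'a::euclidean_space set \<Rightarrow> ('a \<Rightarrow> 'b::real_normed_vector) \<Rightarrow> bool" where
  "cont_diff_on 0 S f \<longleftrightarrow> continuous_on S f"
| "cont_diff_on (Suc k) S f \<longleftrightarrow>
     (\<forall>x\<in>S. f differentiable (at x)) \<and>
     (\<forall>v. cont_diff_on k S (\<lambda>x. frechet_derivative f (at x) v))"

text \<open>Meant for open sets only, since derivatives are taken at the points of the set
  with respect to the whole space.\<close>

definition smooth_on :: "'a::euclidean_space set \<Rightarrow> ('a \<Rightarrow> 'b::real_normed_vector) \<Rightarrow> bool" where
  "smooth_on S f \<longleftrightarrow> (\<forall>k. cont_diff_on k S f)"

definition pderiv_at :: "'n::finite \<Rightarrow> (real ^ 'n \<Rightarrow> real) \<Rightarrow> real ^ 'n \<Rightarrow> real" where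
  "pderiv_at i F q = frechet_derivative F (at q) (axis i 1)"


section \<open>Smooth manifolds\<close>

text \<open>A chart is a pair of a domain and a coordinate map; the values of the
  coordinate map outside the domain are irrelevant.\<close>

type_synonym ('m, 'n) chart = "'m set \<times> ('m \<Rightarrow> real ^ 'n)"

abbreviation chart_dom :: "('m, 'n) chart \<Rightarrow> 'm set" where
  "chart_dom c \<equiv> fst c"

abbreviation chart_map :: "('m, 'n) chart \<Rightarrow> 'm \<Rightarrow> real ^ 'n" where
  "chart_map c \<equiv> snd c"

abbreviation chart_inv :: "('m, 'n) chart \<Rightarrow> real ^ 'n \<Rightarrow> 'm" where
  "chart_inv c \<equiv> inv_into (fst c) (snd c)"

definition is_chart :: "('m::topological_space, 'n::finite) chart \<Rightarrow> bool" where
  "is_chart c \<longleftrightarrow> open (chart_dom c) \<and> open (chart_map c ` chart_dom c) \<and>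
     homeomorphism (chart_dom c) (chart_map c ` chart_dom c) (chart_map c) (chart_inv c)"

definition transition :: "('m, 'n) chart \<Rightarrow> ('m, 'n) chart \<Rightarrow> real ^ 'n \<Rightarrow> real ^ 'n" where
  "transition c d = chart_map d \<circ> chart_inv c"

definition smoothly_compatible :: "('m, 'n::finite) chart \<Rightarrow> ('m, 'n) chart \<Rightarrow> bool" where
  "smoothly_compatible c d \<longleftrightarrow>
     smooth_on (chart_map c ` (chart_dom c \<inter> chart_dom d)) (transition c d) \<and>
     smooth_on (chart_map d ` (chart_dom c \<inter> chart_dom d)) (transition d c)"

text \<open>A smooth structure of dimension \<open>CARD('n)\<close> on the whole space \<open>'m\<close>,
  given by its maximal atlas.\<close>

definition smooth_structure ::
  "('m::{t2_space, second_countable_topology}, 'n::finite) chart set \<Rightarrow> bool" where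
  "smooth_structure A \<longleftrightarrow>
     (\<forall>c\<in>A. is_chart c) \<and>
     (\<Union>c\<in>A. chart_dom c) = UNIV \<and>
     (\<forall>c\<in>A. \<forall>d\<in>A. smoothly_compatible c d) \<and>
     (\<forall>c. is_chart c \<and> (\<forall>d\<in>A. smoothly_compatible c d) \<longrightarrow> c \<in> A)"

definition smooth_function :: "('m, 'n::finite) chart set \<Rightarrow> ('m \<Rightarrow> real) \<Rightarrow> bool" where
  "smooth_function A g \<longleftrightarrow> (\<forall>c\<in>A. smooth_on (chart_map c ` chart_dom c) (g \<circ> chart_inv c))"


section \<open>Differential forms\<close>

text \<open>A 1-form is given by its representatives in all charts of the maximal atlas, subject to the
  usual transformation law: \<open>\<omega> c p v\<close> is the value of the form at the point \<open>p\<close> on the tangent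
  vector whose coordinate vector in the chart \<open>c\<close> is \<open>v\<close>. Only the values with
  \<open>c\<close> in the atlas and \<open>p\<close> in its domain matter. Likewise for 2-forms.\<close>

type_synonym ('m, 'n) form1 = "('m, 'n) chart \<Rightarrow> 'm \<Rightarrow> real ^ 'n \<Rightarrow> real"
type_synonym ('m, 'n) form2 = "('m, 'n) chart \<Rightarrow> 'm \<Rightarrow> real ^ 'n \<Rightarrow> real ^ 'n \<Rightarrow> real"

definition smooth_form1 :: "('m, 'n::finite) chart set \<Rightarrow> ('m, 'n) form1 \<Rightarrow> bool" where
  "smooth_form1 A \<omega> \<longleftrightarrow>
     (\<forall>c\<in>A. \<forall>p\<in>chart_dom c. linear (\<omega> c p)) \<and>
     (\<forall>c\<in>A. \<forall>v. smooth_on (chart_map c ` chart_dom c) (\<lambda>q. \<omega> c (chart_inv c q) v)) \<and>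
     (\<forall>c\<in>A. \<forall>d\<in>A. \<forall>p \<in> chart_dom c \<inter> chart_dom d. \<forall>v.
        \<omega> c p v = \<omega> d p (frechet_derivative (transition c d) (at (chart_map c p)) v))"

text \<open>The number of forms in a coframe is the dimension of the manifold, so that pointwise
  linear independence makes them a basis of each cotangent space.\<close>

definition coframe ::
  "('m, 'n::finite) chart set \<Rightarrow> ('n \<Rightarrow> ('m, 'n) form1) \<Rightarrow> bool" where
  "coframe A \<omega> \<longleftrightarrow>
     (\<forall>i. smooth_form1 A (\<omega> i)) \<and>
     (\<forall>c\<in>A. \<forall>p\<in>chart_dom c. \<forall>a::'n \<Rightarrow> real.
        (\<forall>v. (\<Sum>i\<in>UNIV. a i * \<omega> i c p v) = 0) \<longrightarrow> (\<forall>i. a i = 0))"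

definition wedge :: "('m, 'n) form1 \<Rightarrow> ('m, 'n) form1 \<Rightarrow> ('m, 'n) form2" where
  "wedge \<alpha> \<beta> c p u v = \<alpha> c p u * \<beta> c p v - \<alpha> c p v * \<beta> c p u"

definition d_fun :: "('m \<Rightarrow> real) \<Rightarrow> ('m, 'n::finite) form1" where
  "d_fun g c p v = frechet_derivative (g \<circ> chart_inv c) (at (chart_map c p)) v"

definition d_form1 :: "('m, 'n::finite) form1 \<Rightarrow> ('m, 'n) form2" where
  "d_form1 \<omega> c p u v =
     frechet_derivative (\<lambda>q. \<omega> c (chart_inv c q) v) (at (chart_map c p)) u -
     frechet_derivative (\<lambda>q. \<omega> c (chart_inv c q) u) (at (chart_map c p)) v"


section \<open>Linear second order equations in one variable\<close>

definition solves_ode2 :: "real set \<Rightarrow> (real \<Rightarrow> real) \<Rightarrow> (real \<Rightarrow> real) \<Rightarrow> bool" where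
  "solves_ode2 I g Q \<longleftrightarrow>
     (\<forall>t\<in>I. (Q has_real_derivative deriv Q t) (at t) \<and>
             (deriv Q has_real_derivative g t * Q t) (at t))"

definition lin_indep_on :: "real set \<Rightarrow> (real \<Rightarrow> real) \<Rightarrow> (real \<Rightarrow> real) \<Rightarrow> bool" where
  "lin_indep_on I Q1 Q2 \<longleftrightarrow>
     (\<forall>a b. (\<forall>t\<in>I. a * Q1 t + b * Q2 t = 0) \<longrightarrow> a = 0 \<and> b = 0)"

definition wronskian :: "(real \<Rightarrow> real) \<Rightarrow> (real \<Rightarrow> real) \<Rightarrow> real \<Rightarrow> real" where
  "wronskian Q1 Q2 t = Q1 t * deriv Q2 t - Q2 t * deriv Q1 t"

end

theory Submission
  imports Defs
begin

text \<open>
  In a chart around a point let \<open>X\<^sub>1, \<dots>, X\<^sub>4\<close> be the frame dual to the coframe. In the coordinates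
  given by the time-one flow of \<open>\<Sum>j\<in>J. p\<^sub>j X\<^sub>j\<close>, contracting \<open>\<omega>\<^sup>i\<close> with the radial field
  \<open>\<Sum>j\<in>J. p\<^sub>j \<partial>\<^sub>j\<close> gives \<open>p\<^sub>i\<close> or \<open>0\<close>, and Cartan's formula turns each structure equation into an ordinary
  differential equation along the rays. For \<open>J\<close> the full index set this makes the closed form \<open>\<omega>\<^sup>3\<close> equal to
  \<open>dz\<close>; repeating it with \<open>J = {3, 4}\<close> keeps \<open>\<omega>\<^sup>3 = dz\<close>, puts \<open>\<omega>\<^sup>1\<close> and \<open>\<omega>\<^sup>2\<close> into the span of \<open>dx, dy\<close> (they
  satisfy a homogeneous linear system with zero initial value), and gives \<open>\<omega>\<^sup>4 = dt + \<alpha> dx + \<beta> dy\<close>; put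
  \<open>w = exp (2 t)\<close>. Since the structure equations are assumed in every chart of the atlas, they can be read
  off in the new coordinates at once.

  With \<open>\<omega>\<^sup>1 = K dx + L dy\<close> and \<open>\<omega>\<^sup>2 = M dx + N dy\<close> they say that \<open>\<surd>w K\<close> and \<open>\<surd>w L\<close> do not depend on \<open>w\<close> and
  solve the second order equation in \<open>z\<close>, that \<open>\<alpha>, \<beta>\<close> do not depend on \<open>z\<close>, and that
  \<open>L\<^sub>x - K\<^sub>y = K \<beta> - L \<alpha>\<close>. This identity and its \<open>z\<close>-derivative form a linear system for \<open>\<alpha>, \<beta>\<close> with
  determinant \<open>K L\<^sub>z - L K\<^sub>z = W\<^sub>0 det h / w\<close>; solving it gives the asserted formula for \<open>\<omega>\<^sup>4\<close>.
\<close>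

section \<open>Parametrised smooth functions\<close>

text \<open>Along a ray, a tangential component comes with its initial value: the factor
  \<open>s\<close> in \<open>s * y\<close> makes it vanish at the start. A transversal component
  only satisfies \<open>s * y' = ...\<close>, so its value on the slice where the J-coordinates
  vanish has to be supplied. This is why one pass does not suffice: on the slice the second flow map
  is affine with derivative the frame at the base point, and such a map carries the
  constant-coefficient form dz of the earlier chart to dz again.

  Smooth dependence of flows on parameters forces functions with a time argument: the derivative of
  a solution solves a linear equation whose coefficients depend on time through the solution itself.
  Time runs over a closed interval and is never differentiated here, so continuity in it is enough.
  All equations are scaled to time 1 and Lipschitz constant 1/2, which replaces both continuation of
  solutions and Gronwall's inequality.\<close>

text \<open>\<open>f t\<close> is of class \<open>C\<^sup>k\<close> on \<open>S\<close> for every \<open>t \<in> T\<close>, with derivatives jointly continuous in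
  \<open>t\<close> and the point. For constant \<open>f\<close> in \<open>t\<close> this is \<^const>\<open>cont_diff_on\<close>, so both share one calculus.\<close>

primrec pcd :: "nat \<Rightarrow> real set \<Rightarrow> 'a::euclidean_space set \<Rightarrow> (real \<Rightarrow> 'a \<Rightarrow> 'b::real_normed_vector) \<Rightarrow> bool" where
  "pcd 0 T S f \<longleftrightarrow> continuous_on (T \<times> S) (\<lambda>z. f (fst z) (snd z))"
| "pcd (Suc k) T S f \<longleftrightarrow>
     continuous_on (T \<times> S) (\<lambda>z. f (fst z) (snd z)) \<and>
     (\<forall>t\<in>T. \<forall>x\<in>S. f t differentiable (at x)) \<and>
     (\<forall>v. pcd k T S (\<lambda>t x. frechet_derivative (f t) (at x) v))"

lemma pcd_continuous: "pcd k T S f \<Longrightarrow> continuous_on (T \<times> S) (\<lambda>z. f (fst z) (snd z))"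
  by (cases k) auto

lemma pcd_has_derivative:
  assumes "pcd (Suc k) T S f" "t \<in> T" "x \<in> S"
  shows "(f t has_derivative frechet_derivative (f t) (at x)) (at x)"
  using assms by (auto simp: frechet_derivative_works)

text \<open>\<open>frechet_derivative\<close> is a choice from the set of all derivatives. Locally
  equal functions have the same set, so the chosen maps agree even where no derivative
  exists.\<close>

lemma frechet_derivative_cong_open:
  assumes "open S" "x \<in> S" "\<And>y. y \<in> S \<Longrightarrow> f y = g y"
  shows "frechet_derivative f (at x) = frechet_derivative g (at x)"
proof -
  have "(f has_derivative D) (at x) \<longleftrightarrow> (g has_derivative D) (at x)" for D
  proof
    show "(g has_derivative D) (at x)" if "(f has_derivative D) (at x)"
      by (rule has_derivative_transform_within_open[OF that assms(1,2)]) (rule assms(3))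
    show "(f has_derivative D) (at x)" if "(g has_derivative D) (at x)"
      by (rule has_derivative_transform_within_open[OF that assms(1,2)]) (rule assms(3)[symmetric])
  qed
  then show ?thesis by (simp add: frechet_derivative_def)
qed

lemma pcd_cong:
  assumes "open S" "\<And>t x. t \<in> T \<Longrightarrow> x \<in> S \<Longrightarrow> f t x = g t x" "pcd k T S f"
  shows "pcd k T S g"
  using assms(2,3)
proof (induction k arbitrary: f g)
  case 0
  then show ?case by (auto elim!: continuous_on_eq)
next
  case (Suc k)
  have c: "continuous_on (T \<times> S) (\<lambda>z. g (fst z) (snd z))"
    using Suc.prems by (auto elim!: continuous_on_eq)
  have d: "g t differentiable at x" if "t \<in> T" "x \<in> S" for t x
    using has_derivative_transform_within_open[OF pcd_has_derivative[OF Suc.prems(2) that] \<open>open S\<close> that(2)]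
      Suc.prems(1)[OF that(1)] by (metis differentiableI)
  have "pcd k T S (\<lambda>t x. frechet_derivative (g t) (at x) v)" for v
    by (rule Suc.IH[of "\<lambda>t x. frechet_derivative (f t) (at x) v"])
      (use Suc.prems frechet_derivative_cong_open[OF \<open>open S\<close>, of _ "f _" "g _"] in \<open>auto\<close>)
  with c d show ?case by simp
qed

text \<open>Allows the derivative to be given by an explicit formula \<open>f'\<close>; the
  inductions below then never have to compute \<open>frechet_derivative\<close> of a compound
  function.\<close>

lemma pcd_SucI:
  assumes "open S" "continuous_on (T \<times> S) (\<lambda>z. f (fst z) (snd z))"
    and D: "\<And>t x. t \<in> T \<Longrightarrow> x \<in> S \<Longrightarrow> (f t has_derivative f' t x) (at x)"
    and k: "\<And>v. pcd k T S (\<lambda>t x. f' t x v)"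
  shows "pcd (Suc k) T S f"
proof -
  have "frechet_derivative (f t) (at x) = f' t x" if "t \<in> T" "x \<in> S" for t x
    using D[OF that] by (metis frechet_derivative_at)
  then have "pcd k T S (\<lambda>t x. frechet_derivative (f t) (at x) v)" for v
    by (intro pcd_cong[OF \<open>open S\<close> _ k[of v]]) auto
  with assms show ?thesis by (auto intro: differentiableI)
qed

lemma pcd_mono_Suc: "pcd (Suc k) T S f \<Longrightarrow> pcd k T S f"
proof (induction k arbitrary: f)
  case (Suc k)
  from Suc.prems have "pcd (Suc k) T S (\<lambda>t x. frechet_derivative (f t) (at x) v)" for v
    by simp
  from Suc.IH[OF this] Suc.prems show ?case by simp
qed auto

lemma pcd_subset:
  "pcd k T S f \<Longrightarrow> T' \<subseteq> T \<Longrightarrow> S' \<subseteq> S \<Longrightarrow> pcd k T' S' f"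
  by (induction k arbitrary: f) (auto elim!: continuous_on_subset[of "T \<times> S"], blast)

lemma pcd_const: "pcd k T S (\<lambda>t x. c)"
  by (induction k arbitrary: c) auto

lemma pcd_bounded_linear_snd:
  assumes "bounded_linear L" "open S"
  shows "pcd k T S (\<lambda>t x. L x)"
proof -
  have c: "continuous_on (T \<times> S) (\<lambda>z. L (snd z))"
    by (intro bounded_linear.continuous_on[OF assms(1)] continuous_intros)
  show ?thesis
  proof (cases k)
    case 0 with c show ?thesis by simp
  next
    case (Suc j)
    show ?thesis unfolding Suc
      by (rule pcd_SucI[OF \<open>open S\<close> c bounded_linear_imp_has_derivative[OF assms(1)] pcd_const])
  qed
qed

lemma pcd_add:
  assumes "open S" "pcd k T S f" "pcd k T S g"
  shows "pcd k T S (\<lambda>t x. f t x + g t x)"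
  using assms(2,3)
proof (induction k arbitrary: f g)
  case 0
  then show ?case by (auto intro!: continuous_intros)
next
  case (Suc k)
  show ?case
  proof (rule pcd_SucI[OF \<open>open S\<close>])
    show "continuous_on (T \<times> S) (\<lambda>z. f (fst z) (snd z) + g (fst z) (snd z))"
      using Suc.prems by (auto intro!: continuous_intros)
    show "((\<lambda>x. f t x + g t x) has_derivative
        (\<lambda>v. frechet_derivative (f t) (at x) v + frechet_derivative (g t) (at x) v)) (at x)"
      if "t \<in> T" "x \<in> S" for t x
      using has_derivative_add[OF pcd_has_derivative[OF Suc.prems(1) that]
         pcd_has_derivative[OF Suc.prems(2) that]] .
  qed (use Suc in auto)
qed

lemma pcd_sum:
  assumes "open S" "\<And>i. i \<in> I \<Longrightarrow> pcd k T S (f i)"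
  shows "pcd k T S (\<lambda>t x. \<Sum>i\<in>I. f i t x)"
  using assms(2)
proof (induction I rule: infinite_finite_induct)
  case (insert i I)
  then show ?case using pcd_add[OF assms(1), of k T "f i" "\<lambda>t x. \<Sum>i\<in>I. f i t x"] by simp
qed (auto simp: pcd_const)

lemma pcd_bounded_linear:
  assumes "open S" "bounded_linear L" "pcd k T S f"
  shows "pcd k T S (\<lambda>t x. L (f t x))"
  using assms(3)
proof (induction k arbitrary: f)
  case 0
  then show ?case by (auto intro!: bounded_linear.continuous_on[OF assms(2)])
next
  case (Suc k)
  show ?case
  proof (rule pcd_SucI[OF \<open>open S\<close>])
    show "continuous_on (T \<times> S) (\<lambda>z. L (f (fst z) (snd z)))"
      using Suc.prems by (auto intro!: bounded_linear.continuous_on[OF assms(2)])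
    show "((\<lambda>x. L (f t x)) has_derivative
        (\<lambda>v. L (frechet_derivative (f t) (at x) v))) (at x)"
      if "t \<in> T" "x \<in> S" for t x
      by (rule bounded_linear.has_derivative[OF assms(2) pcd_has_derivative[OF Suc.prems that]])
  qed (use Suc in auto)
qed

lemma pcd_bilinear:
  assumes "open S" "bounded_bilinear B" "pcd k T S f" "pcd k T S g"
  shows "pcd k T S (\<lambda>t x. B (f t x) (g t x))"
  using assms(3,4)
proof (induction k arbitrary: f g)
  case 0
  then show ?case by (auto intro!: bounded_bilinear.continuous_on[OF assms(2)])
next
  case (Suc k)
  show ?case
  proof (rule pcd_SucI[OF \<open>open S\<close>])
    show "continuous_on (T \<times> S) (\<lambda>z. B (f (fst z) (snd z)) (g (fst z) (snd z)))"
      using Suc.prems by (auto intro!: bounded_bilinear.continuous_on[OF assms(2)])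
    show "((\<lambda>x. B (f t x) (g t x)) has_derivative
        (\<lambda>v. B (f t x) (frechet_derivative (g t) (at x) v) + B (frechet_derivative (f t) (at x) v) (g t x))) (at x)"
      if "t \<in> T" "x \<in> S" for t x
      by (rule bounded_bilinear.FDERIV[OF assms(2) pcd_has_derivative[OF Suc.prems(1) that] pcd_has_derivative[OF Suc.prems(2) that]])
    \<comment> \<open>The product rule leaves one factor undifferentiated; it has class k + 1 and is
      demoted to class k.\<close>
    show "pcd k T S (\<lambda>t x. B (f t x) (frechet_derivative (g t) (at x) v) + B (frechet_derivative (f t) (at x) v) (g t x))" for v
      using Suc.prems pcd_mono_Suc[OF Suc.prems(1)] pcd_mono_Suc[OF Suc.prems(2)]
      by (intro pcd_add[OF \<open>open S\<close>] Suc.IH) auto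
  qed
qed

lemma linear_Basis_expand:
  fixes D :: "'a::euclidean_space \<Rightarrow> 'b::real_normed_vector"
  assumes "linear D"
  shows "D v = (\<Sum>b\<in>Basis. (v \<bullet> b) *\<^sub>R D b)"
proof -
  have "D v = D (\<Sum>b\<in>Basis. (v \<bullet> b) *\<^sub>R b)" by (simp add: euclidean_representation)
  also have "\<dots> = (\<Sum>b\<in>Basis. (v \<bullet> b) *\<^sub>R D b)"
    using assms by (simp add: linear_sum linear_scale)
  finally show ?thesis .
qed

text \<open>The chain rule applies the derivative of \<open>f t\<close> in a direction that varies
  with the point, whereas \<open>pcd\<close> controls fixed directions only. Expanding the direction
  in the standard basis turns the derivative into a finite sum of products of functions of class
  k.\<close>

lemma pcd_compose:
  fixes g :: "real \<Rightarrow> 'a::euclidean_space \<Rightarrow> 'c::euclidean_space"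
  assumes "open S" "pcd k T S' f" "pcd k T S g" "\<And>t x. t \<in> T \<Longrightarrow> x \<in> S \<Longrightarrow> g t x \<in> S'"
  shows "pcd k T S (\<lambda>t x. f t (g t x))"
  using assms(2,3)
proof (induction k arbitrary: f)
  have c: "continuous_on (T \<times> S) (\<lambda>z. f (fst z) (g (fst z) (snd z)))" 
    if f: "continuous_on (T \<times> S') (\<lambda>z. f (fst z) (snd z))" and "pcd k T S g" for f :: "real \<Rightarrow> 'c \<Rightarrow> 'b" and k
    using continuous_on_compose2[OF f, of "T \<times> S" "\<lambda>z. (fst z, g (fst z) (snd z))"] assms(4) 
      pcd_continuous[OF that(2)]
    by (force intro!: continuous_intros)
  {
    case 0
    then show ?case using c[of f 0] by auto
  next
    case (Suc k)
    have lin: "linear (frechet_derivative (f t) (at (g t x)))" if "t \<in> T" "x \<in> S" for t x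
      using pcd_has_derivative[OF Suc.prems(1) that(1) assms(4)[OF that]] has_derivative_linear by blast
    show ?case
    proof (rule pcd_SucI[OF \<open>open S\<close>])
      show "continuous_on (T \<times> S) (\<lambda>z. f (fst z) (g (fst z) (snd z)))"
        using c[OF pcd_continuous[OF Suc.prems(1)] Suc.prems(2)] .
      show "((\<lambda>x. f t (g t x)) has_derivative
        (\<lambda>v. \<Sum>b\<in>Basis. (frechet_derivative (g t) (at x) v \<bullet> b) *\<^sub>R frechet_derivative (f t) (at (g t x)) b)) (at x)"
        if "t \<in> T" "x \<in> S" for t x
        using has_derivative_compose[OF pcd_has_derivative[OF Suc.prems(2) that] pcd_has_derivative[OF Suc.prems(1) that(1) assms(4)[OF that]]]
        unfolding linear_Basis_expand[OF lin[OF that], symmetric] .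
      show "pcd k T S (\<lambda>t x. \<Sum>b\<in>Basis. (frechet_derivative (g t) (at x) v \<bullet> b) *\<^sub>R frechet_derivative (f t) (at (g t x)) b)" for v
        by (intro pcd_sum[OF \<open>open S\<close>] pcd_bilinear[OF \<open>open S\<close> bounded_bilinear_scaleR]
            pcd_bounded_linear[OF \<open>open S\<close> bounded_linear_inner_left] Suc.IH pcd_mono_Suc[OF Suc.prems(2)])
          (use Suc.prems in auto)
    qed
  }
qed

section \<open>Passage between parametrised and plain differentiability\<close>

lemma cont_diff_on_imp_continuous:
  assumes "cont_diff_on k S f"
  shows "continuous_on S f"
  using assms
  by (cases k) (auto intro!: continuous_at_imp_continuous_on differentiable_imp_continuous_within)

lemma continuous_on_snd_Times: "continuous_on S f \<Longrightarrow> continuous_on (T \<times> S) (\<lambda>z. f (snd z))"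
  by (rule continuous_on_compose2[of S f _ snd]) (auto intro!: continuous_intros)

lemma cont_diff_on_imp_pcd: "cont_diff_on k S f \<Longrightarrow> pcd k T S (\<lambda>t. f)"
proof (induction k arbitrary: f)
  case 0
  then show ?case using continuous_on_snd_Times by auto
next
  case (Suc k)
  then show ?case
    using continuous_on_snd_Times[OF cont_diff_on_imp_continuous[OF Suc.prems]] by auto
qed

lemma pcd_imp_cont_diff_on: "pcd k T S f \<Longrightarrow> t \<in> T \<Longrightarrow> cont_diff_on k S (f t)"
proof (induction k arbitrary: f)
  case 0
  have "continuous_on S (\<lambda>x. (\<lambda>z. f (fst z) (snd z)) (t, x))"
    by (rule continuous_on_compose2[of "T \<times> S"]) (use 0 in \<open>auto intro!: continuous_intros\<close>)
  then show ?case by simp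
qed auto

text \<open>The time set is a single point, not empty: over the empty set \<open>pcd\<close> holds
  vacuously.\<close>

lemma cont_diff_on_iff_pcd: "cont_diff_on k S f \<longleftrightarrow> pcd k {0} S (\<lambda>t. f)"
  using cont_diff_on_imp_pcd pcd_imp_cont_diff_on by blast

section \<open>Integral equations depending smoothly on parameters\<close>

lemma continuous_on_curry_compose:
  assumes "continuous_on (T \<times> S) (\<lambda>z. F (fst z) (snd z))" "continuous_on A g" "continuous_on A h"
    "\<And>a. a \<in> A \<Longrightarrow> g a \<in> T" "\<And>a. a \<in> A \<Longrightarrow> h a \<in> S"
  shows "continuous_on A (\<lambda>a. F (g a) (h a))"
proof -
  have "continuous_on A (\<lambda>a. (\<lambda>z. F (fst z) (snd z)) (g a, h a))"
    by (rule continuous_on_compose2[OF assms(1)]) (use assms in \<open>auto intro!: continuous_intros\<close>)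
  then show ?thesis by simp
qed

text \<open>At a point where \<open>norm (d t)\<close> is maximal the integral over an interval of
  length at most 1 bounds the maximum by half of itself plus \<open>c\<close>. With
  \<open>c = 0\<close> this gives uniqueness of solutions, with small \<open>c\<close> their
  continuity and differentiability in parameters.\<close>

lemma half_contraction_bound:
  fixes d g :: "real \<Rightarrow> 'a::euclidean_space"
  assumes d: "continuous_on {0..1} d" and g: "continuous_on {0..1} g"
    and eq: "\<And>t. t \<in> {0..1} \<Longrightarrow> d t = integral {0..t} g"
    and le: "\<And>t. t \<in> {0..1} \<Longrightarrow> norm (g t) \<le> norm (d t) / 2 + c"
    and t: "t \<in> {0..1}"
  shows "norm (d t) \<le> 2 * c"
proof -
  obtain m where m: "m \<in> {0..1}" "\<And>s. s \<in> {0..1} \<Longrightarrow> norm (d s) \<le> norm (d m)"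
    using continuous_attains_sup[of "{0..1::real}" "\<lambda>s. norm (d s)", OF _ _ continuous_on_norm[OF d]]
    by auto
  have b: "norm (g s) \<le> norm (d m) / 2 + c" if "s \<in> {0..1}" for s
    using le[OF that] m(2)[OF that] by simp
  have nn: "0 \<le> norm (d m) / 2 + c"
    using b[OF m(1)] norm_ge_zero order_trans by blast
  have "norm (d m) \<le> (norm (d m) / 2 + c) * (m - 0)"
    unfolding eq[OF m(1)]
    using m(1) b unfolding eq[OF m(1)]
    by (intro integral_bound continuous_on_subset[OF g]) auto
  also have "\<dots> \<le> (norm (d m) / 2 + c) * 1"
    using m(1) nn by (intro mult_left_mono) auto
  finally show ?thesis using m(2)[OF t] by simp
qed

lemma picard_exists:
  fixes G :: "real \<Rightarrow> 'a::euclidean_space \<Rightarrow> 'a"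
  assumes cont: "continuous_on ({0..1} \<times> UNIV) (\<lambda>z. G (fst z) (snd z))"
    and lip: "\<And>t x y. t \<in> {0..1} \<Longrightarrow> norm (G t x - G t y) \<le> norm (x - y) / 2"
  obtains u where "continuous_on {0..1} u"
    "\<And>t. t \<in> {0..1} \<Longrightarrow> u t = integral {0..t} (\<lambda>s. G s (u s))"
proof -
  have cG: "continuous_on {0..1} (\<lambda>s. G s (u s))" if "continuous_on {0..1} u" for u
    by (rule continuous_on_curry_compose[OF cont]) (use that in auto)
  have cI: "continuous_on {0..1} (\<lambda>t. integral {0..t} (\<lambda>s. G s (u s)))" if "continuous_on {0..1} u" for u
    by (intro indefinite_integral_continuous_1 integrable_continuous_real cG that)
  have cb: "continuous_on {0..1} (apply_bcontfun u)" for u :: "real \<Rightarrow>\<^sub>C 'a"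
    by (rule continuous_on_apply_bcontfun)
  \<comment> \<open>Functions on \<open>{0..1}\<close> are extended constantly by
    \<open>clamp\<close> to bounded continuous functions on the whole line. These form a complete
    space, on which the Picard operator contracts by 1/2 because the time interval has length
    1.\<close>
  have "\<exists>w :: real \<Rightarrow>\<^sub>C 'a. \<forall>t. apply_bcontfun w t =
      integral {0..clamp 0 1 t} (\<lambda>s. G s (apply_bcontfun u s))" for u
  proof -
    from cI[OF cb, of u] have "continuous_on (cbox 0 1) (\<lambda>t. integral {0..t} (\<lambda>s. G s (apply_bcontfun u s)))"
      by simp
    from continuous_on_cbox_bcontfunE[OF this] show ?thesis by metis
  qed
  then obtain T :: "(real \<Rightarrow>\<^sub>C 'a) \<Rightarrow> (real \<Rightarrow>\<^sub>C 'a)"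
    where T: "\<And>u t. apply_bcontfun (T u) t =
      integral {0..clamp 0 1 t} (\<lambda>s. G s (apply_bcontfun u s))" by metis
  have "dist (T u) (T v) \<le> 1/2 * dist u v" for u v
  proof (rule dist_bound)
    fix t :: real
    let ?t = "clamp 0 1 t"
    have t: "?t \<in> {0..1}" using clamp_in_interval[of 0 1 t] by simp
    have i: "(\<lambda>s. G s (apply_bcontfun w s)) integrable_on {0..?t}" for w
      using t by (intro integrable_continuous_real continuous_on_subset[OF cG[OF cb]]) auto
    have "dist (apply_bcontfun (T u) t) (apply_bcontfun (T v) t)
      = norm (integral {0..?t} (\<lambda>s. G s (apply_bcontfun u s) - G s (apply_bcontfun v s)))"
      by (simp add: T dist_norm integral_diff[OF i i])
    also have "\<dots> \<le> (dist u v / 2) * (?t - 0)"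
    proof (rule integral_bound)
      show "continuous_on {0..?t} (\<lambda>s. G s (apply_bcontfun u s) - G s (apply_bcontfun v s))"
        using t by (intro continuous_on_diff continuous_on_subset[OF cG[OF cb]]) auto
      show "norm (G s (apply_bcontfun u s) - G s (apply_bcontfun v s)) \<le> dist u v / 2" if "s \<in> {0..?t}" for s
        using lip[of s "apply_bcontfun u s" "apply_bcontfun v s"] that t dist_bounded[of u s v]
        by (auto simp: dist_norm)
    qed (use t in auto)
    also have "\<dots> \<le> (dist u v / 2) * 1" using t by (intro mult_left_mono) auto
    finally show "dist (apply_bcontfun (T u) t) (apply_bcontfun (T v) t) \<le> 1/2 * dist u v" by simp
  qed
  then obtain u where u: "T u = u"
    using banach_fix_type[of "1/2" T] by auto
  show ?thesis
  proof
    show "continuous_on {0..1} (apply_bcontfun u)" by (rule cb)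
    fix t :: real assume "t \<in> {0..1}"
    then show "apply_bcontfun u t = integral {0..t} (\<lambda>s. G s (apply_bcontfun u s))"
      using T[of u t] u clamp_cancel_cbox[of t 0 1] by simp
  qed
qed

lemma norm_linear_le_Basis:
  fixes L :: "'a::euclidean_space \<Rightarrow> 'b::real_normed_vector"
  assumes "linear L"
  shows "norm (L v) \<le> (\<Sum>b\<in>Basis. norm (L b)) * norm v"
proof -
  have "norm (L v) \<le> (\<Sum>b\<in>Basis. norm ((v \<bullet> b) *\<^sub>R L b))"
    unfolding linear_Basis_expand[OF assms, of v] by (rule norm_sum)
  also have "\<dots> \<le> (\<Sum>b\<in>Basis. norm (L b) * norm v)"
    by (intro sum_mono) (auto simp: mult.commute[of "norm (L _)"] Basis_le_norm mult_right_mono)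
  finally show ?thesis by (simp add: sum_distrib_right)
qed

text \<open>The curve \<open>z\<close> over the compact interval has a tube of fixed radius inside
  \<open>S\<close>, and near the curve the derivative varies little, uniformly in time. The mean
  value inequality on a ball then gives one \<open>d\<close> for all times.\<close>

lemma pcd_uniformly_differentiable:
  fixes z :: "real \<Rightarrow> 'a::euclidean_space" and F :: "real \<Rightarrow> 'a \<Rightarrow> 'b::real_normed_vector"
  assumes S: "open S" and F: "pcd (Suc 0) {0..1} S F"
    and z: "continuous_on {0..1} z" "\<And>t. t \<in> {0..1} \<Longrightarrow> z t \<in> S" and e: "e > 0"
  obtains d where "d > 0" "\<And>t h. t \<in> {0..1} \<Longrightarrow> norm h < d \<Longrightarrow> z t + h \<in> S \<and>
     norm (F t (z t + h) - F t (z t) - frechet_derivative (F t) (at (z t)) h) \<le> e * norm h"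
proof -
  define D where "D t x = frechet_derivative (F t) (at x)" for t x
  have D: "(F t has_derivative D t x) (at x)" if "t \<in> {0..1}" "x \<in> S" for t x
    using pcd_has_derivative[OF F that] by (simp add: D_def)
  have cD: "continuous_on ({0..1} \<times> S) (\<lambda>z. D (fst z) (snd z) b)" for b
    using F by (simp add: D_def)
  have lin: "linear (D t x)" if "t \<in> {0..1}" "x \<in> S" for t x
    using D[OF that] by (rule has_derivative_linear)
  have "compact (z ` {0..1})" "z ` {0..1} \<subseteq> S"
    using z by (auto intro!: compact_continuous_image)
  then obtain r where r: "r > 0" and rS': "(\<Union>x\<in>z ` {0..1}. ball x r) \<subseteq> S"
    using compact_subset_open_imp_ball_epsilon_subset[OF _ S] by metis
  have rS: "ball (z t) r \<subseteq> S" if "t \<in> {0..1}" for t using rS' that by fast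
  \<comment> \<open>\<open>\<phi> (h, t)\<close> measures how far the derivative at
    \<open>z t + h\<close> is from the one at \<open>z t\<close>. It vanishes for
    \<open>h = 0\<close>, so compactness of \<open>{0..1}\<close> makes it at most \<open>e\<close>
    for all times once \<open>h\<close> is small.\<close>
  define \<phi> where "\<phi> q = (\<Sum>b\<in>Basis. norm (D (snd q) (z (snd q) + fst q) b - D (snd q) (z (snd q)) b))" for q
  have zin: "z t + h \<in> S" if "t \<in> {0..1}" "norm h < r" for t h
    using rS[OF that(1)] that(2) by (auto simp: subset_eq dist_norm)
  have "continuous_on (ball 0 r \<times> {0..1}) \<phi>"
    unfolding \<phi>_def
  proof (intro continuous_on_sum continuous_on_norm continuous_on_diff)
    fix b :: 'a
    have cz: "continuous_on (ball 0 r \<times> {0..1}) (\<lambda>q. z (snd q))"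
      by (rule continuous_on_compose2[OF z(1)]) (auto intro!: continuous_intros)
    have "continuous_on (ball 0 r \<times> {0..1}) (\<lambda>q. (\<lambda>z. D (fst z) (snd z) b) (snd q, z (snd q) + fst q))"
      by (rule continuous_on_compose2[OF cD]) (auto intro!: continuous_intros cz zin)
    then show "continuous_on (ball 0 r \<times> {0..1}) (\<lambda>q. D (snd q) (z (snd q) + fst q) b)" by simp
    have "continuous_on (ball 0 r \<times> {0..1}) (\<lambda>q. (\<lambda>z. D (fst z) (snd z) b) (snd q, z (snd q)))"
      by (rule continuous_on_compose2[OF cD]) (use z in \<open>auto intro!: continuous_intros cz\<close>)
    then show "continuous_on (ball 0 r \<times> {0..1}) (\<lambda>q. D (snd q) (z (snd q)) b)" by simp
  qed
  then obtain X0 where X0: "0 \<in> X0" "open X0"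
    and X0': "\<forall>h\<in>X0 \<inter> ball 0 r. \<forall>t\<in>{0..1}. dist (\<phi> (h, t)) (\<phi> (0, t)) \<le> e"
    by (rule continuous_on_prod_compactE[of "ball 0 r" "{0..1}" \<phi> 0 e]) (use r e in auto)
  obtain d0 where d0: "d0 > 0" "ball 0 d0 \<subseteq> X0" using openE[OF X0(2,1)] by metis
  define d where "d = min d0 r"
  show ?thesis
  proof
    show "d > 0" using d0 r by (simp add: d_def)
    fix t :: real and h :: 'a assume t: "t \<in> {0..1}" and h: "norm h < d"
    have "norm (F t (z t + h) - F t (z t) - D t (z t) (z t + h - z t)) \<le> norm (z t + h - z t) * e"
    proof (rule differentiable_bound_linearization[where S = "ball (z t) d"])
      show "z t + s *\<^sub>R (z t + h - z t) \<in> ball (z t) d" if "s \<in> {0..1}" for s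
      proof -
        have "\<bar>s\<bar> * norm h \<le> 1 * norm h" using that by (intro mult_right_mono) auto
        then show ?thesis using h by (simp add: dist_norm)
      qed
      fix x assume x: "x \<in> ball (z t) d"
      then have xh: "norm (x - z t) < d" by (simp add: dist_norm norm_minus_commute)
      have xS: "x \<in> S" using zin[OF t, of "x - z t"] xh by (simp add: d_def)
      show "(F t has_derivative D t x) (at x within ball (z t) d)"
        using D[OF t xS] has_derivative_at_withinI by blast
      have "dist (\<phi> (x - z t, t)) (\<phi> (0, t)) \<le> e"
        using xh t d0 by (intro X0'[rule_format]) (auto simp: d_def subset_eq dist_norm norm_minus_commute)
      then have le: "(\<Sum>b\<in>Basis. norm (D t x b - D t (z t) b)) \<le> e"
        by (auto simp: \<phi>_def dist_real_def)
      have "linear (D t x - D t (z t))"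
        unfolding fun_diff_def
        by (intro linear_compose_sub lin t xS z)
      from norm_linear_le_Basis[OF this]
      have "norm ((D t x - D t (z t)) v) \<le> e * norm v" for v
        using le by (fastforce intro: order_trans mult_right_mono)
      then show "onorm (D t x - D t (z t)) \<le> e" by (rule onorm_le)
    qed (use d0 r in \<open>auto simp: d_def\<close>)
    then show "z t + h \<in> S \<and> norm (F t (z t + h) - F t (z t) - frechet_derivative (F t) (at (z t)) h) \<le> e * norm h"
      using zin[OF t, of h] h by (simp add: D_def d_def mult.commute)
  qed
qed

text \<open>A bound for difference quotients survives the limit. It passes the contraction constant
  of a right-hand side on to its linearisation.\<close>

lemma has_derivative_norm_le_lipschitz:
  fixes f :: "'a::real_normed_vector \<Rightarrow> 'b::real_normed_vector"
  assumes D: "(f has_derivative D) (at x)"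
    and r: "r > 0" "\<And>s. \<bar>s\<bar> < r \<Longrightarrow> norm (f (x + s *\<^sub>R v) - f x) \<le> c * \<bar>s\<bar>"
  shows "norm (D v) \<le> c"
proof (rule field_le_epsilon)
  fix e :: real assume e: "e > 0"
  define e' where "e' = e / (norm v + 1)"
  have e': "e' > 0" using e by (simp add: e'_def add_nonneg_pos)
  obtain d where d: "d > 0"
    "\<And>y. norm (y - x) < d \<Longrightarrow> norm (f y - f x - D (y - x)) \<le> e' * norm (y - x)"
    using D e' unfolding has_derivative_at_alt by blast
  \<comment> \<open>The summand 1 covers \<open>v = 0\<close>; the choice gives both
    \<open>s < r\<close> and \<open>s * norm v < d\<close>.\<close>
  define s where "s = min r d / (2 * (norm v + 1))"
  have s: "s > 0" using r d by (simp add: s_def add_nonneg_pos)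
  have "norm v + 1 \<noteq> 0" using norm_ge_zero[of v] by linarith
  then have "s * (norm v + 1) = min r d / 2" by (simp add: s_def field_simps)
  then have "s * norm v + s = min r d / 2" by (simp add: algebra_simps)
  moreover have "s * norm v \<ge> 0" using s by simp
  ultimately have s2: "s * norm v < d" "s < r" using s r d by linarith+
  have "norm (f (x + s *\<^sub>R v) - f x - D (s *\<^sub>R v)) \<le> e' * (s * norm v)"
    using d(2)[of "x + s *\<^sub>R v"] s s2 by simp
  moreover have "norm (f (x + s *\<^sub>R v) - f x) \<le> c * s"
    using r(2)[of s] s s2 by simp
  ultimately have "norm (D (s *\<^sub>R v)) \<le> c * s + e' * (s * norm v)"
    using norm_triangle_ineq4[of "f (x + s *\<^sub>R v) - f x" "f (x + s *\<^sub>R v) - f x - D (s *\<^sub>R v)"] by simp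
  then have "s * norm (D v) \<le> s * (c + e' * norm v)"
    using s linear_scale[OF has_derivative_linear[OF D]] by (simp add: algebra_simps)
  then have "norm (D v) \<le> c + e' * norm v" using s by simp
  also have "e' * norm v \<le> e' * (norm v + 1)" using e' by simp
  also have "e' * (norm v + 1) = e"
    unfolding e'_def by simp (metis add_nonneg_eq_0_iff norm_ge_zero zero_le_one zero_neq_one)
  finally show "norm (D v) \<le> c + e" by simp
qed

text \<open>The solution for \<open>p0\<close> satisfies the equation for a nearby \<open>p\<close>
  up to an error that is small uniformly in time, since \<open>{0..1}\<close> is compact. By
  \<open>half_contraction_bound\<close> the two solutions differ by at most twice that
  error.\<close>

lemma ode_continuous:
  fixes F :: "real \<Rightarrow> 'p::euclidean_space \<times> 'a::euclidean_space \<Rightarrow> 'a" and x :: "real \<Rightarrow> 'p \<Rightarrow> 'a"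
  assumes F: "continuous_on ({0..1} \<times> (N \<times> X)) (\<lambda>z. F (fst z) (snd z))"
    and lip: "\<And>t p y z. t \<in> {0..1} \<Longrightarrow> p \<in> N \<Longrightarrow> y \<in> X \<Longrightarrow> z \<in> X \<Longrightarrow>
      norm (F t (p, y) - F t (p, z)) \<le> norm (y - z) / 2"
    and cont: "\<And>p. p \<in> N \<Longrightarrow> continuous_on {0..1} (\<lambda>t. x t p)"
    and mem: "\<And>t p. t \<in> {0..1} \<Longrightarrow> p \<in> N \<Longrightarrow> x t p \<in> X"
    and eq: "\<And>t p. t \<in> {0..1} \<Longrightarrow> p \<in> N \<Longrightarrow> x t p = integral {0..t} (\<lambda>s. F s (p, x s p))"
    and N: "open N"
  shows "continuous_on ({0..1} \<times> N) (\<lambda>z. x (fst z) (snd z))"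
proof -
  have cF: "continuous_on {0..1} (\<lambda>s. F s (p, u s))"
    if "p \<in> N" "continuous_on {0..1} u" "\<And>s. s \<in> {0..1} \<Longrightarrow> u s \<in> X" for p u
    by (rule continuous_on_curry_compose[OF F]) (use that in \<open>auto intro!: continuous_intros\<close>)
  have key: "\<exists>Y. open Y \<and> p0 \<in> Y \<and> (\<forall>p\<in>Y. p \<in> N \<longrightarrow> (\<forall>t\<in>{0..1}. norm (x t p - x t p0) \<le> e))"
    if p0: "p0 \<in> N" and e: "e > 0" for p0 e
  proof -
    have "continuous_on (N \<times> {0..1}) (\<lambda>q. (\<lambda>z. F (fst z) (snd z)) (snd q, (fst q, x (snd q) p0)))"
      by (rule continuous_on_compose2[OF F])
        (use mem[OF _ p0] in \<open>auto intro!: continuous_intros continuous_on_compose2[OF cont[OF p0]]\<close>)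
    then have "continuous_on (N \<times> {0..1}) (\<lambda>q. F (snd q) (fst q, x (snd q) p0))" by simp
    from this compact_Icc p0 half_gt_zero[OF e] obtain Y where Y: "p0 \<in> Y" "open Y"
      and "\<forall>p\<in>Y \<inter> N. \<forall>t\<in>{0..1}. dist (F (snd (p, t)) (fst (p, t), x (snd (p, t)) p0))
        (F (snd (p0, t)) (fst (p0, t), x (snd (p0, t)) p0)) \<le> e/2"
      by (rule continuous_on_prod_compactE)
    then have Y3: "dist (F t (p, x t p0)) (F t (p0, x t p0)) \<le> e/2"
      if "p \<in> Y" "p \<in> N" "t \<in> {0..1}" for p t using that by simp
    have "norm (x t p - x t p0) \<le> 2 * (e/2)" if p: "p \<in> Y" "p \<in> N" and t: "t \<in> {0..1}" for p t
    proof (rule half_contraction_bound[OF _ _ _ _ t, where g = "\<lambda>s. F s (p, x s p) - F s (p0, x s p0)"])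
      show "continuous_on {0..1} (\<lambda>t. x t p - x t p0)"
        using cont p0 p by (auto intro!: continuous_intros)
      show "continuous_on {0..1} (\<lambda>s. F s (p, x s p) - F s (p0, x s p0))"
        using cont p0 p mem by (auto intro!: continuous_on_diff cF)
      show "x t p - x t p0 = integral {0..t} (\<lambda>s. F s (p, x s p) - F s (p0, x s p0))" if "t \<in> {0..1}" for t
        unfolding eq[OF that p(2)] eq[OF that p0] using that p0 p mem cont
        by (intro integral_diff[symmetric] integrable_continuous_real continuous_on_subset[OF cF]) auto
      show "norm (F s (p, x s p) - F s (p0, x s p0)) \<le> norm (x s p - x s p0) / 2 + e/2" if s: "s \<in> {0..1}" for s
      proof -
        have "norm (F s (p, x s p) - F s (p0, x s p0)) \<le> norm (F s (p, x s p) - F s (p, x s p0))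
           + norm (F s (p, x s p0) - F s (p0, x s p0))"
          by (metis diff_add_cancel add_diff_eq norm_triangle_ineq)
        then show ?thesis
          using lip[OF s p(2) mem[OF s p(2)] mem[OF s p0]] Y3[OF p s] by (simp add: dist_norm)
      qed
    qed
    with Y show ?thesis by (intro exI[of _ Y]) auto
  qed
  show ?thesis
    unfolding continuous_on_iff
  proof clarsimp
    fix t0 :: real and p0 and e :: real
    assume t0: "0 \<le> t0" "t0 \<le> 1" and p0: "p0 \<in> N" and e: "e > 0"
    from key[OF p0, of "e/2"] e obtain Y where Y: "open Y" "p0 \<in> Y"
      "\<And>p t. p \<in> Y \<Longrightarrow> p \<in> N \<Longrightarrow> t \<in> {0..1} \<Longrightarrow> norm (x t p - x t p0) \<le> e/2" by auto
    obtain d1 where d1: "d1 > 0" "ball p0 d1 \<subseteq> Y" using openE[OF Y(1,2)] by metis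
    have "\<exists>d>0. \<forall>t\<in>{0..1}. dist t t0 < d \<longrightarrow> dist (x t p0) (x t0 p0) < e/2"
      using cont[OF p0] t0 e unfolding continuous_on_iff by (meson atLeastAtMost_iff half_gt_zero)
    then obtain d2 where d2: "d2 > 0" "\<And>t. t \<in> {0..1} \<Longrightarrow> dist t t0 < d2 \<Longrightarrow> dist (x t p0) (x t0 p0) < e/2"
      by blast
    have "dist (x t p) (x t0 p0) < e"
      if t: "0 \<le> t" "t \<le> 1" and p: "p \<in> N" and d: "dist (t, p) (t0, p0) < min d1 d2" for t p
    proof -
      have a: "dist t t0 < d2" "dist p p0 < d1"
        using d dist_fst_le[of "(t, p)" "(t0, p0)"] dist_snd_le[of "(t, p)" "(t0, p0)"] by auto
      have "dist (x t p) (x t p0) \<le> e/2"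
        using Y(3)[OF _ p, of t] d1 t a by (auto simp: dist_norm subset_eq norm_minus_commute)
      moreover have "dist (x t p0) (x t0 p0) < e/2" using d2(2)[of t] t a by auto
      ultimately show ?thesis using dist_triangle[of "x t p" "x t0 p0" "x t p0"] by linarith
    qed
    then show "\<exists>d>0. \<forall>t\<in>{0..1}. \<forall>p\<in>N. dist (t, p) (t0, p0) < d \<longrightarrow> dist (x t p) (x t0 p0) < e"
      using d1 d2 by (intro exI[of _ "min d1 d2"]) auto
  qed
qed

text \<open>Induction on \<open>k\<close>: the derivative of the solution in a direction \<open>v\<close> solves the linearised equation, whose
  right-hand side is again a contraction and, by the induction hypothesis for the solution itself, of
  class \<open>C\<^sup>k\<close>; so the induction hypothesis also applies to it.\<close>

lemma ode_pcd:
  fixes F :: "real \<Rightarrow> 'p::euclidean_space \<times> 'a::euclidean_space \<Rightarrow> 'a" and x :: "real \<Rightarrow> 'p \<Rightarrow> 'a"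
  assumes N: "open N" and X: "open X" and F: "pcd k {0..1} (N \<times> X) F"
    and lip: "\<And>t p y z. t \<in> {0..1} \<Longrightarrow> p \<in> N \<Longrightarrow> y \<in> X \<Longrightarrow> z \<in> X \<Longrightarrow>
      norm (F t (p, y) - F t (p, z)) \<le> norm (y - z) / 2"
    and cont: "\<And>p. p \<in> N \<Longrightarrow> continuous_on {0..1} (\<lambda>t. x t p)"
    and mem: "\<And>t p. t \<in> {0..1} \<Longrightarrow> p \<in> N \<Longrightarrow> x t p \<in> X"
    and eq: "\<And>t p. t \<in> {0..1} \<Longrightarrow> p \<in> N \<Longrightarrow> x t p = integral {0..t} (\<lambda>s. F s (p, x s p))"
  shows "pcd k {0..1} N x"
  using X F lip cont mem eq
proof (induction k arbitrary: F X x)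
  case 0
  show ?case
    using ode_continuous[OF _ 0(3-6) N] 0(2) by simp
next
  case (Suc k)
  note X = Suc.prems(1) and F = Suc.prems(2) and lip = Suc.prems(3) and cont = Suc.prems(4)
    and mem = Suc.prems(5) and eq = Suc.prems(6)
  have op: "open (N \<times> X)" using N X by (rule open_Times)
  have xk: "pcd k {0..1} N x"
    by (rule Suc.IH[OF X pcd_mono_Suc[OF F] lip cont mem eq])
  have cx: "continuous_on ({0..1} \<times> N) (\<lambda>z. x (fst z) (snd z))"
    by (rule ode_continuous[OF pcd_continuous[OF F] lip cont mem eq N])
  define D where "D t z = frechet_derivative (F t) (at z)" for t z
  have D: "(F t has_derivative D t (p, y)) (at (p, y))" if "t \<in> {0..1}" "p \<in> N" "y \<in> X" for t p y
    unfolding D_def by (rule pcd_has_derivative[OF F]) (use that in auto)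
  have lin: "linear (D t (p, y))" if "t \<in> {0..1}" "p \<in> N" "y \<in> X" for t p y
    using D[OF that] by (rule has_derivative_linear)
  \<comment> \<open>Difference quotients in the state direction are bounded by the Lipschitz
    constant, so the linearised equation is again a contraction with constant 1/2, now on the whole
    state space.\<close>
  have D2: "norm (D t (p, z) (0, y)) \<le> norm y / 2" if t: "t \<in> {0..1}" "p \<in> N" "z \<in> X" for t p z y
  proof -
    obtain r where r: "r > 0" "ball z r \<subseteq> X" using openE[OF X t(3)] by metis
    show ?thesis
    proof (rule has_derivative_norm_le_lipschitz[OF D[OF t]])
      show "r / (norm y + 1) > 0" using r by (simp add: add_nonneg_pos)
      fix s assume s: "\<bar>s\<bar> < r / (norm y + 1)"
      have "\<bar>s\<bar> * norm y \<le> \<bar>s\<bar> * (norm y + 1)" by (intro mult_left_mono) auto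
      also have "\<dots> < r" using s norm_ge_zero[of y] by (simp add: pos_less_divide_eq)
      finally have "z + s *\<^sub>R y \<in> X" using r by (auto simp: subset_eq dist_norm)
      then show "norm (F t ((p, z) + s *\<^sub>R (0, y)) - F t (p, z)) \<le> norm y / 2 * \<bar>s\<bar>"
        using lip[OF t(1,2) _ t(3), of "z + s *\<^sub>R y"] by (simp add: mult.commute)
    qed
  qed
  \<comment> \<open>Right-hand side of the equation linearised along the solution through the
    parameter \<open>fst q\<close>; the unknown is \<open>snd q\<close>. It depends on time through
    \<open>x\<close> even when \<open>F\<close> does not.\<close>
  define G where "G v t q = D t (fst q, x t (fst q)) (v, snd q)" for v t and q :: "'p \<times> 'a"
  have Gk: "pcd k {0..1} (N \<times> UNIV) (G v)" for v
  proof -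
    let ?S = "N \<times> (UNIV :: 'a set)"
    have op: "open ?S" using N by (intro open_Times) auto
    have fst: "pcd k {0..1} ?S (\<lambda>t q. fst q)"
      and snd: "pcd k {0..1} ?S (\<lambda>t q. snd q)"
      by (intro pcd_bounded_linear_snd[OF _ op] bounded_linear_fst bounded_linear_snd)+
    have x1: "pcd k {0..1} ?S (\<lambda>t q. x t (fst q))"
      by (rule pcd_compose[OF op xk fst]) auto
    have pair: "pcd k {0..1} ?S (\<lambda>t q. (f t q, g t q))"
      if "pcd k {0..1} ?S f" "pcd k {0..1} ?S g"
      for f :: "real \<Rightarrow> 'p \<times> 'a \<Rightarrow> 'p" and g :: "real \<Rightarrow> 'p \<times> 'a \<Rightarrow> 'a"
    proof -
      have "pcd k {0..1} ?S (\<lambda>t q. (f t q, 0) + (0, g t q))"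
        by (intro pcd_add[OF op] pcd_bounded_linear[OF op _ that(1), of "\<lambda>u. (u, 0)"]
          pcd_bounded_linear[OF op _ that(2), of "\<lambda>u. (0, u)"] bounded_linear_Pair
          bounded_linear_ident bounded_linear_zero)
      then show ?thesis by simp
    qed
    have "pcd k {0..1} ?S (\<lambda>t q. \<Sum>b\<in>Basis. ((v, snd q) \<bullet> b) *\<^sub>R D t (fst q, x t (fst q)) b)"
    proof (intro pcd_sum[OF op] pcd_bilinear[OF op bounded_bilinear_scaleR]
        pcd_bounded_linear[OF op bounded_linear_inner_left] pair pcd_const snd)
      fix b :: "'p \<times> 'a"
      have "pcd k {0..1} (N \<times> X) (\<lambda>t z. D t z b)" using F unfolding D_def pcd.simps by blast
      from pcd_compose[OF op this pair[OF fst x1]]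
      show "pcd k {0..1} ?S (\<lambda>t q. D t (fst q, x t (fst q)) b)"
        using mem by auto
    qed
    then show ?thesis
      using linear_Basis_expand[OF lin] mem
      by (intro pcd_cong[OF op _ \<open>pcd k _ _ (\<lambda>t q. \<Sum>b\<in>Basis. _)\<close>]) (auto simp: G_def)
  qed
  have Gdiff: "G v t (p, y) - G w t (p, z) = G (v - w) t (p, y - z)" if "t \<in> {0..1}" "p \<in> N" for v w t p y z
    unfolding G_def using linear_diff[OF lin[OF that mem[OF that]], of "(v, y)" "(w, z)"] by simp
  have G0: "norm (G 0 t (p, y)) \<le> norm y / 2" if "t \<in> {0..1}" "p \<in> N" for t p y
    using D2[OF that mem[OF that]] by (simp add: G_def)
  have Glip: "norm (G v t (p, y) - G v t (p, z)) \<le> norm (y - z) / 2" if "t \<in> {0..1}" "p \<in> N" for v t p y z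
    using G0[OF that] by (simp add: Gdiff[OF that])
  have "\<exists>u. p \<in> N \<longrightarrow> continuous_on {0..1} u \<and> (\<forall>t\<in>{0..1}. u t = integral {0..t} (\<lambda>s. G v s (p, u s)))" for v p
  proof (cases "p \<in> N")
    case True
    have "continuous_on ({0..1} \<times> UNIV) (\<lambda>z. G v (fst z) (p, snd z))"
      by (rule continuous_on_curry_compose[OF pcd_continuous[OF Gk]])
        (use True in \<open>auto intro!: continuous_intros\<close>)
    from picard_exists[OF this Glip[OF _ True]] show ?thesis by metis
  qed auto
  then have ex: "\<exists>u. p \<in> N \<longrightarrow> continuous_on {0..1} u \<and> (\<forall>t\<in>{0..1}. u t = integral {0..t} (\<lambda>s. G v s (p, u s)))"
    for v p .
  \<comment> \<open>\<open>Y v t p\<close> is the candidate for the derivative of \<open>x t\<close>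
    at \<open>p\<close> in the direction \<open>v\<close>; for \<open>p\<close> outside
    \<open>N\<close> the choice is arbitrary.\<close>
  define Y where "Y v t p = (SOME u. p \<in> N \<longrightarrow> continuous_on {0..1} u \<and>
    (\<forall>t\<in>{0..1}. u t = integral {0..t} (\<lambda>s. G v s (p, u s)))) t" for v t p
  have Y: "continuous_on {0..1} (\<lambda>t. Y v t p)"
    "\<And>t. t \<in> {0..1} \<Longrightarrow> Y v t p = integral {0..t} (\<lambda>s. G v s (p, Y v s p))" if "p \<in> N" for v p
    using someI_ex[OF ex[of p v]] that unfolding Y_def by blast+
  have Yk: "pcd k {0..1} N (Y v)" for v
    by (rule Suc.IH[OF open_UNIV Gk]) (use Glip Y in auto)
  have cG: "continuous_on {0..1} (\<lambda>s. G v s (p, u s))" if "p \<in> N" "continuous_on {0..1} u" for v p u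
    by (rule continuous_on_curry_compose[OF pcd_continuous[OF Gk]])
      (use that in \<open>auto intro!: continuous_intros\<close>)
  have iG: "(\<lambda>s. G v s (p, u s)) integrable_on {0..t}"
    if "t \<in> {0..1}" "p \<in> N" "continuous_on {0..1} u" for v p u t
    using that by (intro integrable_continuous_real continuous_on_subset[OF cG]) auto
  have uniq: "u t = Y v t p"
    if "p \<in> N" "continuous_on {0..1} u" "\<And>t. t \<in> {0..1} \<Longrightarrow> u t = integral {0..t} (\<lambda>s. G v s (p, u s))"
      "t \<in> {0..1}" for u v t p
  proof -
    have "norm (u t - Y v t p) \<le> 2 * 0"
    proof (rule half_contraction_bound[OF _ _ _ _ that(4)])
      show "continuous_on {0..1} (\<lambda>s. G v s (p, u s) - G v s (p, Y v s p))"
        using that Y by (intro continuous_on_diff cG) auto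
      show "u t - Y v t p = integral {0..t} (\<lambda>s. G v s (p, u s) - G v s (p, Y v s p))" if "t \<in> {0..1}" for t
        using \<open>p \<in> N\<close> that Y(1) \<open>continuous_on {0..1} u\<close>
        by (subst integral_diff) (auto simp: Y(2)[symmetric] \<open>\<And>t. t \<in> {0..1} \<Longrightarrow> u t = _\<close>[symmetric] intro!: iG)
    qed (use that Y Glip in \<open>auto intro!: continuous_intros\<close>)
    then show ?thesis by simp
  qed
  have Ylin: "linear (\<lambda>v. Y v t p)" if t: "t \<in> {0..1}" and p: "p \<in> N" for t p
  proof -
    have Glin: "linear (\<lambda>q. G (fst q) s (p, snd q))" if "s \<in> {0..1}" for s
      unfolding G_def using lin[OF that p mem[OF that p]] by (simp add: case_prod_beta')
    \<comment> \<open>By uniqueness: the combination on the left solves the linearised equation for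
      the direction \<open>c *\<^sub>R v + w\<close>.\<close>
    have comb: "c *\<^sub>R Y v t p + Y w t p = Y (c *\<^sub>R v + w) t p" for c v w
    proof (rule uniq[OF p _ _ t])
      fix t :: real assume t: "t \<in> {0..1}"
      have "c *\<^sub>R Y v t p + Y w t p = integral {0..t} (\<lambda>s. c *\<^sub>R G v s (p, Y v s p) + G w s (p, Y w s p))"
        unfolding Y(2)[OF p t] by (subst integral_add) (auto intro!: iG integrable_cmul t p Y)
      also have "\<dots> = integral {0..t} (\<lambda>s. G (c *\<^sub>R v + w) s (p, c *\<^sub>R Y v s p + Y w s p))"
      proof (rule integral_cong)
        fix s assume "s \<in> {0..t}"
        then have l: "linear (\<lambda>q. G (fst q) s (p, snd q))" using t by (intro Glin) auto
        show "c *\<^sub>R G v s (p, Y v s p) + G w s (p, Y w s p) = G (c *\<^sub>R v + w) s (p, c *\<^sub>R Y v s p + Y w s p)"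
          using linear_add[OF l, of "c *\<^sub>R (v, Y v s p)" "(w, Y w s p)"] linear_scale[OF l, of c "(v, Y v s p)"] by simp
      qed
      finally show "c *\<^sub>R Y v t p + Y w t p = integral {0..t} (\<lambda>s. G (c *\<^sub>R v + w) s (p, c *\<^sub>R Y v s p + Y w s p))" .
    qed (use Y p in \<open>auto intro!: continuous_intros\<close>)
    have "Y 0 t p = 0" using comb[of 1 0 0] by simp
    then show ?thesis using comb[of 1] comb[of _ _ 0] by (intro linearI) simp_all
  qed
  have Ybound: "\<exists>K\<ge>0. \<forall>t\<in>{0..1}. \<forall>v. norm (Y v t p) \<le> K * norm v" if p: "p \<in> N" for p
  proof -
    have "continuous_on {0..1} (\<lambda>t. \<Sum>b\<in>Basis. norm (Y b t p))"
      using Y(1)[OF p] by (auto intro!: continuous_intros)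
    then obtain m where m: "m \<in> {0..1}"
      "\<And>t. t \<in> {0..1} \<Longrightarrow> (\<Sum>b\<in>Basis. norm (Y b t p)) \<le> (\<Sum>b\<in>Basis. norm (Y b m p))"
      using continuous_attains_sup[of "{0..1::real}" "\<lambda>t. \<Sum>b\<in>Basis. norm (Y b t p)"] by auto
    show ?thesis
    proof (intro exI[of _ "\<Sum>b\<in>Basis. norm (Y b m p)"] conjI ballI allI)
      fix t :: real and v assume t: "t \<in> {0..1}"
      have "norm (Y v t p) \<le> (\<Sum>b\<in>Basis. norm (Y b t p)) * norm v"
        by (rule norm_linear_le_Basis[OF Ylin[OF t p]])
      also have "\<dots> \<le> (\<Sum>b\<in>Basis. norm (Y b m p)) * norm v"
        by (intro mult_right_mono m t) auto
      finally show "norm (Y v t p) \<le> (\<Sum>b\<in>Basis. norm (Y b m p)) * norm v" .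
    qed (auto intro: sum_nonneg)
  qed
  have cF: "continuous_on {0..1} (\<lambda>s. F s (p, u s))"
    if "p \<in> N" "continuous_on {0..1} u" "\<And>s. s \<in> {0..1} \<Longrightarrow> u s \<in> X" for p u
    by (rule continuous_on_curry_compose[OF pcd_continuous[OF F]]) (use that in \<open>auto intro!: continuous_intros\<close>)
  have der: "(x t has_derivative (\<lambda>v. Y v t p)) (at p)" if t: "t \<in> {0..1}" and p: "p \<in> N" for t p
    unfolding has_derivative_at_alt
  proof (intro conjI allI impI)
    show "bounded_linear (\<lambda>v. Y v t p)"
      using Ylin[OF t p] by (simp add: linear_conv_bounded_linear)
    fix e :: real assume e: "e > 0"
    obtain K where K: "K \<ge> 0" "\<And>t v. t \<in> {0..1} \<Longrightarrow> norm (Y v t p) \<le> K * norm v"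
      using Ybound[OF p] by auto
    \<comment> \<open>The increment in parameter and state has norm at most
      \<open>(1 + K) * norm v\<close>, and the contraction bound doubles the error; hence the
      divisor \<open>2 * (1 + K)\<close>.\<close>
    define e' where "e' = e / (2 * (1 + K))"
    have e': "e' > 0" using e K by (simp add: e'_def)
    have F1: "pcd (Suc 0) {0..1} (N \<times> X) F"
      using F pcd_continuous[of k "{0..1}" "N \<times> X"] unfolding pcd.simps by blast
    have "continuous_on {0..1} (\<lambda>t. (p, x t p))" using cont[OF p] by (auto intro!: continuous_intros)
    from pcd_uniformly_differentiable[OF op F1 this _ e'] mem p
    obtain d where d: "d > 0" "\<And>t h. t \<in> {0..1} \<Longrightarrow> norm h < d \<Longrightarrow> (p, x t p) + h \<in> N \<times> X \<and>
      norm (F t ((p, x t p) + h) - F t (p, x t p) - D t (p, x t p) h) \<le> e' * norm h"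
      by (metis D_def mem_Sigma_iff)
    show "\<exists>d>0. \<forall>y. norm (y - p) < d \<longrightarrow> norm (x t y - x t p - Y (y - p) t p) \<le> e * norm (y - p)"
    proof (intro exI[of _ "d / (1 + K)"] conjI allI impI)
      show "d / (1 + K) > 0" using d K by simp
      fix y assume y: "norm (y - p) < d / (1 + K)"
      define v where "v = y - p"
      have hle: "norm (v, Y v s p) \<le> (1 + K) * norm v" if "s \<in> {0..1}" for s
        using norm_Pair_le[of v "Y v s p"] K(2)[OF that, of v] by (simp add: algebra_simps)
      have hd: "norm (v, Y v s p) < d" if "s \<in> {0..1}" for s
        using hle[OF that] y K by (simp add: v_def pos_less_divide_eq mult.commute)
      have inX: "y \<in> N" "x s p + Y v s p \<in> X" if "s \<in> {0..1}" for s
        using d(2)[OF that hd[OF that]] by (auto simp: v_def)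
      have yN: "y \<in> N" using inX(1)[of 0] by simp
      have "norm (x t y - x t p - Y v t p) \<le> 2 * (e' * ((1 + K) * norm v))"
      proof (rule half_contraction_bound[OF _ _ _ _ t])
        show "continuous_on {0..1} (\<lambda>t. x t y - x t p - Y v t p)"
          using cont yN p Y(1) by (intro continuous_intros) auto
        show "continuous_on {0..1} (\<lambda>s. F s (y, x s y) - F s (p, x s p) - G v s (p, Y v s p))"
          using cont yN p Y(1) mem by (intro continuous_on_diff cF cG) auto
        fix t :: real assume t: "t \<in> {0..1}"
        have iF: "(\<lambda>s. F s (q, x s q)) integrable_on {0..t}" if "q \<in> N" for q
          using that t cont mem by (intro integrable_continuous_real continuous_on_subset[OF cF]) auto
        show "x t y - x t p - Y v t p = integral {0..t} (\<lambda>s. F s (y, x s y) - F s (p, x s p) - G v s (p, Y v s p))"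
          using t p yN Y(1)
          by (simp add: eq[OF t p] eq[OF t yN] Y(2)[OF p t] integral_diff integrable_diff iF iG)
        \<comment> \<open>Inserting the predicted state \<open>x t p + Y v t p\<close> splits the
          error: the first term is controlled by the contraction in the state, the second is the
          linearisation error of \<open>F\<close> along the solution.\<close>
        have "norm (F t (y, x t y) - F t (p, x t p) - G v t (p, Y v t p)) \<le>
          norm (F t (y, x t y) - F t (y, x t p + Y v t p)) +
          norm (F t (y, x t p + Y v t p) - F t (p, x t p) - G v t (p, Y v t p))"
          by (rule order_trans[OF _ norm_triangle_ineq]) (simp add: algebra_simps)
        also have "norm (F t (y, x t y) - F t (y, x t p + Y v t p)) \<le> norm (x t y - x t p - Y v t p) / 2"
          using lip[OF t yN mem[OF t yN] inX(2)[OF t]] by (simp add: algebra_simps)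
        also have "norm (F t (y, x t p + Y v t p) - F t (p, x t p) - G v t (p, Y v t p)) \<le> e' * norm (v, Y v t p)"
          using d(2)[OF t hd[OF t]] by (simp add: G_def v_def)
        also have "e' * norm (v, Y v t p) \<le> e' * ((1 + K) * norm v)"
          using hle[OF t] e' by (intro mult_left_mono) auto
        finally show "norm (F t (y, x t y) - F t (p, x t p) - G v t (p, Y v t p)) \<le>
            norm (x t y - x t p - Y v t p) / 2 + e' * ((1 + K) * norm v)" by simp
      qed
      also have "2 * (e' * ((1 + K) * norm v)) = e * norm v"
        using K by (simp add: e'_def field_simps)
      finally show "norm (x t y - x t p - Y (y - p) t p) \<le> e * norm (y - p)" by (simp add: v_def)
    qed
  qed
  show ?case
    by (rule pcd_SucI[OF N cx der Yk])
qed

section \<open>Calculus of smooth functions\<close>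

lemma pcd_mult:
  fixes f g :: "real \<Rightarrow> 'a::euclidean_space \<Rightarrow> real"
  assumes "open S" "pcd k T S f" "pcd k T S g"
  shows "pcd k T S (\<lambda>t x. f t x * g t x)"
  by (rule pcd_bilinear[OF assms(1) bounded_bilinear_mult assms(2,3)])

lemma pcd_prod:
  fixes f :: "'i \<Rightarrow> real \<Rightarrow> 'a::euclidean_space \<Rightarrow> real"
  assumes "open S" "\<And>i. i \<in> I \<Longrightarrow> pcd k T S (f i)"
  shows "pcd k T S (\<lambda>t x. \<Prod>i\<in>I. f i t x)"
  using assms(2)
proof (induction I rule: infinite_finite_induct)
  case (insert i I)
  then show ?case using pcd_mult[OF assms(1), of k T "f i" "\<lambda>t x. \<Prod>i\<in>I. f i t x"] by simp
qed (auto simp: pcd_const)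

text \<open>The derivative of \<open>inverse\<close> is a polynomial in \<open>inverse\<close>
  itself, so class k of \<open>inverse\<close> already yields class k + 1.\<close>

lemma pcd_inverse:
  fixes f :: "real \<Rightarrow> 'a::euclidean_space \<Rightarrow> real"
  assumes "open S" "pcd k T S f" "\<And>t x. t \<in> T \<Longrightarrow> x \<in> S \<Longrightarrow> f t x \<noteq> 0"
  shows "pcd k T S (\<lambda>t x. inverse (f t x))"
proof (rule pcd_compose[OF assms(1) _ assms(2), where f = "\<lambda>t. inverse" and S' = "- {0}"])
  have o: "open (- {0::real})" by auto
  show "pcd k T (- {0::real}) (\<lambda>t. inverse)"
  proof (induction k)
    case 0
    show ?case by (auto intro!: continuous_intros)
  next
    case (Suc k)
    show ?case
    proof (rule pcd_SucI[OF o])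
      show "continuous_on (T \<times> - {0::real}) (\<lambda>z. inverse (snd z))" by (auto intro!: continuous_intros)
      show "(inverse has_derivative (\<lambda>v. - (inverse x * v * inverse x))) (at x)" if "x \<in> - {0::real}" for x
        using that by (auto intro!: derivative_eq_intros)
      have "pcd k T (- {0::real}) (\<lambda>t x. (- v) * (inverse x * inverse x))" for v
        by (intro pcd_mult[OF o] pcd_const Suc.IH)
      then show "pcd k T (- {0::real}) (\<lambda>t x. - (inverse x * v * inverse x))" for v
        by (simp add: mult_ac)
    qed
  qed
qed (use assms in auto)

lemma pcd_det:
  fixes A :: "real \<Rightarrow> 'a::euclidean_space \<Rightarrow> real^'n^'n"
  assumes "open S" "\<And>i j. pcd k T S (\<lambda>t x. A t x $ i $ j)"
  shows "pcd k T S (\<lambda>t x. det (A t x))"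
  unfolding det_def
  by (intro pcd_sum[OF assms(1)] pcd_mult[OF assms(1)] pcd_const pcd_prod[OF assms(1)] assms(2))

lemma pcd_vec:
  fixes f :: "real \<Rightarrow> 'a::euclidean_space \<Rightarrow> real^'n"
  assumes "open S" "\<And>i. pcd k T S (\<lambda>t x. f t x $ i)"
  shows "pcd k T S f"
proof -
  have "pcd k T S (\<lambda>t x. \<Sum>i\<in>UNIV. (f t x $ i) *\<^sub>R axis i (1::real))"
    by (intro pcd_sum[OF assms(1)] pcd_bilinear[OF assms(1) bounded_bilinear_scaleR] assms(2) pcd_const)
  moreover have eq: "(\<Sum>i\<in>UNIV. (f t x $ i) *\<^sub>R axis i (1::real)) = f t x" for t x
    by (simp add: vec_eq_iff axis_def if_distrib cong: if_cong)
  ultimately show ?thesis unfolding eq by simp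
qed

lemma pcd_nth:
  fixes f :: "real \<Rightarrow> 'a::euclidean_space \<Rightarrow> real^'n"
  assumes "open S" "pcd k T S f"
  shows "pcd k T S (\<lambda>t x. f t x $ i)"
  by (rule pcd_bounded_linear[OF assms(1) bounded_linear_vec_nth assms(2)])

text \<open>Cramer's rule writes each component of \<open>u\<close> as a quotient of determinants in
  the data, so a solution given only pointwise inherits their class.\<close>

lemma pcd_linear_solve:
  fixes A :: "real \<Rightarrow> 'a::euclidean_space \<Rightarrow> real^'n^'n" and u b :: "real \<Rightarrow> 'a \<Rightarrow> real^'n"
  assumes S: "open S" and A: "\<And>i j. pcd k T S (\<lambda>t x. A t x $ i $ j)"
    and b: "pcd k T S b"
    and d: "\<And>t x. t \<in> T \<Longrightarrow> x \<in> S \<Longrightarrow> det (A t x) \<noteq> 0"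
    and eq: "\<And>t x. t \<in> T \<Longrightarrow> x \<in> S \<Longrightarrow> A t x *v u t x = b t x"
  shows "pcd k T S u"
proof (rule pcd_vec[OF S])
  fix l
  have "pcd k T S (\<lambda>t x. det (\<chi> i j. if j = l then b t x $ i else A t x $ i $ j) * inverse (det (A t x)))"
  proof (intro pcd_mult[OF S] pcd_inverse[OF S] pcd_det[OF S])
    show "pcd k T S (\<lambda>t x. (\<chi> i j. if j = l then b t x $ i else A t x $ i $ j) $ i $ j)" for i j
      using A[of i j] pcd_nth[OF S b, of i] by (cases "j = l") simp_all
  qed (use A d in auto)
  then show "pcd k T S (\<lambda>t x. u t x $ l)"
  proof (rule pcd_cong[OF S, rotated])
    fix t x assume "t \<in> T" "x \<in> S"
    then show "det (\<chi> i j. if j = l then b t x $ i else A t x $ i $ j) * inverse (det (A t x)) = u t x $ l"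
      using cramer[OF d, of t x "u t x" "b t x"] eq[of t x] by (simp add: divide_inverse)
  qed
qed

lemma smooth_on_iff_pcd: "smooth_on S f \<longleftrightarrow> (\<forall>k. pcd k {0} S (\<lambda>t. f))"
  by (simp add: smooth_on_def cont_diff_on_iff_pcd)

lemma smooth_on_imp_pcd: "smooth_on S f \<Longrightarrow> pcd k T S (\<lambda>t. f)"
  by (simp add: smooth_on_def cont_diff_on_imp_pcd)

lemma pcd_imp_smooth_on: "(\<And>k. pcd k T S f) \<Longrightarrow> t \<in> T \<Longrightarrow> smooth_on S (f t)"
  unfolding smooth_on_def using pcd_imp_cont_diff_on by blast

lemma smooth_on_imp_continuous_on: "smooth_on S f \<Longrightarrow> continuous_on S f"
  unfolding smooth_on_def using cont_diff_on_imp_continuous by blast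

lemma smooth_on_has_derivative:
  "smooth_on S f \<Longrightarrow> x \<in> S \<Longrightarrow> (f has_derivative frechet_derivative f (at x)) (at x)"
  using pcd_has_derivative[of 0 "{0}" S "\<lambda>t. f" 0 x] by (simp add: smooth_on_iff_pcd del: pcd.simps)

lemma smooth_on_frechet_derivative:
  "smooth_on S f \<Longrightarrow> smooth_on S (\<lambda>x. frechet_derivative f (at x) v)"
  unfolding smooth_on_def
proof (intro allI)
  fix k assume "\<forall>k. cont_diff_on k S f"
  then have "cont_diff_on (Suc k) S f" by blast
  then show "cont_diff_on k S (\<lambda>x. frechet_derivative f (at x) v)" by simp
qed

lemma smooth_on_cong:
  assumes "open S" "\<And>x. x \<in> S \<Longrightarrow> f x = g x" "smooth_on S f"
  shows "smooth_on S g"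
proof -
  have "pcd k {0} S (\<lambda>t. g)" for k
    by (rule pcd_cong[OF assms(1) _ smooth_on_imp_pcd[OF assms(3)]]) (rule assms(2))
  then show ?thesis by (simp add: smooth_on_iff_pcd)
qed

lemma smooth_on_subset: "smooth_on S f \<Longrightarrow> S' \<subseteq> S \<Longrightarrow> smooth_on S' f"
  unfolding smooth_on_iff_pcd using pcd_subset by blast

lemma smooth_on_const: "smooth_on S (\<lambda>x. c)"
  unfolding smooth_on_iff_pcd by (simp add: pcd_const)

lemma smooth_on_bounded_linear: "open S \<Longrightarrow> bounded_linear L \<Longrightarrow> smooth_on S L"
  unfolding smooth_on_iff_pcd by (simp add: pcd_bounded_linear_snd)

lemma smooth_on_add:
  "open S \<Longrightarrow> smooth_on S f \<Longrightarrow> smooth_on S g \<Longrightarrow> smooth_on S (\<lambda>x. f x + g x)"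
  unfolding smooth_on_iff_pcd by (simp add: pcd_add)

lemma smooth_on_mult:
  fixes f g :: "'a::euclidean_space \<Rightarrow> real"
  shows "open S \<Longrightarrow> smooth_on S f \<Longrightarrow> smooth_on S g \<Longrightarrow> smooth_on S (\<lambda>x. f x * g x)"
  unfolding smooth_on_iff_pcd by (simp add: pcd_mult)

lemma smooth_on_inverse:
  fixes f :: "'a::euclidean_space \<Rightarrow> real"
  assumes "open S" "smooth_on S f" "\<And>x. x \<in> S \<Longrightarrow> f x \<noteq> 0"
  shows "smooth_on S (\<lambda>x. inverse (f x))"
proof -
  have "pcd k {0} S (\<lambda>t x. inverse (f x))" for k
    by (rule pcd_inverse[OF assms(1) smooth_on_imp_pcd[OF assms(2)]]) (rule assms(3))
  then show ?thesis by (simp add: smooth_on_iff_pcd)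
qed

lemma smooth_on_diff:
  fixes f g :: "'a::euclidean_space \<Rightarrow> real"
  assumes "open S" "smooth_on S f" "smooth_on S g"
  shows "smooth_on S (\<lambda>x. f x - g x)"
  using smooth_on_add[OF assms(1,2) smooth_on_mult[OF assms(1) smooth_on_const assms(3)], of "-1"] by simp

lemma smooth_on_vec:
  fixes f :: "'a::euclidean_space \<Rightarrow> real^'n"
  assumes "open S" "\<And>i. smooth_on S (\<lambda>x. f x $ i)"
  shows "smooth_on S f"
proof -
  have "pcd k {0} S (\<lambda>t. f)" for k
    by (rule pcd_vec[OF assms(1)]) (rule smooth_on_imp_pcd[OF assms(2)])
  then show ?thesis by (simp add: smooth_on_iff_pcd)
qed

lemma smooth_on_compose:
  fixes g :: "'a::euclidean_space \<Rightarrow> 'c::euclidean_space"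
  assumes "open S" "smooth_on S' f" "smooth_on S g" "\<And>x. x \<in> S \<Longrightarrow> g x \<in> S'"
  shows "smooth_on S (\<lambda>x. f (g x))"
proof -
  have "pcd k {0} S (\<lambda>t x. f (g x))" for k
    by (rule pcd_compose[OF assms(1) smooth_on_imp_pcd[OF assms(2)] smooth_on_imp_pcd[OF assms(3)]])
      (rule assms(4))
  then show ?thesis by (simp add: smooth_on_iff_pcd)
qed

lemma smooth_on_linear_solve:
  fixes A :: "'a::euclidean_space \<Rightarrow> real^'n^'n" and u b :: "'a \<Rightarrow> real^'n"
  assumes S: "open S" and A: "\<And>i j. smooth_on S (\<lambda>x. A x $ i $ j)"
    and b: "smooth_on S b"
    and d: "\<And>x. x \<in> S \<Longrightarrow> det (A x) \<noteq> 0"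
    and eq: "\<And>x. x \<in> S \<Longrightarrow> A x *v u x = b x"
  shows "smooth_on S u"
proof -
  have "pcd k {0} S (\<lambda>t. u)" for k
    by (rule pcd_linear_solve[OF S smooth_on_imp_pcd[OF A] smooth_on_imp_pcd[OF b]])
      (simp_all add: d eq)
  then show ?thesis by (simp add: smooth_on_iff_pcd)
qed

lemma smooth_on_ln: "smooth_on {0<..} (ln :: real \<Rightarrow> real)"
proof -
  have o: "open ({0<..} :: real set)" by simp
  have "pcd k {0} {0<..} (\<lambda>t. ln :: real \<Rightarrow> real)" for k
  proof (cases k)
    case 0
    show ?thesis unfolding 0 by (auto intro!: continuous_intros)
  next
    case (Suc j)
    show ?thesis unfolding Suc
    proof (rule pcd_SucI[OF o])
      show "(ln has_derivative (\<lambda>v. inverse x * v)) (at x)" if "x \<in> {0<..}" for x :: real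
        using that by (auto intro!: derivative_eq_intros simp: divide_inverse mult.commute)
      show "pcd j {0} {0<..} (\<lambda>t x. inverse x * v)" for v :: real
        by (intro pcd_mult[OF o] pcd_inverse[OF o] pcd_const pcd_bounded_linear_snd[OF bounded_linear_ident o]) auto
    qed (auto intro!: continuous_intros)
  qed
  then show ?thesis by (simp add: smooth_on_iff_pcd)
qed

text \<open>The inverse function theorem yields only a differentiable inverse \<open>H\<close>. Its
  derivative solves a linear system with the coefficients DP at \<open>H y\<close>, which are of the
  same class as \<open>H\<close>; Cramer's rule therefore gains one derivative in each induction
  step.\<close>

lemma smooth_local_inverse:
  fixes P :: "real^'n \<Rightarrow> real^'n"
  assumes N: "open N" and P: "smooth_on N P" and y0: "y0 \<in> N"
    and inj: "inj (frechet_derivative P (at y0))"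
  obtains U V H where "open U" "y0 \<in> U" "U \<subseteq> N" "open V" "homeomorphism U V P H" "smooth_on V H"
proof -
  define D where "D y = Blinfun (frechet_derivative P (at y))" for y
  have bl: "bounded_linear (frechet_derivative P (at y))" if "y \<in> N" for y
    using smooth_on_has_derivative[OF P that] has_derivative_bounded_linear by blast
  have D: "blinfun_apply (D y) = frechet_derivative P (at y)" if "y \<in> N" for y
    unfolding D_def by (rule bounded_linear_Blinfun_apply[OF bl[OF that]])
  have der: "(P has_derivative blinfun_apply (D y)) (at y)" if "y \<in> N" for y
    unfolding D[OF that] by (rule smooth_on_has_derivative[OF P that])
  have cont: "continuous_on N D"
  proof (rule continuous_on_blinfun_componentwise)
    fix i :: "real^'n"
    have "continuous_on N (\<lambda>y. frechet_derivative P (at y) i)"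
      by (intro smooth_on_imp_continuous_on smooth_on_frechet_derivative P)
    then show "continuous_on N (\<lambda>y. blinfun_apply (D y) i)"
      by (rule continuous_on_eq) (simp add: D)
  qed
  obtain g where g: "linear g" "g \<circ> frechet_derivative P (at y0) = id"
    using linear_injective_left_inverse[OF bounded_linear.linear[OF bl[OF y0]] inj] by blast
  have gb: "bounded_linear g" using g by (simp add: linear_conv_bounded_linear)
  have "Blinfun g o\<^sub>L D y0 = id_blinfun"
    using g(2) by (intro blinfun_eqI) (simp add: bounded_linear_Blinfun_apply[OF gb] D[OF y0] o_def fun_eq_iff)
  from inverse_function_theorem[OF N der cont y0 this]
  obtain U V H H' where U: "open U" "U \<subseteq> N" "y0 \<in> U" "open V" "homeomorphism U V P H"
    and H: "\<And>y. y \<in> V \<Longrightarrow> (H has_derivative H' y) (at y)"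
      "\<And>y. y \<in> V \<Longrightarrow> H' y = inv (blinfun_apply (D (H y)))"
      "\<And>y. y \<in> V \<Longrightarrow> bij (blinfun_apply (D (H y)))"
    by metis
  have HU: "H y \<in> U" if "y \<in> V" for y using U(5) that by (auto simp: homeomorphism_def)
  have HN: "H y \<in> N" if "y \<in> V" for y using HU[OF that] U(2) by auto
  have linD: "linear (frechet_derivative P (at y))" if "y \<in> N" for y
    using bl[OF that] bounded_linear.linear by blast
  define A where "A y = matrix (frechet_derivative P (at (H y)))" for y
  have Av: "A y *v w = frechet_derivative P (at (H y)) w" if "y \<in> V" for y w
    unfolding A_def using fun_cong[OF matrix_vector_mul(2)[OF linD[OF HN[OF that]]], of w] .
  have eq: "A y *v H' y w = w" if "y \<in> V" for y w
    using H(2,3)[OF that] by (simp add: Av[OF that] D[OF HN[OF that]] bij_is_surj surj_f_inv_f)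
  have detA: "det (A y) \<noteq> 0" if "y \<in> V" for y
  proof -
    have "(*v) (A y) = blinfun_apply (D (H y))" by (simp add: fun_eq_iff D[OF HN[OF that]] Av[OF that])
    then have "bij ((*v) (A y))" using H(3)[OF that] by simp
    then have "inj ((*v) (A y))" by (rule bij_is_inj)
    then have "invertible (A y)"
      using matrix_left_invertible_injective[of "A y"] invertible_left_inverse[of "A y"] by (simp add: inj_def)
    then show ?thesis by (simp add: invertible_det_nz)
  qed
  have cH: "continuous_on V H" using U(5) by (simp add: homeomorphism_def)
  have "pcd k {0} V (\<lambda>t. H)" for k
  proof (induction k)
    case 0
    show ?case using continuous_on_snd_Times[OF cH] by simp
  next
    case (Suc k)
    show ?case
    proof (rule pcd_SucI[OF U(4)])
      show "continuous_on ({0} \<times> V) (\<lambda>z. H (snd z))" by (rule continuous_on_snd_Times[OF cH])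
      show "(H has_derivative H' y) (at y)" if "y \<in> V" for y by (rule H(1)[OF that])
      show "pcd k {0} V (\<lambda>t y. H' y w)" for w
      proof (rule pcd_linear_solve[OF U(4), where A = "\<lambda>t. A" and b = "\<lambda>t x. w"])
        show "pcd k {0} V (\<lambda>t y. A y $ i $ j)" for i j
          unfolding A_def matrix_def
          using pcd_nth[OF U(4) pcd_compose[OF U(4) smooth_on_imp_pcd[OF smooth_on_frechet_derivative[OF P]] Suc.IH HN], of "axis j 1" i]
          by (simp add: axis_def)
      qed (use detA eq in \<open>auto simp: pcd_const\<close>)
    qed
  qed
  then have "smooth_on V H" by (simp add: smooth_on_iff_pcd)
  then show ?thesis using that U by blast
qed

section \<open>Charts and coframes\<close>

lemma is_chart_inj_on: "is_chart c \<Longrightarrow> inj_on (chart_map c) (chart_dom c)"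
  unfolding is_chart_def homeomorphism_def by (metis inj_on_inverseI)

lemma is_chart_open_image:
  assumes "is_chart c" "open W" "W \<subseteq> chart_dom c"
  shows "open (chart_map c ` W)"
proof -
  have h: "homeomorphism (chart_dom c) (chart_map c ` chart_dom c) (chart_map c) (chart_inv c)"
    and o: "open (chart_map c ` chart_dom c)" using assms(1) by (auto simp: is_chart_def)
  have "openin (top_of_set (chart_dom c)) W"
    using assms(2,3) by (rule open_subset[rotated])
  from homeomorphism_imp_open_map[OF h this] o show ?thesis
    using openin_open_trans by blast
qed

lemma smooth_structure_is_chart: "smooth_structure A \<Longrightarrow> c \<in> A \<Longrightarrow> is_chart c"
  by (simp add: smooth_structure_def)

lemma homeomorphism_facts:
  assumes hom: "homeomorphism U V P H"
  shows "\<And>u. u \<in> U \<Longrightarrow> H (P u) = u" "\<And>u. u \<in> U \<Longrightarrow> P u \<in> V"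
    "\<And>y. y \<in> V \<Longrightarrow> P (H y) = y" "\<And>y. y \<in> V \<Longrightarrow> H y \<in> U" "H ` V = U"
    "continuous_on U P" "continuous_on V H"
proof -
  show "P u \<in> V" if "u \<in> U" for u
    using imageI[OF that, of P] homeomorphism_image1[OF hom] by simp
  show "H y \<in> U" if "y \<in> V" for y
    using imageI[OF that, of H] homeomorphism_image2[OF hom] by simp
qed (rule homeomorphism_apply1[OF hom] homeomorphism_apply2[OF hom] homeomorphism_image2[OF hom]
    homeomorphism_cont1[OF hom] homeomorphism_cont2[OF hom]; assumption?)+

text \<open>Maximality of the atlas reduces membership to compatibility with every chart
  \<open>d\<close>, and the new transition maps are those between \<open>c\<close> and
  \<open>d\<close> composed with \<open>P\<close> or \<open>H\<close>.\<close>

lemma chart_compose: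
  fixes A :: "('m::{t2_space, second_countable_topology}, 'n::finite) chart set"
  assumes A: "smooth_structure A" and c: "c \<in> A"
    and U: "open U" and V': "open V'" "V' \<subseteq> chart_map c ` chart_dom c"
    and hom: "homeomorphism U V' P H" and P: "smooth_on U P" and H: "smooth_on V' H"
  defines "V \<equiv> chart_dom c \<inter> chart_map c -` V'" and "\<phi> \<equiv> \<lambda>p. H (chart_map c p)"
  shows "(V, \<phi>) \<in> A" and "\<phi> ` V = U"
proof -
  obtain Vc \<psi> where c_def: "c = (Vc, \<psi>)" by (cases c)
  have V_def': "V = Vc \<inter> \<psi> -` V'" and \<phi>_def': "\<phi> = (\<lambda>p. H (\<psi> p))" by (auto simp: V_def \<phi>_def c_def)
  have ch: "is_chart c" using A c by (rule smooth_structure_is_chart)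
  have inj: "inj_on \<psi> Vc" using is_chart_inj_on[OF ch] by (simp add: c_def)
  have Vc: "open Vc" and \<psi>c: "continuous_on Vc \<psi>" and \<psi>ic: "continuous_on (\<psi> ` Vc) (inv_into Vc \<psi>)"
    using ch by (auto simp: is_chart_def homeomorphism_def c_def)
  have Vo: "open V" unfolding V_def' by (rule continuous_open_preimage[OF \<psi>c Vc V'(1)])
  have \<psi>V: "\<psi> ` V = V'" using V'(2) by (auto simp: V_def' c_def)
  note HP = homeomorphism_facts[OF hom]
  have "\<phi> ` V = H ` (\<psi> ` V)" by (simp add: \<phi>_def' image_image)
  then show \<phi>V: "\<phi> ` V = U" by (simp only: \<psi>V HP(5))
  have inj\<phi>: "inj_on \<phi> V"
  proof (rule inj_onI)
    fix p q assume pq: "p \<in> V" "q \<in> V" "\<phi> p = \<phi> q"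
    then have "\<psi> p \<in> V'" "\<psi> q \<in> V'" by (auto simp: V_def')
    then have "P (\<phi> p) = \<psi> p" "P (\<phi> q) = \<psi> q" by (simp_all add: \<phi>_def' HP(3))
    then have "\<psi> p = \<psi> q" unfolding pq(3) by simp
    then show "p = q" using inj pq by (auto simp: V_def' inj_on_def)
  qed
  have inv: "inv_into V \<phi> u = inv_into Vc \<psi> (P u)" if "u \<in> U" for u
  proof (rule inv_into_f_eq[OF inj\<phi>])
    have "P u \<in> \<psi> ` Vc" using HP(2)[OF that] V'(2) by (auto simp: c_def)
    then show "inv_into Vc \<psi> (P u) \<in> V" "\<phi> (inv_into Vc \<psi> (P u)) = u"
      using HP(1,2)[OF that] by (auto simp: V_def' \<phi>_def' f_inv_into_f inv_into_into)
  qed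
  have chart: "is_chart (V, \<phi>)"
    unfolding is_chart_def
  proof (intro conjI)
    show "homeomorphism (chart_dom (V, \<phi>)) (chart_map (V, \<phi>) ` chart_dom (V, \<phi>)) (chart_map (V, \<phi>)) (chart_inv (V, \<phi>))"
      unfolding homeomorphism_def fst_conv snd_conv
    proof (intro conjI ballI)
      show "continuous_on V \<phi>" unfolding \<phi>_def'
        by (rule continuous_on_compose2[of V' H, OF _ continuous_on_subset[OF \<psi>c]])
          (use homeomorphism_cont2[OF hom] V_def' in auto)
      have "continuous_on U (\<lambda>u. inv_into Vc \<psi> (P u))"
        by (rule continuous_on_compose2[OF \<psi>ic])
          (use homeomorphism_cont1[OF hom] HP(2) V'(2) in \<open>auto simp: c_def\<close>)
      then show "continuous_on (\<phi> ` V) (inv_into V \<phi>)"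
        unfolding \<phi>V by (rule continuous_on_eq) (simp add: inv)
      show "inv_into V \<phi> ` \<phi> ` V = V" using inj\<phi> by simp
    qed (use inj\<phi> in \<open>auto simp: f_inv_into_f\<close>)
  qed (simp_all add: Vo \<phi>V U)
  have comp: "smoothly_compatible (V, \<phi>) d" if d: "d \<in> A" for d
  proof -
    have chd: "is_chart d" using A d by (rule smooth_structure_is_chart)
    have cd: "smoothly_compatible c d" using A c d by (simp add: smooth_structure_def)
    have od: "open (chart_dom d)" using chd by (simp add: is_chart_def)
    have o1: "open (\<phi> ` (V \<inter> chart_dom d))"
      using is_chart_open_image[OF chart, of "V \<inter> chart_dom d"] Vo od by auto
    have o2: "open (chart_map d ` (V \<inter> chart_dom d))"
      using is_chart_open_image[OF chd, of "V \<inter> chart_dom d"] Vo od by auto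
    have P\<phi>: "P (\<phi> p) = \<psi> p" if "p \<in> V" for p using that HP(3) by (simp add: V_def' \<phi>_def')
    show ?thesis
      unfolding smoothly_compatible_def fst_conv snd_conv
    proof (intro conjI)
      have "smooth_on (\<phi> ` (V \<inter> chart_dom d)) (\<lambda>u. transition c d (P u))"
      proof (rule smooth_on_compose[OF o1, where f = "transition c d" and g = P])
        show "smooth_on (\<psi> ` (Vc \<inter> chart_dom d)) (transition c d)"
          using cd by (simp add: smoothly_compatible_def c_def)
        show "smooth_on (\<phi> ` (V \<inter> chart_dom d)) P"
          by (rule smooth_on_subset[OF P]) (use \<phi>V in auto)
        show "P u \<in> \<psi> ` (Vc \<inter> chart_dom d)" if "u \<in> \<phi> ` (V \<inter> chart_dom d)" for u
          using that P\<phi> by (auto simp: V_def')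
      qed
      then show "smooth_on (\<phi> ` (V \<inter> chart_dom d)) (transition (V, \<phi>) d)"
        by (rule smooth_on_cong[OF o1, rotated]) (use \<phi>V in \<open>auto simp: transition_def c_def inv\<close>)
      have "smooth_on (chart_map d ` (V \<inter> chart_dom d)) (\<lambda>u. H (transition d c u))"
      proof (rule smooth_on_compose[OF o2 H])
        have "smooth_on (chart_map d ` (Vc \<inter> chart_dom d)) (transition d c)"
          using cd by (simp add: smoothly_compatible_def c_def)
        then show "smooth_on (chart_map d ` (V \<inter> chart_dom d)) (transition d c)"
          by (rule smooth_on_subset) (auto simp: V_def')
        show "transition d c u \<in> V'" if "u \<in> chart_map d ` (V \<inter> chart_dom d)" for u
          using that is_chart_inj_on[OF chd] by (auto simp: transition_def c_def V_def')
      qed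
      then show "smooth_on (chart_map d ` (V \<inter> chart_dom d)) (transition d (V, \<phi>))"
        by (rule smooth_on_cong[OF o2, rotated]) (simp add: transition_def c_def \<phi>_def')
    qed
  qed
  then show "(V, \<phi>) \<in> A" using A chart unfolding smooth_structure_def by blast
qed

lemma chart_restrict:
  fixes A :: "('m::{t2_space, second_countable_topology}, 'n::finite) chart set"
  assumes A: "smooth_structure A" and c: "c \<in> A" and B: "open B" "B \<subseteq> chart_map c ` chart_dom c"
  shows "(chart_dom c \<inter> chart_map c -` B, chart_map c) \<in> A"
    and "chart_map c ` (chart_dom c \<inter> chart_map c -` B) = B"
proof -
  have "smooth_on B (\<lambda>x. x)" by (rule smooth_on_bounded_linear[OF B(1) bounded_linear_ident])
  moreover have "homeomorphism B B (\<lambda>x. x) (\<lambda>x. x)"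
    by (auto simp: homeomorphism_def)
  ultimately show "(chart_dom c \<inter> chart_map c -` B, chart_map c) \<in> A"
    using chart_compose(1)[OF A c B(1) B, of "\<lambda>x. x" "\<lambda>x. x"] by simp
  show "chart_map c ` (chart_dom c \<inter> chart_map c -` B) = B" using B(2) by auto
qed

text \<open>Flow maps lead from the new coordinates to the old ones, so it is their local inverse
  that serves as the coordinate map.\<close>

lemma chart_reparam:
  fixes A :: "('m::{t2_space, second_countable_topology}, 'n::finite) chart set"
  assumes A: "smooth_structure A" and c: "c \<in> A" and p0: "p0 \<in> chart_dom c" "p0 \<in> W" and W: "open W"
    and N: "open N" "y0 \<in> N" and P: "smooth_on N P" and y0: "P y0 = chart_map c p0"
    and inj: "inj (frechet_derivative P (at y0))"
  obtains V \<phi> where "(V, \<phi>) \<in> A" "p0 \<in> V" "V \<subseteq> chart_dom c \<inter> W" "\<phi> p0 = y0" "\<phi> ` V \<subseteq> N"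
    "\<And>p. p \<in> V \<Longrightarrow> P (\<phi> p) = chart_map c p"
proof -
  have ch: "is_chart c" using A c by (rule smooth_structure_is_chart)
  have inj_c: "inj_on (chart_map c) (chart_dom c)" by (rule is_chart_inj_on[OF ch])
  obtain U V1 H where UV: "open U" "y0 \<in> U" "U \<subseteq> N" "open V1" "homeomorphism U V1 P H" "smooth_on V1 H"
    using smooth_local_inverse[OF N(1) P N(2) inj] by metis
  \<comment> \<open>Intersecting with the image of \<open>W\<close> keeps the domain of the new
    chart inside \<open>W\<close>.\<close>
  define B where "B = V1 \<inter> chart_map c ` (chart_dom c \<inter> W)"
  have oB: "open B" unfolding B_def
    using is_chart_open_image[OF ch, of "chart_dom c \<inter> W"] W UV(4) ch by (auto simp: is_chart_def)
  define U' where "U' = U \<inter> P -` B"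
  note HP = homeomorphism_facts[OF UV(5)]
  have oU: "open U'" unfolding U'_def by (rule continuous_open_preimage[OF HP(6) UV(1) oB])
  have BV: "B \<subseteq> V1" by (auto simp: B_def)
  have "P ` U' = B"
  proof
    show "B \<subseteq> P ` U'"
    proof
      fix y assume "y \<in> B"
      then show "y \<in> P ` U'"
        using HP(3,4)[of y] BV by (intro image_eqI[of _ _ "H y"]) (auto simp: U'_def)
    qed
  qed (auto simp: U'_def)
  moreover have "H ` B = U'"
  proof
    show "H ` B \<subseteq> U'" using HP(3,4) BV by (auto simp: U'_def)
    show "U' \<subseteq> H ` B" using HP(1) by (force simp: U'_def)
  qed
  ultimately have hom: "homeomorphism U' B P H"
    unfolding homeomorphism_def
    using HP(1,3) BV continuous_on_subset[OF HP(6), of U'] continuous_on_subset[OF HP(7) BV]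
    by (simp add: U'_def subset_eq)
  have sP: "smooth_on U' P" by (rule smooth_on_subset[OF P]) (use UV in \<open>auto simp: U'_def\<close>)
  have sH: "smooth_on B H" by (rule smooth_on_subset[OF UV(6) BV])
  define V where "V = chart_dom c \<inter> chart_map c -` B"
  define \<phi> where "\<phi> p = H (chart_map c p)" for p
  have B_sub: "B \<subseteq> chart_map c ` chart_dom c" by (auto simp: B_def)
  have VA: "(V, \<phi>) \<in> A" "\<phi> ` V = U'"
    using chart_compose[OF A c oU oB B_sub hom sP sH] unfolding V_def \<phi>_def by auto
  have py: "chart_map c p0 \<in> B" using HP(2)[OF UV(2)] y0 p0 by (auto simp: B_def)
  show ?thesis
  proof (rule that[OF VA(1)])
    show "p0 \<in> V" using p0 py by (simp add: V_def)
    show "V \<subseteq> chart_dom c \<inter> W"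
      using inj_c by (auto simp: V_def B_def inj_on_def)
    show "\<phi> p0 = y0" using HP(1)[OF UV(2)] y0 by (simp add: \<phi>_def)
    show "\<phi> ` V \<subseteq> N" using VA(2) UV(3) by (auto simp: U'_def)
    show "P (\<phi> p) = chart_map c p" if "p \<in> V" for p
      using that HP(3) BV by (auto simp: V_def \<phi>_def)
  qed
qed

text \<open>On the open image of \<open>V\<close> the transition map coincides with
  \<open>P\<close>, hence so do the derivatives, and the transformation law of 1-forms becomes
  usable with a concrete \<open>P\<close>.\<close>

lemma form1_reparam:
  fixes A :: "('m::{t2_space, second_countable_topology}, 'n::finite) chart set"
  assumes A: "smooth_structure A" and \<omega>: "smooth_form1 A \<omega>" and c: "c \<in> A" and V: "(V, \<phi>) \<in> A"
    and sub: "V \<subseteq> chart_dom c" and P: "\<And>p. p \<in> V \<Longrightarrow> P (\<phi> p) = chart_map c p" and p: "p \<in> V"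
  shows "\<omega> (V, \<phi>) p v = \<omega> c p (frechet_derivative P (at (\<phi> p)) v)"
proof -
  have ch: "is_chart (V, \<phi>)" using A V by (rule smooth_structure_is_chart)
  have o: "open (\<phi> ` V)" using ch by (simp add: is_chart_def)
  have "transition (V, \<phi>) c u = P u" if "u \<in> \<phi> ` V" for u
    using that is_chart_inj_on[OF ch] P by (auto simp: transition_def)
  then have "frechet_derivative (transition (V, \<phi>) c) (at (\<phi> p)) = frechet_derivative P (at (\<phi> p))"
    using p by (intro frechet_derivative_cong_open[OF o]) auto
  moreover have "\<omega> (V, \<phi>) p v = \<omega> c p (frechet_derivative (transition (V, \<phi>) c) (at (chart_map (V, \<phi>) p)) v)"
  proof -
    have "\<forall>c\<in>A. \<forall>d\<in>A. \<forall>p \<in> chart_dom c \<inter> chart_dom d. \<forall>v.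
        \<omega> c p v = \<omega> d p (frechet_derivative (transition c d) (at (chart_map c p)) v)"
      using \<omega> unfolding smooth_form1_def by (elim conjE)
    from this[rule_format, OF V c] show ?thesis using p sub by auto
  qed
  ultimately show ?thesis by simp
qed

section \<open>The frame dual to a coframe\<close>

definition coframe_matrix :: "('n \<Rightarrow> ('m, 'n::finite) form1) \<Rightarrow> ('m, 'n) chart \<Rightarrow> real^'n \<Rightarrow> real^'n^'n" where
  "coframe_matrix \<omega> c q = (\<chi> i k. \<omega> i c (chart_inv c q) (axis k 1))"

definition dual_frame :: "('n \<Rightarrow> ('m, 'n::finite) form1) \<Rightarrow> ('m, 'n) chart \<Rightarrow> 'n \<Rightarrow> real^'n \<Rightarrow> real^'n" where
  "dual_frame \<omega> c j q = matrix_inv (coframe_matrix \<omega> c q) *v axis j 1"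

lemma axis_expand: "(\<Sum>k\<in>UNIV. (v $ k) *\<^sub>R axis k (1::real)) = (v :: real^'n)"
  by (simp add: vec_eq_iff axis_def if_distrib cong: if_cong)

lemma linear_axis_expand:
  fixes L :: "real^'n \<Rightarrow> 'b::real_vector"
  assumes "linear L" shows "L v = (\<Sum>k\<in>UNIV. (v $ k) *\<^sub>R L (axis k 1))"
proof -
  have "L v = L (\<Sum>k\<in>UNIV. (v $ k) *\<^sub>R axis k 1)" by (simp add: axis_expand)
  then show ?thesis using assms by (simp add: linear_sum linear_scale)
qed

lemma coframe_smooth_form1: "coframe A \<omega> \<Longrightarrow> smooth_form1 A (\<omega> i)"
  by (simp add: coframe_def)

lemma coframe_linear: "coframe A \<omega> \<Longrightarrow> c \<in> A \<Longrightarrow> p \<in> chart_dom c \<Longrightarrow> linear (\<omega> i c p)"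
  by (simp add: coframe_def smooth_form1_def)

lemma coframe_matrix_mult:
  assumes "coframe A \<omega>" "c \<in> A" "q \<in> chart_map c ` chart_dom c"
  shows "(coframe_matrix \<omega> c q *v v) $ i = \<omega> i c (chart_inv c q) v"
proof -
  have "chart_inv c q \<in> chart_dom c" using assms(3) by (rule inv_into_into)
  from linear_axis_expand[OF coframe_linear[OF assms(1,2) this], of i v]
  show ?thesis by (simp add: coframe_matrix_def matrix_vector_mult_def mult.commute)
qed

text \<open>The rows of the matrix are the forms in coordinates. Their linear independence says that
  the transpose has trivial kernel, and for square matrices this is invertibility.\<close>

lemma coframe_matrix_invertible:
  assumes "coframe A \<omega>" "c \<in> A" "q \<in> chart_map c ` chart_dom c"
  shows "invertible (coframe_matrix \<omega> c q)"
proof -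
  let ?M = "coframe_matrix \<omega> c q"
  have p: "chart_inv c q \<in> chart_dom c" using assms(3) by (rule inv_into_into)
  have "a = 0" if a: "a v* ?M = 0" for a
  proof -
    have "(\<Sum>i\<in>UNIV. a $ i * \<omega> i c (chart_inv c q) v) = 0" for v
    proof -
      have "(\<Sum>i\<in>UNIV. a $ i * \<omega> i c (chart_inv c q) v) = a \<bullet> (?M *v v)"
        by (simp add: inner_vec_def coframe_matrix_mult[OF assms])
      also have "\<dots> = (a v* ?M) \<bullet> v" by (simp add: dot_lmul_matrix)
      finally show ?thesis using a by simp
    qed
    moreover have "(\<forall>v. (\<Sum>i\<in>UNIV. a $ i * \<omega> i c (chart_inv c q) v) = 0) \<longrightarrow> (\<forall>i. a $ i = 0)"
      using assms(1,2) p unfolding coframe_def by blast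
    ultimately show ?thesis by (simp add: vec_eq_iff)
  qed
  then have "transpose ?M *v a = 0 \<longrightarrow> a = 0" for a by (simp add: transpose_matrix_vector)
  then have "\<exists>B. B ** transpose ?M = mat 1"
    using matrix_left_invertible_ker by blast
  then have "invertible (transpose ?M)" using invertible_left_inverse by blast
  then show ?thesis by (metis transpose_transpose transpose_invertible)
qed

lemma dual_frame_works:
  assumes "coframe A \<omega>" "c \<in> A" "q \<in> chart_map c ` chart_dom c"
  shows "coframe_matrix \<omega> c q *v dual_frame \<omega> c j q = axis j 1"
proof -
  have "coframe_matrix \<omega> c q ** matrix_inv (coframe_matrix \<omega> c q) = mat 1"
    using someI_ex[OF coframe_matrix_invertible[OF assms, unfolded invertible_def]]
    by (simp add: matrix_inv_def)
  then show ?thesis by (simp add: dual_frame_def matrix_vector_mul_assoc)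
qed

lemma dual_frame:
  assumes "coframe A \<omega>" "c \<in> A" "q \<in> chart_map c ` chart_dom c"
  shows "\<omega> i c (chart_inv c q) (dual_frame \<omega> c j q) = (if i = j then 1 else 0)"
  using coframe_matrix_mult[OF assms, of "dual_frame \<omega> c j q" i] dual_frame_works[OF assms, of j]
  by (simp add: axis_def)

text \<open>The dual frame is treated as the solution of a linear system with smooth coefficients,
  which avoids studying the smoothness of matrix inversion separately.\<close>

lemma smooth_on_dual_frame:
  fixes A :: "('m::{t2_space, second_countable_topology}, 'n::finite) chart set"
  assumes A: "smooth_structure A" and "coframe A \<omega>" "c \<in> A"
  shows "smooth_on (chart_map c ` chart_dom c) (dual_frame \<omega> c j)"
proof (rule smooth_on_linear_solve[where A = "coframe_matrix \<omega> c" and b = "\<lambda>q. axis j 1"])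
  show "open (chart_map c ` chart_dom c)"
    using smooth_structure_is_chart[OF A \<open>c \<in> A\<close>] by (simp add: is_chart_def)
  show "smooth_on (chart_map c ` chart_dom c) (\<lambda>q. coframe_matrix \<omega> c q $ i $ k)" for i k
    using coframe_smooth_form1[OF assms(2), of i] assms(3) by (simp add: coframe_matrix_def smooth_form1_def)
  show "det (coframe_matrix \<omega> c q) \<noteq> 0" if "q \<in> chart_map c ` chart_dom c" for q
    using coframe_matrix_invertible[OF assms(2,3) that] by (simp add: invertible_det_nz)
  show "coframe_matrix \<omega> c q *v dual_frame \<omega> c j q = axis j 1" if "q \<in> chart_map c ` chart_dom c" for q
    by (rule dual_frame_works[OF assms(2,3) that])
qed (rule smooth_on_const)

section \<open>Time-one maps of frame combinations\<close>

lemma smooth_on_cball_lipschitz: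
  fixes f :: "'a::euclidean_space \<Rightarrow> 'b::real_normed_vector"
  assumes f: "smooth_on S f" and sub: "cball q R \<subseteq> S"
  obtains B where "B > 0" "\<And>x. x \<in> cball q R \<Longrightarrow> norm (f x) \<le> B"
    "\<And>x y. x \<in> cball q R \<Longrightarrow> y \<in> cball q R \<Longrightarrow> norm (f x - f y) \<le> B * norm (x - y)"
proof -
  define \<phi> where "\<phi> x = norm (f x) + (\<Sum>b\<in>Basis. norm (frechet_derivative f (at x) b))" for x
  have "continuous_on (cball q R) \<phi>"
    unfolding \<phi>_def
    by (intro continuous_intros continuous_on_subset[OF smooth_on_imp_continuous_on sub] f
        smooth_on_frechet_derivative)
  then have "compact (\<phi> ` cball q R)" by (intro compact_continuous_image compact_cball)
  then obtain B where B: "B > 0" "\<And>x. x \<in> cball q R \<Longrightarrow> norm (\<phi> x) \<le> B"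
    using compact_imp_bounded[THEN bounded_pos[THEN iffD1]] by (metis image_eqI)
  have pos: "0 \<le> (\<Sum>b\<in>Basis. norm (frechet_derivative f (at x) b))" for x by (intro sum_nonneg) auto
  have le: "norm (f x) \<le> B" "(\<Sum>b\<in>Basis. norm (frechet_derivative f (at x) b)) \<le> B" if "x \<in> cball q R" for x
    using B(2)[OF that] pos[of x] norm_ge_zero[of "f x"] unfolding \<phi>_def real_norm_def by linarith+
  show ?thesis
  proof (rule that[OF B(1) le(1)])
    fix x y assume "x \<in> cball q R" "y \<in> cball q R"
    then show "norm (f x - f y) \<le> B * norm (x - y)"
    proof (rule differentiable_bound[OF convex_cball, rotated 2])
      fix x assume x: "x \<in> cball q R"
      have D: "(f has_derivative frechet_derivative f (at x)) (at x)"
        by (rule smooth_on_has_derivative[OF f]) (use x sub in auto)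
      then show "(f has_derivative frechet_derivative f (at x)) (at x within cball q R)"
        by (rule has_derivative_at_withinI)
      show "onorm (frechet_derivative f (at x)) \<le> B"
      proof (rule onorm_le)
        fix v
        have "norm (frechet_derivative f (at x) v) \<le> (\<Sum>b\<in>Basis. norm (frechet_derivative f (at x) b)) * norm v"
          by (rule norm_linear_le_Basis[OF has_derivative_linear[OF D]])
        also have "\<dots> \<le> B * norm v" by (intro mult_right_mono le x) auto
        finally show "norm (frechet_derivative f (at x) v) \<le> B * norm v" .
      qed
    qed
  qed
qed

definition coord_proj :: "'n set \<Rightarrow> real^'n \<Rightarrow> real^'n" where
  "coord_proj J p = (\<chi> j. if j \<in> J then p $ j else 0)"

lemma coord_proj_nth [simp]: "coord_proj J p $ j = (if j \<in> J then p $ j else 0)"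
  by (simp add: coord_proj_def)

lemma has_derivative_along_line:
  assumes D: "(f has_derivative D) (at (a + s *\<^sub>R v))"
  shows "((\<lambda>s. f (a + s *\<^sub>R v)) has_vector_derivative D v) (at s within T)"
proof -
  have "((\<lambda>s. f (a + s *\<^sub>R v)) has_derivative (\<lambda>h. D (h *\<^sub>R v))) (at s within T)"
    by (rule has_derivative_compose[where g = f and f = "\<lambda>s. a + s *\<^sub>R v" and x = s, OF _ D])
      (auto intro!: derivative_eq_intros)
  then show ?thesis
    using linear_scale[OF has_derivative_linear[OF D]] by (simp add: has_vector_derivative_def)
qed

lemma norm_sum_scaleR_le:
  fixes p :: "real^'n" and Y :: "'n \<Rightarrow> 'b::real_normed_vector"
  assumes "\<And>j. norm (Y j) \<le> B j" "\<And>j. B j \<ge> 0"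
  shows "norm (\<Sum>j\<in>J. (p $ j) *\<^sub>R Y j) \<le> norm p * (\<Sum>j\<in>UNIV. B j)"
proof -
  have "norm (\<Sum>j\<in>J. (p $ j) *\<^sub>R Y j) \<le> (\<Sum>j\<in>J. norm p * B j)"
    by (rule order_trans[OF norm_sum sum_mono])
      (auto intro!: mult_mono assms component_le_norm_cart)
  also have "\<dots> \<le> (\<Sum>j\<in>UNIV. norm p * B j)"
    by (rule sum_mono2) (auto simp: assms)
  finally show ?thesis by (simp add: sum_distrib_left)
qed

text \<open>\<open>\<Phi> p\<close> starts at \<open>q0 + (\<Sum>j\<notin>J. p$j X j q0)\<close> and follows the field \<open>\<Sum>j\<in>J. p$j X j\<close> for time 1;
  the parameter domain is so small that the Picard operator is a contraction up to time 1.\<close>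

lemma exp_map:
  fixes X :: "'n::finite \<Rightarrow> real^'n \<Rightarrow> real^'n" and J :: "'n set"
  assumes S: "open S" and X: "\<And>j. smooth_on S (X j)" and q0: "q0 \<in> S"
  obtains \<delta> \<Phi> where "\<delta> > 0" "smooth_on (ball 0 \<delta>) \<Phi>" "\<Phi> 0 = q0"
    "\<And>p. p \<in> ball 0 \<delta> \<Longrightarrow> \<Phi> p \<in> S"
    "\<And>p. p \<in> ball 0 \<delta> \<Longrightarrow> frechet_derivative \<Phi> (at p) (coord_proj J p) = (\<Sum>j\<in>J. (p $ j) *\<^sub>R X j (\<Phi> p))"
    "\<And>p v. p \<in> ball 0 \<delta> \<Longrightarrow> coord_proj J p = 0 \<Longrightarrow> coord_proj J v = 0 \<Longrightarrow>
      frechet_derivative \<Phi> (at p) v = (\<Sum>j\<in>UNIV. (v $ j) *\<^sub>R X j q0)"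
    "\<And>v. frechet_derivative \<Phi> (at 0) v = (\<Sum>j\<in>UNIV. (v $ j) *\<^sub>R X j q0)"
proof -
  obtain R where R: "R > 0" "cball q0 R \<subseteq> S" using S q0 open_contains_cball by blast
  have "\<exists>B. B > 0 \<and> (\<forall>x\<in>cball q0 R. norm (X j x) \<le> B) \<and>
    (\<forall>x\<in>cball q0 R. \<forall>y\<in>cball q0 R. norm (X j x - X j y) \<le> B * norm (x - y))" for j
    by (rule smooth_on_cball_lipschitz[OF X[of j] R(2)]) blast
  then obtain B where B: "\<And>j. B j > 0" "\<And>j x. x \<in> cball q0 R \<Longrightarrow> norm (X j x) \<le> B j"
    "\<And>j x y. x \<in> cball q0 R \<Longrightarrow> y \<in> cball q0 R \<Longrightarrow> norm (X j x - X j y) \<le> B j * norm (x - y)"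
    by metis
  define Bt where "Bt = (\<Sum>j\<in>UNIV. B j)"
  have Bt: "Bt > 0" unfolding Bt_def by (intro sum_pos) (auto simp: B)
  \<comment> \<open>Speed and Lipschitz constant of the field for the parameter \<open>p\<close> are
    at most \<open>norm p * Bt\<close>. The bound 1/2 gives the contraction; the bound R/4 is used
    twice, for the offset of the starting point and for the displacement along the flow.\<close>
  define \<delta> where "\<delta> = min (1/2) (R/4) / Bt"
  have \<delta>: "\<delta> > 0" using R Bt by (simp add: \<delta>_def)
  have pB: "norm p * Bt \<le> 1/2" "norm p * Bt \<le> R/4" if "p \<in> ball 0 \<delta>" for p :: "real^'n"
    using that Bt by (simp_all add: \<delta>_def pos_less_divide_eq)
  define \<iota> where "\<iota> p = q0 + (\<Sum>j\<in>-J. (p $ j) *\<^sub>R X j q0)" for p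
  \<comment> \<open>The unknown is the displacement from the starting point
    \<open>\<iota> p\<close>, so that the integral equation has initial value 0.\<close>
  define F where "F z = (\<Sum>j\<in>J. (fst z $ j) *\<^sub>R X j (\<iota> (fst z) + snd z))" for z
  have q0R: "q0 \<in> cball q0 R" using R by simp
  have \<iota>: "norm (\<iota> p - q0) \<le> R/4" if "p \<in> ball 0 \<delta>" for p
  proof -
    have "norm (\<iota> p - q0) \<le> norm p * Bt"
      unfolding \<iota>_def Bt_def using norm_sum_scaleR_le[of "\<lambda>j. X j q0" B p "-J"] B(2)[OF q0R] B(1)
      by (simp add: less_imp_le)
    then show ?thesis using pB(2)[OF that] by simp
  qed
  have inR: "\<iota> p + y \<in> cball q0 R" if "p \<in> ball 0 \<delta>" "norm y \<le> R/2" for p y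
    using \<iota>[OF that(1)] that(2) norm_triangle_ineq[of "\<iota> p - q0" y]
    by (simp add: dist_norm norm_minus_commute[of q0] algebra_simps) (use R in linarith)
  have Fle: "norm (F (p, y)) \<le> R/4" if "p \<in> ball 0 \<delta>" "norm y \<le> R/2" for p y
    unfolding F_def using norm_sum_scaleR_le[of "\<lambda>j. X j (\<iota> p + y)" B p J] B(2)[OF inR[OF that]] B(1)
      pB(2)[OF that(1)] by (force simp: less_imp_le Bt_def)
  have Flip: "norm (F (p, y) - F (p, z)) \<le> norm (y - z) / 2"
    if "p \<in> ball 0 \<delta>" "norm y \<le> R/2" "norm z \<le> R/2" for p y z
  proof -
    have "F (p, y) - F (p, z) = (\<Sum>j\<in>J. (p $ j) *\<^sub>R (X j (\<iota> p + y) - X j (\<iota> p + z)))"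
      by (simp add: F_def sum_subtractf algebra_simps)
    also have "norm \<dots> \<le> norm p * (\<Sum>j\<in>UNIV. B j * norm (y - z))"
      using B(3)[OF inR[OF that(1,2)] inR[OF that(1,3)]] B(1)
      by (intro norm_sum_scaleR_le) (auto simp: less_imp_le)
    also have "\<dots> = (norm p * Bt) * norm (y - z)" by (simp add: Bt_def sum_distrib_right mult.assoc)
    also have "\<dots> \<le> 1/2 * norm (y - z)" by (intro mult_right_mono pB that) auto
    finally show ?thesis by simp
  qed
  define N where "N = ball (0 :: real^'n) \<delta>"
  define Y where "Y = ball (0 :: real^'n) (R/2)"
  have oNY: "open (N \<times> Y)" by (simp add: N_def Y_def open_Times)
  have b\<iota>: "bounded_linear (\<lambda>p. \<Sum>j\<in>-J. (p $ j) *\<^sub>R X j q0)"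
    by (intro bounded_linear_sum bounded_linear_scaleR_const bounded_linear_vec_nth)
  have sm: "pcd k T (N \<times> Y) (\<lambda>t z. F z)" for k T
    unfolding F_def
  proof (intro pcd_sum[OF oNY] pcd_bilinear[OF oNY bounded_bilinear_scaleR])
    fix j
    show "pcd k T (N \<times> Y) (\<lambda>t z. fst z $ j)"
      by (intro pcd_bounded_linear_snd[OF _ oNY] bounded_linear_compose[OF bounded_linear_vec_nth bounded_linear_fst])
    have "pcd k T (N \<times> Y) (\<lambda>t z. q0 + ((\<Sum>j\<in>-J. (fst z $ j) *\<^sub>R X j q0) + snd z))"
      by (intro pcd_add[OF oNY] pcd_const pcd_bounded_linear_snd[OF _ oNY] bounded_linear_snd
        bounded_linear_compose[OF b\<iota> bounded_linear_fst])
    then have "pcd k T (N \<times> Y) (\<lambda>t z. \<iota> (fst z) + snd z)" by (simp add: \<iota>_def add.assoc)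
    from pcd_compose[OF oNY smooth_on_imp_pcd[OF X] this, of j]
    show "pcd k T (N \<times> Y) (\<lambda>t z. X j (\<iota> (fst z) + snd z))"
      using inR R(2) by (force simp: N_def Y_def less_imp_le)
  qed
  have cF0: "continuous_on (N \<times> Y) F"
    using pcd_imp_smooth_on[OF sm, of 0 UNIV] smooth_on_imp_continuous_on by auto
  have contF: "continuous_on {0..1} (\<lambda>s. F (p, u s))"
    if "p \<in> N" "continuous_on {0..1} u" "\<And>s. s \<in> {0..1} \<Longrightarrow> u s \<in> Y" for p and u :: "real \<Rightarrow> real^'n"
    by (rule continuous_on_compose2[OF cF0]) (use that in \<open>auto intro!: continuous_intros\<close>)
  have ex: "\<exists>u :: real \<Rightarrow> real^'n. continuous_on {0..1} u \<and> (\<forall>t\<in>{0..1}. u t \<in> Y \<and> u t = integral {0..t} (\<lambda>s. F (p, u s)))"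
    if p: "p \<in> N" for p
  proof -
    \<comment> \<open>Picard iteration needs a field that is Lipschitz on the whole space. The
      projection onto a ball is 1-Lipschitz, and since the speed is at most R/4 the solution stays
      in that ball up to time 1, where the projection changes nothing.\<close>
    define cl where "cl = closest_point (cball (0 :: real^'n) (R/4))"
    have ne: "cball (0 :: real^'n) (R/4) \<noteq> {}" using R by simp
    have cl: "norm (cl y) \<le> R/4" for y
      using closest_point_in_set[OF closed_cball ne, of y] by (simp add: cl_def)
    have clY: "cl y \<in> Y" and cl2: "norm (cl y) \<le> R/2" for y using cl[of y] R by (auto simp: Y_def)
    have cllip: "norm (cl y - cl z) \<le> norm (y - z)" for y z
      using closest_point_lipschitz[OF convex_cball closed_cball ne, of y z] by (simp add: cl_def dist_norm)
    have clc: "continuous_on S' cl" for S'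
      unfolding cl_def using continuous_on_closest_point[OF convex_cball closed_cball ne] by blast
    have cF: "continuous_on ({0..1::real} \<times> UNIV) (\<lambda>z. F (p, cl (snd z)))"
      by (rule continuous_on_compose2[OF cF0])
        (use p clY in \<open>auto intro!: continuous_intros continuous_on_compose2[OF clc[of UNIV]]\<close>)
    have lipF: "norm (F (p, cl y) - F (p, cl z)) \<le> norm (y - z) / 2" for y z
      using Flip[of p "cl y" "cl z"] cl2 cllip[of y z] p by (force simp: N_def)
    have "\<exists>u :: real \<Rightarrow> real^'n. continuous_on {0..1} u \<and> (\<forall>t\<in>{0..1}. u t = integral {0..t} (\<lambda>s. F (p, cl (u s))))"
      by (rule picard_exists[of "\<lambda>t y. F (p, cl y)", OF cF lipF]) blast+
    then obtain u :: "real \<Rightarrow> real^'n" where u: "continuous_on {0..1} u"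
      "\<And>t. t \<in> {0..1} \<Longrightarrow> u t = integral {0..t} (\<lambda>s. F (p, cl (u s)))" by blast
    have cu: "continuous_on {0..1} (\<lambda>s. F (p, cl (u s)))"
      by (rule contF[OF p]) (auto intro!: continuous_on_compose2[OF clc[of UNIV]] u clY)
    have le: "norm (u t) \<le> R/4" if t: "t \<in> {0..1}" for t
    proof -
      have "norm (u t) \<le> (R/4) * (t - 0)"
        unfolding u(2)[OF t]
        using t Fle[OF _ cl2] p by (intro integral_bound continuous_on_subset[OF cu]) (auto simp: N_def)
      also have "\<dots> \<le> (R/4) * 1" using t R by (intro mult_left_mono) auto
      finally show ?thesis by simp
    qed
    then have clu: "cl (u t) = u t" if "t \<in> {0..1}" for t
      using that by (simp add: cl_def closest_point_self)
    have "u t = integral {0..t} (\<lambda>s. F (p, u s))" if t: "t \<in> {0..1}" for t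
      unfolding u(2)[OF t] using t by (intro integral_cong) (auto simp: clu)
    moreover have "u t \<in> Y" if t: "t \<in> {0..1}" for t using le[OF t] R by (simp add: Y_def)
    ultimately show ?thesis using u(1) by blast
  qed
  define x where "x t p = (SOME u :: real \<Rightarrow> real^'n. continuous_on {0..1} u \<and>
    (\<forall>t\<in>{0..1}. u t \<in> Y \<and> u t = integral {0..t} (\<lambda>s. F (p, u s)))) t" for t p
  have x: "continuous_on {0..1} (\<lambda>t. x t p)"
    "\<And>t. t \<in> {0..1} \<Longrightarrow> x t p \<in> Y" "\<And>t. t \<in> {0..1} \<Longrightarrow> x t p = integral {0..t} (\<lambda>s. F (p, x s p))"
    if "p \<in> N" for p
    using someI_ex[OF ex[OF that]] unfolding x_def by blast+
  have xk: "pcd k {0..1} N x" for k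
  proof (rule ode_pcd[where F = "\<lambda>t. F" and X = Y])
    show "pcd k {0..1} (N \<times> Y) (\<lambda>t. F)" using sm by simp
    show "norm (F (p, y) - F (p, z)) \<le> norm (y - z) / 2" if "p \<in> N" "y \<in> Y" "z \<in> Y" for p y z
      using that by (intro Flip) (auto simp: N_def Y_def)
  qed (use x in \<open>auto simp: N_def Y_def\<close>)
  have xF: "continuous_on {0..1} (\<lambda>s. F (p, x s p))" if "p \<in> N" for p
    using x[OF that] that by (intro contF)
  have xder: "((\<lambda>t. x t p) has_vector_derivative F (p, x t p)) (at t within {0..1})"
    if p: "p \<in> N" and t: "t \<in> {0..1}" for t p
    by (rule has_vector_derivative_transform[OF t _ integral_has_vector_derivative[OF xF[OF p] t]])
      (use x(3)[OF p] in auto)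
  have x0: "x 0 p = 0" if "p \<in> N" for p using x(3)[OF that, of 0] by simp
  define sc where "sc s p = (p - coord_proj J p) + s *\<^sub>R coord_proj J p" for s p
  have sc_nth: "sc s p $ j = (if j \<in> J then s * p $ j else p $ j)" for s p j
    by (simp add: sc_def)
  have scN: "sc s p \<in> N" if "p \<in> N" "s \<in> {0..1}" for s p
  proof -
    have "norm (sc s p) \<le> norm p"
      using that(2) by (intro norm_le_componentwise_cart) (auto simp: sc_nth abs_mult mult_left_le_one_le)
    then show ?thesis using that(1) by (simp add: N_def)
  qed
  have \<iota>sc: "\<iota> (sc s p) = \<iota> p" for s p by (simp add: \<iota>_def sc_nth)
  have Fsc: "F (sc s p, y) = s *\<^sub>R F (p, y)" for s p y
    by (simp add: F_def \<iota>sc sc_nth scaleR_sum_right)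
  \<comment> \<open>Scaling the J-coordinates by \<open>s\<close> multiplies the field by
    \<open>s\<close>, which amounts to running time slower by that factor. Both sides solve the
    integral equation for \<open>sc s p\<close>, so they agree by uniqueness.\<close>
  have hom: "x t (sc s p) = x (t * s) p" if p: "p \<in> N" and s: "s \<in> {0..1}" and t: "t \<in> {0..1}" for s t p
  proof -
    have ts: "t * s \<in> {0..1}" if "t \<in> {0..1}" for t
      using that s by (auto simp: mult_le_one)
    have cxs: "continuous_on {0..1} (\<lambda>t. x (t * s) p)"
      by (rule continuous_on_compose2[OF x(1)[OF p]]) (use ts in \<open>auto intro!: continuous_intros\<close>)
    have cF: "continuous_on {0..1} (\<lambda>t. F (sc s p, x (t * s) p))"
      by (rule contF[OF scN[OF p s] cxs]) (use x(2)[OF p] ts in auto)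
    have eq: "x (t * s) p = integral {0..t} (\<lambda>t. F (sc s p, x (t * s) p))" if t: "t \<in> {0..1}" for t
    proof -
      have "((\<lambda>t. F (sc s p, x (t * s) p)) has_integral (x (t * s) p - x (0 * s) p)) {0..t}"
      proof (rule fundamental_theorem_of_calculus)
        fix r assume r: "r \<in> {0..t}"
        then have r1: "r \<in> {0..1}" using t by simp
        have "(((\<lambda>t. x t p) \<circ> (\<lambda>t. t * s)) has_vector_derivative s *\<^sub>R F (p, x (r * s) p)) (at r within {0..1})"
        proof (rule vector_diff_chain_within)
          show "((\<lambda>t. t * s) has_vector_derivative s) (at r within {0..1})"
            by (auto intro!: derivative_eq_intros)
          show "((\<lambda>t. x t p) has_vector_derivative F (p, x (r * s) p)) (at (r * s) within (\<lambda>t. t * s) ` {0..1})"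
            by (rule has_vector_derivative_within_subset[OF xder[OF p ts[OF r1]]]) (use ts in blast)
        qed
        then have "((\<lambda>t. x (t * s) p) has_vector_derivative F (sc s p, x (r * s) p)) (at r within {0..1})"
          by (simp add: o_def Fsc)
        then show "((\<lambda>t. x (t * s) p) has_vector_derivative F (sc s p, x (r * s) p)) (at r within {0..t})"
          by (rule has_vector_derivative_within_subset) (use t in auto)
      qed (use t in auto)
      then show ?thesis using x0[OF p] by (simp add: has_integral_iff)
    qed
    have sub: "continuous_on {0..t} f" if "continuous_on {0..1} f" "t \<in> {0..1}" for f :: "real \<Rightarrow> real^'n" and t
      using that by (auto elim: continuous_on_subset)
    have "norm (x t (sc s p) - x (t * s) p) \<le> 2 * 0"
    proof (rule half_contraction_bound[OF _ _ _ _ t])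
      show "continuous_on {0..1} (\<lambda>t. x t (sc s p) - x (t * s) p)"
        using x(1)[OF scN[OF p s]] cxs by (intro continuous_on_diff)
      show "continuous_on {0..1} (\<lambda>t. F (sc s p, x t (sc s p)) - F (sc s p, x (t * s) p))"
        using xF[OF scN[OF p s]] cF by (intro continuous_on_diff)
      show "x t (sc s p) - x (t * s) p = integral {0..t} (\<lambda>t. F (sc s p, x t (sc s p)) - F (sc s p, x (t * s) p))"
        if t: "t \<in> {0..1}" for t
        using x(3)[OF scN[OF p s] t] eq[OF t] integral_diff[OF integrable_continuous_real[OF sub[OF xF[OF scN[OF p s]] t]]
           integrable_continuous_real[OF sub[OF cF t]]] by simp
      show "norm (F (sc s p, x t (sc s p)) - F (sc s p, x (t * s) p)) \<le> norm (x t (sc s p) - x (t * s) p) / 2 + 0"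
        if t: "t \<in> {0..1}" for t
        using Flip[of "sc s p" "x t (sc s p)" "x (t * s) p"] scN[OF p s] x(2)[OF scN[OF p s] t] x(2)[OF p ts[OF t]]
        by (simp add: N_def Y_def)
    qed
    then show ?thesis by simp
  qed
  define \<Phi> where "\<Phi> p = \<iota> p + x 1 p" for p
  have smx: "smooth_on N (x 1)" by (rule pcd_imp_smooth_on[OF xk]) simp
  have oN: "open N" by (simp add: N_def)
  have sm\<iota>: "smooth_on N \<iota>"
    unfolding \<iota>_def by (intro smooth_on_add[OF oN] smooth_on_const smooth_on_bounded_linear[OF oN b\<iota>])
  have sm\<Phi>: "smooth_on N \<Phi>" unfolding \<Phi>_def by (rule smooth_on_add[OF oN sm\<iota> smx])
  have D: "(\<Phi> has_derivative frechet_derivative \<Phi> (at p)) (at p)" if "p \<in> N" for p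
    by (rule smooth_on_has_derivative[OF sm\<Phi> that])
  have N0: "0 \<in> N" using \<delta> by (simp add: N_def)
  \<comment> \<open>Along the segment traced by \<open>sc s p\<close> the map \<open>\<Phi>\<close>
    is the trajectory itself, so its derivative there can be computed by the chain rule and by the
    flow equation.\<close>
  have radial: "frechet_derivative \<Phi> (at (sc s p)) (coord_proj J p) = (\<Sum>j\<in>J. (p $ j) *\<^sub>R X j (\<Phi> (sc s p)))"
    if p: "p \<in> N" and s: "s \<in> {0..1}" for s p
  proof -
    have eq: "\<Phi> (sc s p) = \<iota> p + x s p" if "s \<in> {0..1}" for s
      using hom[OF p that, of 1] by (simp add: \<Phi>_def \<iota>sc)
    have "((\<lambda>s. \<iota> p + x s p) has_vector_derivative F (p, x s p)) (at s within {0..1})"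
      using has_vector_derivative_add[OF has_vector_derivative_const xder[OF p s]] by simp
    then have "((\<lambda>s. \<Phi> (sc s p)) has_vector_derivative F (p, x s p)) (at s within {0..1})"
      by (rule has_vector_derivative_transform[OF s, rotated]) (use eq in auto)
    moreover have "((\<lambda>s. \<Phi> (sc s p)) has_vector_derivative frechet_derivative \<Phi> (at (sc s p)) (coord_proj J p)) (at s within {0..1})"
      unfolding sc_def by (rule has_derivative_along_line[OF D]) (use scN[OF p s] in \<open>simp add: sc_def\<close>)
    ultimately have "frechet_derivative \<Phi> (at (sc s p)) (coord_proj J p) = F (p, x s p)"
      using vector_derivative_unique_within_closed_interval[of 0 1 s "\<lambda>s. \<Phi> (sc s p)"] s by auto
    then show ?thesis by (simp add: F_def eq[OF s])
  qed
  have sc1: "sc 1 p = p" for p by (simp add: sc_def)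
  \<comment> \<open>On the slice where the J-coordinates vanish the field is zero, so
    \<open>\<Phi>\<close> equals the affine map \<open>\<iota>\<close> along the whole line through
    \<open>p\<close> in the direction \<open>v\<close>.\<close>
  have b: "frechet_derivative \<Phi> (at p) v = (\<Sum>j\<in>UNIV. (v $ j) *\<^sub>R X j q0)"
    if p: "p \<in> N" "coord_proj J p = 0" and v: "coord_proj J v = 0" for p v
  proof -
    have z: "p $ j = 0" "v $ j = 0" if "j \<in> J" for j
      using that p(2) v by (metis coord_proj_nth zero_index)+
    have "((\<lambda>s. \<Phi> (p + s *\<^sub>R v)) has_vector_derivative frechet_derivative \<Phi> (at p) v) (at 0)"
      using has_derivative_along_line[of \<Phi> _ p 0 v UNIV] D[OF p(1)] by simp
    moreover have "((\<lambda>s. \<Phi> (p + s *\<^sub>R v)) has_vector_derivative (\<Sum>j\<in>UNIV. (v $ j) *\<^sub>R X j q0)) (at 0)"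
    proof (rule has_vector_derivative_transform_within_open)
      show "((\<lambda>s. \<iota> p + s *\<^sub>R (\<Sum>j\<in>UNIV. (v $ j) *\<^sub>R X j q0)) has_vector_derivative (\<Sum>j\<in>UNIV. (v $ j) *\<^sub>R X j q0)) (at 0)"
        by (auto intro!: derivative_eq_intros)
      show "open ((\<lambda>s. p + s *\<^sub>R v) -` N)"
        using oN by (intro open_vimage continuous_intros)
      fix s assume "s \<in> (\<lambda>s. p + s *\<^sub>R v) -` N"
      then have sN: "p + s *\<^sub>R v \<in> N" by simp
      have "F (p + s *\<^sub>R v, y) = 0" for y by (simp add: F_def z)
      then have "x 1 (p + s *\<^sub>R v) = 0" using x(3)[OF sN, of 1] by simp
      moreover have "(\<Sum>j\<in>UNIV. (v $ j) *\<^sub>R X j q0) = (\<Sum>j\<in>-J. (v $ j) *\<^sub>R X j q0)"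
        by (rule sum.mono_neutral_right) (auto simp: z)
      ultimately show "\<iota> p + s *\<^sub>R (\<Sum>j\<in>UNIV. (v $ j) *\<^sub>R X j q0) = \<Phi> (p + s *\<^sub>R v)"
        by (simp add: \<Phi>_def \<iota>_def algebra_simps sum.distrib scaleR_sum_right)
    qed (use p in simp)
    ultimately show ?thesis by (rule vector_derivative_unique_at)
  qed
  show ?thesis
  proof (rule that[OF \<delta>, folded N_def])
    show "smooth_on N \<Phi>" by (rule sm\<Phi>)
    show \<Phi>0: "\<Phi> 0 = q0"
    proof -
      have "F (0, y) = 0" for y by (simp add: F_def)
      then show ?thesis using x(3)[OF N0, of 1] by (simp add: \<Phi>_def \<iota>_def)
    qed
    show "\<Phi> p \<in> S" if "p \<in> N" for p
      using inR[of p "x 1 p"] R(2) x(2)[OF that, of 1] that by (auto simp: \<Phi>_def N_def Y_def)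
    show "frechet_derivative \<Phi> (at p) (coord_proj J p) = (\<Sum>j\<in>J. (p $ j) *\<^sub>R X j (\<Phi> p))" if "p \<in> N" for p
      using radial[OF that, of 1] by (simp add: sc1)
    show "frechet_derivative \<Phi> (at p) v = (\<Sum>j\<in>UNIV. (v $ j) *\<^sub>R X j q0)"
      if "p \<in> N" "coord_proj J p = 0" "coord_proj J v = 0" for p v using that by (rule b)
    fix v
    have lin: "linear (frechet_derivative \<Phi> (at 0))" using D[OF N0] by (rule has_derivative_linear)
    define w where "w = coord_proj J v"
    \<comment> \<open>The J-part \<open>w\<close> of \<open>v\<close> may lie outside the parameter
      ball, so the radial formula at \<open>s = 0\<close> is applied to a small multiple and
      linearity removes the factor.\<close>
    define e where "e = \<delta> / (2 * (norm w + 1))"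
    have nw: "norm w + 1 > 0" by (simp add: add_nonneg_pos)
    have e: "e > 0" using \<delta> nw by (simp add: e_def)
    have "e * norm w \<le> e * (norm w + 1)" using e by simp
    also have "\<dots> = \<delta> / 2" using nw by (simp add: e_def field_simps)
    finally have ewN: "e *\<^sub>R w \<in> N" using e \<delta> by (simp add: N_def)
    have pe: "coord_proj J (e *\<^sub>R w) = e *\<^sub>R w" by (simp add: vec_eq_iff w_def)
    have "sc 0 (e *\<^sub>R w) = 0" by (simp add: sc_def pe)
    with radial[OF ewN, of 0] have "frechet_derivative \<Phi> (at 0) (e *\<^sub>R w) = (\<Sum>j\<in>J. (e * w $ j) *\<^sub>R X j q0)"
      by (simp add: pe \<Phi>0)
    then have "e *\<^sub>R frechet_derivative \<Phi> (at 0) w = e *\<^sub>R (\<Sum>j\<in>J. (w $ j) *\<^sub>R X j q0)"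
      by (simp add: linear_scale[OF lin] scaleR_sum_right)
    then have A: "frechet_derivative \<Phi> (at 0) w = (\<Sum>j\<in>J. (w $ j) *\<^sub>R X j q0)" using e by simp
    have B: "frechet_derivative \<Phi> (at 0) (v - w) = (\<Sum>j\<in>UNIV. ((v - w) $ j) *\<^sub>R X j q0)"
      by (rule b[OF N0]) (simp_all add: vec_eq_iff w_def)
    have "(\<Sum>j\<in>J. (w $ j) *\<^sub>R X j q0) = (\<Sum>j\<in>UNIV. (w $ j) *\<^sub>R X j q0)"
      by (rule sum.mono_neutral_left) (auto simp: w_def)
    then have "frechet_derivative \<Phi> (at 0) (w + (v - w)) = (\<Sum>j\<in>UNIV. (w $ j + (v - w) $ j) *\<^sub>R X j q0)"
      unfolding linear_add[OF lin] A B by (simp only: sum.distrib scaleR_left.add)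
    then show "frechet_derivative \<Phi> (at 0) v = (\<Sum>j\<in>UNIV. (v $ j) *\<^sub>R X j q0)" by simp
  qed
qed

section \<open>Radial structure of exponential charts\<close>

text \<open>The chart is the local inverse of the map from \<open>exp_map\<close>. Radially its
  derivative is a frame combination at the same point, which the dual coframe evaluates to the
  coordinates; on the slice it is a combination of the frame at the base point, which the coframe at
  \<open>p\<close> need not evaluate to constants.\<close>

lemma exp_chart:
  fixes A :: "('m::{t2_space, second_countable_topology}, 'n::finite) chart set" and J :: "'n set"
  assumes A: "smooth_structure A" and \<omega>: "coframe A \<omega>" and c: "c \<in> A"
    and p0: "p0 \<in> chart_dom c" "p0 \<in> W" and W: "open W"
  obtains V \<phi> r where "r > 0" "(V, \<phi>) \<in> A" "p0 \<in> V" "V \<subseteq> chart_dom c \<inter> W" "\<phi> ` V = ball 0 r" "\<phi> p0 = 0"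
    "\<And>i p. p \<in> V \<Longrightarrow> \<omega> i (V, \<phi>) p (coord_proj J (\<phi> p)) = (if i \<in> J then \<phi> p $ i else 0)"
    "\<And>i p v. p \<in> V \<Longrightarrow> coord_proj J (\<phi> p) = 0 \<Longrightarrow> coord_proj J v = 0 \<Longrightarrow>
      \<omega> i (V, \<phi>) p v = \<omega> i c p (\<Sum>j\<in>UNIV. (v $ j) *\<^sub>R dual_frame \<omega> c j (chart_map c p0))"
proof -
  define S where "S = chart_map c ` chart_dom c"
  define q0 where "q0 = chart_map c p0"
  have ch: "is_chart c" using A c by (rule smooth_structure_is_chart)
  have S: "open S" using ch by (simp add: S_def is_chart_def)
  have q0: "q0 \<in> S" using p0 by (simp add: S_def q0_def)
  have inv: "chart_inv c (chart_map c p) = p" if "p \<in> chart_dom c" for p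
    using is_chart_inj_on[OF ch] that by simp
  have X: "smooth_on S (dual_frame \<omega> c j)" for j
    unfolding S_def by (rule smooth_on_dual_frame[OF A \<omega> c])
  have lin: "linear (\<omega> i c p)" if "p \<in> chart_dom c" for i p
    by (rule coframe_linear[OF \<omega> c that])
  have dual: "\<omega> i c p (dual_frame \<omega> c j (chart_map c p)) = (if i = j then 1 else 0)" if "p \<in> chart_dom c" for i j p
    using dual_frame[OF \<omega> c, of "chart_map c p" i j] that by (simp add: inv)
  have dualsum: "\<omega> i c p (\<Sum>j\<in>I. (v $ j) *\<^sub>R dual_frame \<omega> c j (chart_map c p)) = (if i \<in> I then v $ i else 0)"
    if "p \<in> chart_dom c" for i p v I
    using lin[OF that] by (simp add: linear_sum linear_scale dual[OF that] if_distrib cong: if_cong)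
  obtain \<delta> \<Phi> where \<Phi>: "\<delta> > 0" "smooth_on (ball 0 \<delta>) \<Phi>" "\<Phi> 0 = q0"
    "\<And>p. p \<in> ball 0 \<delta> \<Longrightarrow> \<Phi> p \<in> S"
    "\<And>p. p \<in> ball 0 \<delta> \<Longrightarrow> frechet_derivative \<Phi> (at p) (coord_proj J p) = (\<Sum>j\<in>J. (p $ j) *\<^sub>R dual_frame \<omega> c j (\<Phi> p))"
    "\<And>p v. p \<in> ball 0 \<delta> \<Longrightarrow> coord_proj J p = 0 \<Longrightarrow> coord_proj J v = 0 \<Longrightarrow>
      frechet_derivative \<Phi> (at p) v = (\<Sum>j\<in>UNIV. (v $ j) *\<^sub>R dual_frame \<omega> c j q0)"
    "\<And>v. frechet_derivative \<Phi> (at 0) v = (\<Sum>j\<in>UNIV. (v $ j) *\<^sub>R dual_frame \<omega> c j q0)"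
    by (rule exp_map[where J = J, OF S X q0 that])
  have z: "(0 :: real^'n) \<in> ball 0 \<delta>" using \<Phi>(1) by simp
  have lin0: "linear (frechet_derivative \<Phi> (at 0))"
    using smooth_on_has_derivative[OF \<Phi>(2) z] by (rule has_derivative_linear)
  have "inj (frechet_derivative \<Phi> (at 0))"
    unfolding linear_injective_0[OF lin0]
  proof (intro allI impI)
    fix v assume "frechet_derivative \<Phi> (at 0) v = 0"
    then have "v $ i = 0" for i
      using dualsum[OF p0(1), of i v UNIV] linear_0[OF lin[OF p0(1)]] by (simp add: \<Phi>(7) q0_def)
    then show "v = 0" by (simp add: vec_eq_iff)
  qed
  from chart_reparam[OF A c p0 W open_ball z \<Phi>(2) _ this] \<Phi>(3)
  obtain V1 \<phi> where V1: "(V1, \<phi>) \<in> A" "p0 \<in> V1" "V1 \<subseteq> chart_dom c \<inter> W" "\<phi> p0 = 0" "\<phi> ` V1 \<subseteq> ball 0 \<delta>"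
    "\<And>p. p \<in> V1 \<Longrightarrow> \<Phi> (\<phi> p) = chart_map c p"
    by (metis q0_def)
  have "is_chart (V1, \<phi>)" using A V1(1) by (rule smooth_structure_is_chart)
  then have "open (\<phi> ` V1)" by (simp add: is_chart_def)
  moreover have "0 \<in> \<phi> ` V1" using V1(2,4) by (metis imageI)
  \<comment> \<open>A ball is closed under shrinking the J-coordinates, so it contains the rays
    along which the differential equations run.\<close>
  ultimately obtain r where r: "r > 0" "ball 0 r \<subseteq> \<phi> ` V1" using openE by metis
  define V where "V = V1 \<inter> \<phi> -` ball 0 r"
  have VA: "(V, \<phi>) \<in> A" "\<phi> ` V = ball 0 r"
    using chart_restrict[OF A V1(1), of "ball 0 r"] r by (auto simp: V_def)
  have form: "\<omega> i (V, \<phi>) p v = \<omega> i c p (frechet_derivative \<Phi> (at (\<phi> p)) v)" if "p \<in> V" for i p v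
    by (rule form1_reparam[OF A coframe_smooth_form1[OF \<omega>] c VA(1)])
      (use that V1 in \<open>auto simp: V_def\<close>)
  have pV: "p \<in> chart_dom c" "\<phi> p \<in> ball 0 \<delta>" "\<Phi> (\<phi> p) = chart_map c p" if "p \<in> V" for p
    using that V1 by (auto simp: V_def)
  show ?thesis
  proof (rule that[OF r(1) VA(1) _ _ VA(2) V1(4)])
    show "p0 \<in> V" using V1 r by (simp add: V_def)
    show "V \<subseteq> chart_dom c \<inter> W" using V1 by (auto simp: V_def)
    show "\<omega> i (V, \<phi>) p (coord_proj J (\<phi> p)) = (if i \<in> J then \<phi> p $ i else 0)" if "p \<in> V" for i p
      unfolding form[OF that] \<Phi>(5)[OF pV(2)[OF that]] pV(3)[OF that] by (rule dualsum[OF pV(1)[OF that]])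
    show "\<omega> i (V, \<phi>) p v = \<omega> i c p (\<Sum>j\<in>UNIV. (v $ j) *\<^sub>R dual_frame \<omega> c j (chart_map c p0))"
      if "p \<in> V" "coord_proj J (\<phi> p) = 0" "coord_proj J v = 0" for i p v
      unfolding form[OF that(1)] \<Phi>(6)[OF pV(2)[OF that(1)] that(2,3)] by (simp add: q0_def)
  qed
qed

section \<open>Cartan's formula and differential equations along rays\<close>

definition ray :: "'n set \<Rightarrow> real \<Rightarrow> real^'n \<Rightarrow> real^'n" where
  "ray J s q = (q - coord_proj J q) + s *\<^sub>R coord_proj J q"

lemma ray_nth: "ray J s q $ j = (if j \<in> J then s * q $ j else q $ j)"
  by (simp add: ray_def)

lemma coord_proj_ray: "coord_proj J (ray J s q) = s *\<^sub>R coord_proj J q"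
  by (simp add: vec_eq_iff ray_nth)

lemma ray_1: "ray J 1 q = q" by (simp add: ray_def)

lemma ray_in_ball:
  assumes "q \<in> ball 0 r" "s \<in> {0..1}"
  shows "ray J s q \<in> ball 0 r"
proof -
  have "norm (ray J s q) \<le> norm q"
    using assms(2) by (intro norm_le_componentwise_cart) (auto simp: ray_nth abs_mult mult_left_le_one_le)
  then show ?thesis using assms(1) by simp
qed

context
  fixes A :: "('m::{t2_space, second_countable_topology}, 'n::finite) chart set"
    and \<alpha> :: "('m, 'n) form1" and V \<phi> r J and l :: "real^'n \<Rightarrow> real"
  assumes A: "smooth_structure A" and \<alpha>: "smooth_form1 A \<alpha>" and V: "(V, \<phi>) \<in> A"
    and ball: "\<phi> ` V = ball 0 r" and l: "bounded_linear l"
    and rad: "\<And>p. p \<in> V \<Longrightarrow> \<alpha> (V, \<phi>) p (coord_proj J (\<phi> p)) = l (\<phi> p)"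
begin

abbreviation (input) "\<beta> v q \<equiv> \<alpha> (V, \<phi>) (inv_into V \<phi> q) v"

lemma radial_chart_facts:
  assumes "q \<in> ball 0 r"
  shows "inv_into V \<phi> q \<in> V" "\<phi> (inv_into V \<phi> q) = q" "linear (\<lambda>v. \<beta> v q)"
    "(\<beta> v has_derivative frechet_derivative (\<beta> v) (at q)) (at q)"
proof -
  show V': "inv_into V \<phi> q \<in> V" "\<phi> (inv_into V \<phi> q) = q"
    using assms ball by (auto intro: inv_into_into f_inv_into_f)
  have "\<forall>c\<in>A. \<forall>p\<in>chart_dom c. linear (\<alpha> c p)"
    and s: "\<forall>c\<in>A. \<forall>v. smooth_on (chart_map c ` chart_dom c) (\<lambda>q. \<alpha> c (chart_inv c q) v)"
    using \<alpha> by (simp_all add: smooth_form1_def)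
  from this(1)[rule_format, OF V] show "linear (\<lambda>v. \<beta> v q)" using V'(1) by simp
  from s[rule_format, OF V, of v] have "smooth_on (ball 0 r) (\<beta> v)" by (simp add: ball)
  then show "(\<beta> v has_derivative frechet_derivative (\<beta> v) (at q)) (at q)"
    using assms by (rule smooth_on_has_derivative)
qed

text \<open>Cartan's formula for the radial field R in the J-coordinates: the Lie derivative
  consists of the derivative of the coefficient along R and of \<open>\<alpha>\<close> applied to
  the derivative of R in the direction \<open>v\<close>, which is \<open>coord_proj J v\<close>; the
  contraction with R contributes \<open>l v\<close>.\<close>

lemma radial_d_form1:
  assumes q: "q \<in> ball 0 r"
  shows "d_form1 \<alpha> (V, \<phi>) (inv_into V \<phi> q) (coord_proj J q) v =
    frechet_derivative (\<beta> v) (at q) (coord_proj J q) + \<beta> (coord_proj J v) q - l v"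
proof -
  note F = radial_chart_facts
  define D where "D k = frechet_derivative (\<beta> (axis k 1)) (at q)" for k
  have D: "(\<beta> (axis k 1) has_derivative D k) (at q)" for k
    unfolding D_def by (rule F(4)[OF q])
  have exp: "\<beta> w q' = (\<Sum>k\<in>UNIV. w $ k * \<beta> (axis k 1) q')" if "q' \<in> ball 0 r" for w q'
    using linear_axis_expand[OF F(3)[OF that], of w] by simp
  have Dexp: "frechet_derivative (\<beta> w) (at q) = (\<lambda>h. \<Sum>k\<in>UNIV. w $ k * D k h)" for w
  proof -
    have "((\<lambda>q'. \<Sum>k\<in>UNIV. w $ k * \<beta> (axis k 1) q') has_derivative (\<lambda>h. \<Sum>k\<in>UNIV. w $ k * D k h)) (at q)"
      by (intro has_derivative_sum has_derivative_mult_right D)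
    then have "(\<beta> w has_derivative (\<lambda>h. \<Sum>k\<in>UNIV. w $ k * D k h)) (at q)"
      by (rule has_derivative_transform_within_open[OF _ open_ball q]) (simp add: exp[of _ w])
    then show ?thesis by (rule frechet_derivative_at[symmetric])
  qed
  have nth: "((\<lambda>q'. coord_proj J q' $ k) has_derivative (\<lambda>h. coord_proj J h $ k)) (at q)" for k
    by (cases "k \<in> J") (auto intro!: bounded_linear_imp_has_derivative bounded_linear_vec_nth)
  \<comment> \<open>In the identity \<open>rad\<close> both the form and its argument vary with the
    point; in components the product rule separates the two contributions.\<close>
  have "((\<lambda>q'. \<Sum>k\<in>UNIV. coord_proj J q' $ k * \<beta> (axis k 1) q') has_derivative
      (\<lambda>h. \<Sum>k\<in>UNIV. coord_proj J q $ k * D k h + coord_proj J h $ k * \<beta> (axis k 1) q)) (at q)"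
    by (intro has_derivative_sum has_derivative_mult nth D)
  then have "(l has_derivative
      (\<lambda>h. \<Sum>k\<in>UNIV. coord_proj J q $ k * D k h + coord_proj J h $ k * \<beta> (axis k 1) q)) (at q)"
  proof (rule has_derivative_transform_within_open[OF _ open_ball q])
    fix q' :: "real^'n" assume q': "q' \<in> ball 0 r"
    show "(\<Sum>k\<in>UNIV. coord_proj J q' $ k * \<beta> (axis k 1) q') = l q'"
      using rad[OF F(1)[OF q']] F(2)[OF q'] exp[OF q', of "coord_proj J q'"] by simp
  qed
  from has_derivative_unique[OF this bounded_linear_imp_has_derivative[OF l]]
  have "l v = (\<Sum>k\<in>UNIV. coord_proj J q $ k * D k v) + (\<Sum>k\<in>UNIV. coord_proj J v $ k * \<beta> (axis k 1) q)"
    by (simp add: fun_eq_iff sum.distrib del: coord_proj_nth)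
  then have "frechet_derivative (\<beta> (coord_proj J q)) (at q) v = l v - \<beta> (coord_proj J v) q"
    unfolding exp[OF q, of "coord_proj J v"] Dexp by simp
  then show ?thesis by (simp add: d_form1_def F(2)[OF q])
qed

lemma ray_derivative:
  assumes q: "q \<in> ball 0 r" and s: "s \<in> {0..1}"
  shows "((\<lambda>s. \<beta> v (ray J s q)) has_real_derivative
     frechet_derivative (\<beta> v) (at (ray J s q)) (coord_proj J q)) (at s within {0..1})"
  unfolding has_real_derivative_iff_has_vector_derivative ray_def
  by (rule has_derivative_along_line[where f = "\<beta> v"])
    (use radial_chart_facts(4)[OF ray_in_ball[OF q s]] in \<open>simp add: ray_def\<close>)

text \<open>Radial differentiation is \<open>s\<close> times the derivative along the ray, and for
  tangential \<open>v\<close> Cartan's formula adds the coefficient itself. Together these are the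
  derivative of \<open>s\<close> times the coefficient, a quantity that starts at 0.\<close>

lemma radial_ode_tangential:
  assumes q: "q \<in> ball 0 r" and s: "s \<in> {0..1}" and v: "coord_proj J v = v"
  shows "((\<lambda>s. s * \<beta> v (ray J s q)) has_real_derivative
    d_form1 \<alpha> (V, \<phi>) (inv_into V \<phi> (ray J s q)) (coord_proj J (ray J s q)) v + l v) (at s within {0..1})"
proof -
  have lin: "linear (frechet_derivative (\<beta> v) (at (ray J s q)))"
    using radial_chart_facts(4)[OF ray_in_ball[OF q s]] by (rule has_derivative_linear)
  have "((\<lambda>s. s * \<beta> v (ray J s q)) has_real_derivative
      s * frechet_derivative (\<beta> v) (at (ray J s q)) (coord_proj J q) + \<beta> v (ray J s q)) (at s within {0..1})"
    using DERIV_mult[OF DERIV_ident ray_derivative[OF q s, of v]] by (simp add: mult.commute add.commute)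
  moreover have "s * frechet_derivative (\<beta> v) (at (ray J s q)) (coord_proj J q) + \<beta> v (ray J s q) =
    d_form1 \<alpha> (V, \<phi>) (inv_into V \<phi> (ray J s q)) (coord_proj J (ray J s q)) v + l v"
    unfolding radial_d_form1[OF ray_in_ball[OF q s]] by (simp add: coord_proj_ray v linear_scale[OF lin])
  ultimately show ?thesis by simp
qed

text \<open>For transversal \<open>v\<close> the extra coefficient disappears, so only
  \<open>s * y'\<close> is determined and the value at \<open>s = 0\<close> has to be found on the
  slice.\<close>

lemma radial_ode_transversal:
  assumes q: "q \<in> ball 0 r" and s: "s \<in> {0..1}" and v: "coord_proj J v = 0"
  shows "\<exists>y'. ((\<lambda>s. \<beta> v (ray J s q)) has_real_derivative y') (at s within {0..1}) \<and>
    s * y' = d_form1 \<alpha> (V, \<phi>) (inv_into V \<phi> (ray J s q)) (coord_proj J (ray J s q)) v + l v"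
proof (intro exI conjI, rule ray_derivative[OF q s, of v])
  have lin: "linear (frechet_derivative (\<beta> v) (at (ray J s q)))"
    using radial_chart_facts(4)[OF ray_in_ball[OF q s]] by (rule has_derivative_linear)
  show "s * frechet_derivative (\<beta> v) (at (ray J s q)) (coord_proj J q) =
    d_form1 \<alpha> (V, \<phi>) (inv_into V \<phi> (ray J s q)) (coord_proj J (ray J s q)) v + l v"
    unfolding radial_d_form1[OF ray_in_ball[OF q s]]
    using linear_0[OF radial_chart_facts(3)[OF ray_in_ball[OF q s]]]
    by (simp add: coord_proj_ray v linear_scale[OF lin])
qed

end

text \<open>The weighted energy \<open>g\<close> does not increase. Each of the four coefficient
  terms contributes at most M times a sum of two squares by 2uv \<le> u^2 + v^2, which adds up to 4
  M times the energy; hence the rate in the exponential.\<close>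

lemma linear_system2_zero:
  fixes y1 y2 a b c d :: "real \<Rightarrow> real"
  assumes y1: "\<And>s. s \<in> {0..1} \<Longrightarrow> (y1 has_real_derivative a s * y1 s + b s * y2 s) (at s within {0..1})"
    and y2: "\<And>s. s \<in> {0..1} \<Longrightarrow> (y2 has_real_derivative c s * y1 s + d s * y2 s) (at s within {0..1})"
    and M: "\<And>s. s \<in> {0..1} \<Longrightarrow> \<bar>a s\<bar> \<le> M \<and> \<bar>b s\<bar> \<le> M \<and> \<bar>c s\<bar> \<le> M \<and> \<bar>d s\<bar> \<le> M"
    and init: "y1 0 = 0" "y2 0 = 0"
  shows "y1 1 = 0" "y2 1 = 0"
proof -
  define g where "g s = exp (- 4 * M * s) * ((y1 s)\<^sup>2 + (y2 s)\<^sup>2)" for s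
  have "g 1 \<le> g 0"
  proof (rule DERIV_nonpos_imp_decreasing_open[of 0 1 g])
    have "continuous_on {0..1} y1" "continuous_on {0..1} y2"
      by (rule DERIV_continuous_on, erule y1, rule DERIV_continuous_on, erule y2)
    then show "continuous_on {0..1} g" unfolding g_def by (intro continuous_intros)
    fix s :: real assume s: "0 < s" "s < 1"
    then have w: "at s within {0..1} = at s" by (intro at_within_Icc_at) auto
    have D: "(y1 has_real_derivative a s * y1 s + b s * y2 s) (at s)"
      "(y2 has_real_derivative c s * y1 s + d s * y2 s) (at s)"
      using y1[of s] y2[of s] s by (simp_all add: w)
    define g' where "g' = exp (- 4 * M * s) * (- 4 * M * ((y1 s)\<^sup>2 + (y2 s)\<^sup>2)
      + 2 * y1 s * (a s * y1 s + b s * y2 s) + 2 * y2 s * (c s * y1 s + d s * y2 s))"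
    have "(g has_real_derivative g') (at s)"
      unfolding g_def g'_def
      by (rule derivative_eq_intros D refl)+ (simp add: algebra_simps power2_eq_square)
    moreover have "g' \<le> 0"
    proof -
      have m: "\<bar>a s\<bar> \<le> M" "\<bar>b s\<bar> \<le> M" "\<bar>c s\<bar> \<le> M" "\<bar>d s\<bar> \<le> M" using M[of s] s by auto
      have le: "k * (u * v) \<le> M * ((u\<^sup>2 + v\<^sup>2) / 2)" if "\<bar>k\<bar> \<le> M" for k u v :: real
      proof -
        have "k * (u * v) \<le> \<bar>k\<bar> * \<bar>u * v\<bar>" by (metis abs_ge_self abs_mult)
        also have "\<dots> \<le> M * ((u\<^sup>2 + v\<^sup>2) / 2)"
        proof (rule mult_mono[OF that])
          have "0 \<le> (\<bar>u\<bar> - \<bar>v\<bar>)\<^sup>2" by simp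
          then show "\<bar>u * v\<bar> \<le> (u\<^sup>2 + v\<^sup>2) / 2" by (simp add: power2_diff abs_mult)
        qed (use that in auto)
        finally show ?thesis .
      qed
      have "2 * y1 s * (a s * y1 s + b s * y2 s) + 2 * y2 s * (c s * y1 s + d s * y2 s) =
         2 * (a s * (y1 s * y1 s)) + 2 * (b s * (y1 s * y2 s)) + 2 * (c s * (y1 s * y2 s)) + 2 * (d s * (y2 s * y2 s))"
        by (simp add: algebra_simps)
      also have "\<dots> \<le> 4 * M * ((y1 s)\<^sup>2 + (y2 s)\<^sup>2)"
        using le[OF m(1), of "y1 s" "y1 s"] le[OF m(2), of "y1 s" "y2 s"] le[OF m(3), of "y1 s" "y2 s"]
          le[OF m(4), of "y2 s" "y2 s"] by (simp add: algebra_simps)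
      finally show ?thesis unfolding g'_def by (intro mult_nonneg_nonpos) (auto simp: algebra_simps)
    qed
    ultimately show "\<exists>g'. (g has_real_derivative g') (at s) \<and> g' \<le> 0" by blast
  qed simp
  then have "exp (- 4 * M) * ((y1 1)\<^sup>2 + (y2 1)\<^sup>2) \<le> 0" by (simp add: g_def init)
  then have "(y1 1)\<^sup>2 + (y2 1)\<^sup>2 \<le> 0" by (simp add: mult_le_0_iff not_le[symmetric])
  then show "y1 1 = 0" "y2 1 = 0" by (simp_all add: sum_power2_le_zero_iff)
qed

section \<open>Adapted charts\<close>

lemma real_derivative_const_increment:
  fixes y :: "real \<Rightarrow> real"
  assumes "\<And>s. s \<in> {0..1} \<Longrightarrow> (y has_real_derivative k) (at s within {0..1})"
  shows "y 1 = y 0 + k"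
proof -
  have "((\<lambda>s. k) has_integral (y 1 - y 0)) {0..1::real}"
    by (rule fundamental_theorem_of_calculus[of 0 1 y "\<lambda>s. k"])
      (use assms in \<open>auto simp: has_real_derivative_iff_has_vector_derivative\<close>)
  moreover have "((\<lambda>s. k) has_integral k) {0..1::real}"
    using has_integral_const_real[of k 0 1] by simp
  ultimately have "y 1 - y 0 = k" by (rule has_integral_unique)
  then show ?thesis by simp
qed

text \<open>A form of the Poincare lemma in which the primitive is a coordinate. With the full index
  set every direction is tangential, and closedness leaves a constant right-hand side
  \<open>v $ k\<close>.\<close>

lemma normal_chart:
  fixes A :: "('m::{t2_space, second_countable_topology}, 'n::finite) chart set"
  assumes A: "smooth_structure A" and \<omega>: "coframe A \<omega>"
    and closed: "\<And>c p u v. c \<in> A \<Longrightarrow> p \<in> chart_dom c \<Longrightarrow> d_form1 (\<omega> k) c p u v = 0"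
    and W: "open W" "p0 \<in> W"
  obtains V \<phi> where "(V, \<phi>) \<in> A" "p0 \<in> V" "V \<subseteq> W" "\<And>p v. p \<in> V \<Longrightarrow> \<omega> k (V, \<phi>) p v = v $ k"
proof -
  have "p0 \<in> (\<Union>c\<in>A. chart_dom c)" using A by (simp add: smooth_structure_def)
  then obtain c where c: "c \<in> A" "p0 \<in> chart_dom c" by blast
  obtain V \<phi> r where V: "r > 0" "(V, \<phi>) \<in> A" "p0 \<in> V" "V \<subseteq> chart_dom c \<inter> W" "\<phi> ` V = ball 0 r" "\<phi> p0 = 0"
    "\<And>i p. p \<in> V \<Longrightarrow> \<omega> i (V, \<phi>) p (coord_proj UNIV (\<phi> p)) = (if i \<in> UNIV then \<phi> p $ i else 0)"
    by (rule exp_chart[where J = UNIV, OF A \<omega> c W(2,1) that])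
  have univ: "coord_proj UNIV v = v" for v :: "real^'n" by (simp add: vec_eq_iff)
  show ?thesis
  proof (rule that[OF V(2,3)])
    show "V \<subseteq> W" using V(4) by auto
    fix p v assume p: "p \<in> V"
    define q where "q = \<phi> p"
    have q: "q \<in> ball 0 r" using p V(5) by (auto simp: q_def)
    have inv: "inv_into V \<phi> q = p"
      using is_chart_inj_on[OF smooth_structure_is_chart[OF A V(2)]] p by (simp add: q_def)
    define y where "y s = s * \<omega> k (V, \<phi>) (inv_into V \<phi> (ray UNIV s q)) v" for s
    have "y 1 = y 0 + v $ k"
    proof (rule real_derivative_const_increment)
      fix s :: real assume s: "s \<in> {0..1}"
      have rad: "\<omega> k (V, \<phi>) p (coord_proj UNIV (\<phi> p)) = \<phi> p $ k" if "p \<in> V" for p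
        using V(7)[OF that, of k] by simp
      have "inv_into V \<phi> (ray UNIV s q) \<in> V"
        using ray_in_ball[OF q s] V(5) by (metis inv_into_into)
      then have "d_form1 (\<omega> k) (V, \<phi>) (inv_into V \<phi> (ray UNIV s q)) u v = 0" for u
        using closed[OF V(2)] by simp
      with radial_ode_tangential[OF A coframe_smooth_form1[OF \<omega>] V(2,5) bounded_linear_vec_nth rad q s univ, of v]
      show "(y has_real_derivative v $ k) (at s within {0..1})"
        unfolding y_def by simp
    qed
    then show "\<omega> k (V, \<phi>) p v = v $ k" by (simp add: y_def ray_1 inv)
  qed
qed

text \<open>The argument \<open>k\<close> is the coefficient of the fourth differential in
  \<open>\<omega> 4\<close>: it is 1 in the logarithmic coordinate t and 1 / (2 w) in w = exp (2
  t).\<close>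

definition adapted_at :: "(4 \<Rightarrow> ('m, 4) form1) \<Rightarrow> ('m, 4) chart \<Rightarrow> 'm \<Rightarrow> real \<Rightarrow> bool" where
  "adapted_at \<omega> c p k \<longleftrightarrow> \<omega> 1 c p (axis 3 1) = 0 \<and> \<omega> 1 c p (axis 4 1) = 0 \<and>
     \<omega> 2 c p (axis 3 1) = 0 \<and> \<omega> 2 c p (axis 4 1) = 0 \<and> (\<forall>v. \<omega> 3 c p v = v $ 3) \<and>
     \<omega> 4 c p (axis 3 1) = 0 \<and> \<omega> 4 c p (axis 4 1) = k"

context
  fixes A :: "('m::{t2_space, second_countable_topology}, 4) chart set" and \<omega> C E \<epsilon>
  assumes A: "smooth_structure A" and \<omega>: "coframe A \<omega>" and C: "smooth_function A C"
    and d1: "\<And>c p u v. c \<in> A \<Longrightarrow> p \<in> chart_dom c \<Longrightarrow> d_form1 (\<omega> 1) c p u v =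
        wedge (\<omega> 1) (\<omega> 4) c p u v - C p * wedge (\<omega> 1) (\<omega> 3) c p u v + wedge (\<omega> 2) (\<omega> 3) c p u v"
    and d2: "\<And>c p u v. c \<in> A \<Longrightarrow> p \<in> chart_dom c \<Longrightarrow> d_form1 (\<omega> 2) c p u v =
        wedge (\<omega> 2) (\<omega> 4) c p u v + C p * wedge (\<omega> 2) (\<omega> 3) c p u v + \<epsilon> * wedge (\<omega> 1) (\<omega> 3) c p u v"
    and d3: "\<And>c p u v. c \<in> A \<Longrightarrow> p \<in> chart_dom c \<Longrightarrow> d_form1 (\<omega> 3) c p u v = 0"
    and d4: "\<And>c p u v. c \<in> A \<Longrightarrow> p \<in> chart_dom c \<Longrightarrow> d_form1 (\<omega> 4) c p u v = E p * wedge (\<omega> 1) (\<omega> 2) c p u v"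
begin

text \<open>The exponential chart for J = {3, 4} is built over a chart in which
  \<open>\<omega> 3\<close> already has constant coefficients, since the rays alone do not determine
  its transversal components. For \<open>\<omega> 1\<close>, \<open>\<omega> 2\<close> and
  \<open>\<omega> 4\<close> only the tangential components are claimed.\<close>

lemma adapted_chart_logarithmic:
  assumes W: "open W" "p0 \<in> W"
  obtains V \<phi> where "(V, \<phi>) \<in> A" "p0 \<in> V" "V \<subseteq> W" "\<phi> p0 = 0"
    "\<And>p. p \<in> V \<Longrightarrow> adapted_at \<omega> (V, \<phi>) p 1"
proof -
  obtain V2 \<phi>2 where V2: "(V2, \<phi>2) \<in> A" "p0 \<in> V2" "V2 \<subseteq> W" "\<And>p v. p \<in> V2 \<Longrightarrow> \<omega> 3 (V2, \<phi>2) p v = v $ 3"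
    by (rule normal_chart[OF A \<omega> d3 W that])
  define J :: "4 set" where "J = {3, 4}"
  have p02: "p0 \<in> chart_dom (V2, \<phi>2)" using V2(2) by simp
  obtain V \<phi> r where V: "r > 0" "(V, \<phi>) \<in> A" "p0 \<in> V" "V \<subseteq> chart_dom (V2, \<phi>2) \<inter> W" "\<phi> ` V = ball 0 r" "\<phi> p0 = 0"
    "\<And>i p. p \<in> V \<Longrightarrow> \<omega> i (V, \<phi>) p (coord_proj J (\<phi> p)) = (if i \<in> J then \<phi> p $ i else 0)"
    "\<And>i p v. p \<in> V \<Longrightarrow> coord_proj J (\<phi> p) = 0 \<Longrightarrow> coord_proj J v = 0 \<Longrightarrow>
      \<omega> i (V, \<phi>) p v = \<omega> i (V2, \<phi>2) p (\<Sum>j\<in>UNIV. (v $ j) *\<^sub>R dual_frame \<omega> (V2, \<phi>2) j (chart_map (V2, \<phi>2) p0))"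
    by (rule exp_chart[where J = J, OF A \<omega> V2(1) p02 W(2,1) that])
  have inv: "inv_into V \<phi> (\<phi> p) = p" if "p \<in> V" for p
    using is_chart_inj_on[OF smooth_structure_is_chart[OF A V(2)]] that by simp
  have invV: "inv_into V \<phi> q \<in> V" "\<phi> (inv_into V \<phi> q) = q" if "q \<in> ball 0 r" for q
    using that V(5) by (auto intro: inv_into_into f_inv_into_f)
  have bl: "bounded_linear (\<lambda>q::real^4. if i \<in> J then q $ i else 0)" for i
    by (cases "i \<in> J") (simp_all add: bounded_linear_vec_nth)
  have tang: "((\<lambda>s. s * \<omega> i (V, \<phi>) (inv_into V \<phi> (ray J s q)) v) has_real_derivative
      d_form1 (\<omega> i) (V, \<phi>) (inv_into V \<phi> (ray J s q)) (coord_proj J (ray J s q)) v +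
      (if i \<in> J then v $ i else 0)) (at s within {0..1})"
    if "q \<in> ball 0 r" "s \<in> {0..1}" "coord_proj J v = v" for i q s v
    by (rule radial_ode_tangential[OF A coframe_smooth_form1[OF \<omega>] V(2,5) bl V(7) that])
  have trans: "\<exists>y'. ((\<lambda>s. \<omega> i (V, \<phi>) (inv_into V \<phi> (ray J s q)) v) has_real_derivative y') (at s within {0..1}) \<and>
      s * y' = d_form1 (\<omega> i) (V, \<phi>) (inv_into V \<phi> (ray J s q)) (coord_proj J (ray J s q)) v +
      (if i \<in> J then v $ i else 0)"
    if "q \<in> ball 0 r" "s \<in> {0..1}" "coord_proj J v = 0" for i q s v
    by (rule radial_ode_transversal[OF A coframe_smooth_form1[OF \<omega>] V(2,5) bl V(7) that])
  have lin: "linear (\<omega> i (V, \<phi>) p)" if "p \<in> V" for i p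
    using coframe_linear[OF \<omega> V(2)] that by simp
  have J: "1 \<notin> J" "2 \<notin> J" "3 \<in> J" "4 \<in> J" by (simp_all add: J_def)
  have tangential: "\<omega> i (V, \<phi>) p v = v $ i"
    if p: "p \<in> V" and i: "i \<in> J" and v: "coord_proj J v = v"
      and d: "\<And>q. q \<in> ball 0 r \<Longrightarrow> d_form1 (\<omega> i) (V, \<phi>) (inv_into V \<phi> q) (coord_proj J q) v = 0" for i p v
  proof -
    define q where "q = \<phi> p"
    have q: "q \<in> ball 0 r" using p V(5) by (auto simp: q_def)
    define y where "y s = s * \<omega> i (V, \<phi>) (inv_into V \<phi> (ray J s q)) v" for s
    have "y 1 = y 0 + v $ i"
    proof (rule real_derivative_const_increment)
      fix s :: real assume s: "s \<in> {0..1}"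
      show "(y has_real_derivative v $ i) (at s within {0..1})"
        using tang[OF q s v, of i] d[OF ray_in_ball[OF q s]] i unfolding y_def by simp
    qed
    then show ?thesis by (simp add: y_def ray_1 q_def inv[OF p])
  qed
  \<comment> \<open>The tangential part of \<open>v\<close> is settled by closedness; for the
    remaining part \<open>u\<close> the equation says that the component is constant along the
    ray.\<close>
  have w3: "\<omega> 3 (V, \<phi>) p v = v $ 3" if p: "p \<in> V" for p v
  proof -
    define q where "q = \<phi> p"
    have q: "q \<in> ball 0 r" using p V(5) by (auto simp: q_def)
    define u where "u = v - coord_proj J v"
    have pu: "coord_proj J u = 0" by (simp add: vec_eq_iff u_def)
    have u3: "u $ 3 = 0" using J by (simp add: u_def)
    have t: "\<omega> 3 (V, \<phi>) p (coord_proj J v) = coord_proj J v $ 3"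
      by (rule tangential[OF p J(3)]) (use d3[OF V(2)] invV in \<open>auto simp: vec_eq_iff\<close>)
    define y where "y s = \<omega> 3 (V, \<phi>) (inv_into V \<phi> (ray J s q)) u" for s
    have der: "\<exists>y'. (y has_real_derivative y') (at s within {0..1}) \<and> s * y' = 0" if s: "s \<in> {0..1}" for s
    proof -
      have "d_form1 (\<omega> 3) (V, \<phi>) (inv_into V \<phi> (ray J s q)) (coord_proj J (ray J s q)) u = 0"
        using d3[OF V(2)] invV(1)[OF ray_in_ball[OF q s]] by simp
      with u3 trans[OF q s pu, of 3] show ?thesis unfolding y_def by (simp add: J)
    qed
    have "y 1 = y 0"
    proof (rule DERIV_isconst_end[of 0 1 y])
      show "continuous_on {0..1} y"
        using der by (meson DERIV_continuous continuous_on_eq_continuous_within)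
      show "DERIV y s :> 0" if "0 < s" "s < 1" for s
        using der[of s] that at_within_Icc_at[of 0 s 1] by auto
    qed simp
    \<comment> \<open>On the slice the chart is built from the frame at \<open>p0\<close>, yet
      \<open>\<omega> 3\<close> is evaluated at another point. As its coefficients in the earlier
      chart are constant, the duality at \<open>p0\<close> applies there as well.\<close>
    moreover have "y 0 = 0"
    proof -
      have r0: "ray J 0 q \<in> ball 0 r" by (rule ray_in_ball[OF q]) simp
      let ?p = "inv_into V \<phi> (ray J 0 q)"
      have "coord_proj J (\<phi> ?p) = 0" using invV(2)[OF r0] by (simp add: coord_proj_ray)
      from V(8)[OF invV(1)[OF r0] this pu, of 3]
      have "y 0 = (\<Sum>j\<in>UNIV. (u $ j) *\<^sub>R dual_frame \<omega> (V2, \<phi>2) j (\<phi>2 p0)) $ 3"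
        using V(4) invV(1)[OF r0] V2(4)[of ?p] by (auto simp: y_def)
      also have "\<dots> = (\<Sum>j\<in>UNIV. u $ j * dual_frame \<omega> (V2, \<phi>2) j (\<phi>2 p0) $ 3)" by simp
      also have "\<dots> = (\<Sum>j\<in>UNIV. u $ j * (if 3 = j then 1 else 0))"
      proof (rule sum.cong[OF refl])
        fix j :: 4
        have "\<omega> 3 (V2, \<phi>2) (inv_into V2 \<phi>2 (\<phi>2 p0)) (dual_frame \<omega> (V2, \<phi>2) j (\<phi>2 p0)) = (if 3 = j then 1 else 0)"
          using dual_frame[OF \<omega> V2(1), of "\<phi>2 p0" 3 j] V2(2) by simp
        moreover have "inv_into V2 \<phi>2 (\<phi>2 p0) = p0"
          using is_chart_inj_on[OF smooth_structure_is_chart[OF A V2(1)]] V2(2) by simp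
        ultimately show "u $ j * dual_frame \<omega> (V2, \<phi>2) j (\<phi>2 p0) $ 3 = u $ j * (if 3 = j then 1 else 0)"
          using V2(2,4) by simp
      qed
      also have "\<dots> = u $ 3" by (simp add: if_distrib cong: if_cong)
      finally show ?thesis using u3 by simp
    qed
    ultimately have "\<omega> 3 (V, \<phi>) p u = 0" by (simp add: y_def ray_1 q_def inv[OF p])
    then show ?thesis
      using linear_add[OF lin[OF p], of 3 "coord_proj J v" u] t J by (simp add: u_def)
  qed
  have ax: "coord_proj J (axis k 1) = axis k 1" if "k \<in> J" for k :: 4
    using that by (auto simp: vec_eq_iff axis_def)
  have rad0: "\<omega> 1 (V, \<phi>) (inv_into V \<phi> q) (coord_proj J q) = 0" "\<omega> 2 (V, \<phi>) (inv_into V \<phi> q) (coord_proj J q) = 0"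
    "\<omega> 3 (V, \<phi>) (inv_into V \<phi> q) (coord_proj J q) = q $ 3" "\<omega> 4 (V, \<phi>) (inv_into V \<phi> q) (coord_proj J q) = q $ 4"
    if "q \<in> ball 0 r" for q
    using V(7)[OF invV(1)[OF that], of 1] V(7)[OF invV(1)[OF that], of 2] V(7)[OF invV(1)[OF that], of 3]
      V(7)[OF invV(1)[OF that], of 4] by (simp_all add: invV(2)[OF that] J)
  \<comment> \<open>The radial field annihilates \<open>\<omega> 1\<close> and
    \<open>\<omega> 2\<close>, so the right-hand side of the fourth structure equation vanishes when
    contracted with it.\<close>
  have w4: "\<omega> 4 (V, \<phi>) p (axis k 1) = axis k 1 $ 4" if p: "p \<in> V" and k: "k \<in> J" for p k
    by (rule tangential[OF p J(4) ax[OF k]])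
      (use d4[OF V(2)] invV(1) rad0 in \<open>simp add: wedge_def\<close>)
  have w12: "\<omega> 1 (V, \<phi>) p (axis k 1) = 0 \<and> \<omega> 2 (V, \<phi>) p (axis k 1) = 0" if p: "p \<in> V" and k: "k \<in> J" for p k
  proof -
    define v :: "real^4" where "v = axis k 1"
    have v: "coord_proj J v = v" unfolding v_def by (rule ax[OF k])
    define q where "q = \<phi> p"
    have q: "q \<in> ball 0 r" using p V(5) by (auto simp: q_def)
    define P where "P s = inv_into V \<phi> (ray J s q)" for s
    \<comment> \<open>In the contracted equations the radial values of \<open>\<omega> 3\<close> and
      \<open>\<omega> 4\<close> are \<open>s * q $ 3\<close> and \<open>s * q $ 4\<close>. Their
      factor \<open>s\<close> is absorbed in \<open>Y\<close>, so the system has bounded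
      coefficients up to \<open>s = 0\<close>.\<close>
    define Y where "Y i s = s * \<omega> i (V, \<phi>) (P s) v" for i s
    have rq: "ray J s q \<in> ball 0 r" if "s \<in> {0..1}" for s by (rule ray_in_ball[OF q that])
    have PV: "P s \<in> V" if "s \<in> {0..1}" for s using invV(1)[OF rq[OF that]] by (simp add: P_def)
    have nth: "ray J s q $ 3 = s * q $ 3" "ray J s q $ 4 = s * q $ 4" for s by (simp_all add: ray_nth J)
    have D1: "(Y 1 has_real_derivative (C (P s) * q $ 3 - q $ 4) * Y 1 s + (- q $ 3) * Y 2 s) (at s within {0..1})"
      if s: "s \<in> {0..1}" for s
    proof -
      have "d_form1 (\<omega> 1) (V, \<phi>) (P s) (coord_proj J (ray J s q)) v =
         (C (P s) * q $ 3 - q $ 4) * Y 1 s + (- q $ 3) * Y 2 s"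
        using d1[OF V(2), of "P s" "coord_proj J (ray J s q)" v] PV[OF s] rad0[OF rq[OF s]]
        by (simp add: wedge_def P_def[symmetric] nth Y_def algebra_simps)
      with tang[OF q s v, of 1] show ?thesis by (simp add: J Y_def[abs_def] P_def)
    qed
    have D2: "(Y 2 has_real_derivative (- \<epsilon> * q $ 3) * Y 1 s + (- C (P s) * q $ 3 - q $ 4) * Y 2 s) (at s within {0..1})"
      if s: "s \<in> {0..1}" for s
    proof -
      have "d_form1 (\<omega> 2) (V, \<phi>) (P s) (coord_proj J (ray J s q)) v =
         (- \<epsilon> * q $ 3) * Y 1 s + (- C (P s) * q $ 3 - q $ 4) * Y 2 s"
        using d2[OF V(2), of "P s" "coord_proj J (ray J s q)" v] PV[OF s] rad0[OF rq[OF s]]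
        by (simp add: wedge_def P_def[symmetric] nth Y_def algebra_simps)
      with tang[OF q s v, of 2] show ?thesis by (simp add: J Y_def[abs_def] P_def)
    qed
    have "smooth_on (ball 0 r) (\<lambda>q. C (inv_into V \<phi> q))"
      using C V(2,5) by (fastforce simp: smooth_function_def o_def)
    then have "continuous_on (ball 0 r) (\<lambda>q. C (inv_into V \<phi> q))" by (rule smooth_on_imp_continuous_on)
    then have "continuous_on {0..1} (\<lambda>s. C (P s))"
      unfolding P_def by (rule continuous_on_compose2) (use rq in \<open>auto simp: ray_def intro!: continuous_intros\<close>)
    then have "compact ((\<lambda>s. C (P s)) ` {0..1})" by (intro compact_continuous_image compact_Icc)
    then obtain M0 where M0: "M0 > 0" "\<And>s. s \<in> {0..1} \<Longrightarrow> \<bar>C (P s)\<bar> \<le> M0"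
      using compact_imp_bounded bounded_pos by (metis image_eqI real_norm_def)
    define M where "M = (M0 + 1 + \<bar>\<epsilon>\<bar>) * \<bar>q $ 3\<bar> + \<bar>q $ 4\<bar>"
    have "Y 1 1 = 0 \<and> Y 2 1 = 0"
    proof -
      have M: "\<bar>C (P s) * q $ 3 - q $ 4\<bar> \<le> M \<and> \<bar>- q $ 3\<bar> \<le> M \<and> \<bar>- \<epsilon> * q $ 3\<bar> \<le> M \<and> \<bar>- C (P s) * q $ 3 - q $ 4\<bar> \<le> M"
        if s: "s \<in> {0..1}" for s
      proof -
        have a: "\<bar>C (P s) * q $ 3\<bar> \<le> M0 * \<bar>q $ 3\<bar>" unfolding abs_mult by (intro mult_right_mono M0 s) auto
        have M_eq: "M = M0 * \<bar>q $ 3\<bar> + \<bar>q $ 3\<bar> + \<bar>\<epsilon> * q $ 3\<bar> + \<bar>q $ 4\<bar>" by (simp add: M_def algebra_simps abs_mult)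
        have "M0 * \<bar>q $ 3\<bar> \<ge> 0" using M0 by simp
        moreover have "\<bar>c - y\<bar> \<le> m + \<bar>x\<bar> + \<bar>e\<bar> + \<bar>y\<bar> \<and> \<bar>- x\<bar> \<le> m + \<bar>x\<bar> + \<bar>e\<bar> + \<bar>y\<bar> \<and>
          \<bar>- e\<bar> \<le> m + \<bar>x\<bar> + \<bar>e\<bar> + \<bar>y\<bar> \<and> \<bar>- c - y\<bar> \<le> m + \<bar>x\<bar> + \<bar>e\<bar> + \<bar>y\<bar>"
          if "\<bar>c\<bar> \<le> m" "0 \<le> m" for c m x e y :: real
          using that by (intro conjI; linarith)
        ultimately show ?thesis unfolding M_eq mult_minus_left using a by blast
      qed
      show ?thesis
        using linear_system2_zero[OF D1 D2 M] by (simp add: Y_def)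
    qed
    then show ?thesis by (simp add: Y_def P_def ray_1 q_def inv[OF p] v_def)
  qed
  show ?thesis
  proof (rule that[OF V(2,3) _ V(6)])
    show "V \<subseteq> W" using V(4) by auto
  qed (use w12 w3 w4 J in \<open>auto simp: adapted_at_def axis_def\<close>)
qed

text \<open>Only the fourth coordinate is changed. \<open>P\<close> takes w to t = ln w / 2, so the
  differential dt becomes dw / (2 w).\<close>

lemma adapted_chart:
  assumes W: "open W" "p0 \<in> W"
  obtains V \<phi> a b where "(V, \<phi>) \<in> A" "p0 \<in> V" "V \<subseteq> W" "\<phi> ` V = box a b"
    "\<And>p. p \<in> V \<Longrightarrow> \<phi> p $ 4 > 0"
    "\<And>p. p \<in> V \<Longrightarrow> adapted_at \<omega> (V, \<phi>) p (1 / (2 * \<phi> p $ 4))"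
proof -
  obtain V0 \<phi>0 where V0: "(V0, \<phi>0) \<in> A" "p0 \<in> V0" "V0 \<subseteq> W" "\<phi>0 p0 = 0"
    "\<And>p. p \<in> V0 \<Longrightarrow> adapted_at \<omega> (V0, \<phi>0) p 1"
    by (rule adapted_chart_logarithmic[OF W that])
  define P where "P y = (\<chi> i. if i = 4 then ln (y $ 4) / 2 else y $ i)" for y :: "real^4"
  define P' where "P' y v = (\<chi> i. if i = 4 then v $ 4 / (2 * y $ 4) else v $ i)" for y v :: "real^4"
  define N where "N = {y :: real^4. y $ 4 > 0}"
  \<comment> \<open>The origin of the logarithmic chart, where t = 0, corresponds to w = 1.\<close>
  define y0 :: "real^4" where "y0 = axis 4 1"
  have y0: "y0 \<in> N" by (simp add: y0_def N_def axis_def)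
  have N: "open N" unfolding N_def by (intro open_Collect_less continuous_intros)
  have DP: "(P has_derivative P' y) (at y)" if "y \<in> N" for y
    unfolding has_derivative_componentwise_within[of P]
  proof
    fix i :: "real^4" assume "i \<in> Basis"
    then obtain k where i: "i = axis k 1" by (auto simp: Basis_vec_def)
    show "((\<lambda>x. P x \<bullet> i) has_derivative (\<lambda>v. P' y v \<bullet> i)) (at y)"
    proof (cases "k = 4")
      case True
      have "((\<lambda>x::real^4. ln (x $ 4) / 2) has_derivative (\<lambda>v. v $ 4 / (2 * y $ 4))) (at y)"
        using that by (auto intro!: derivative_eq_intros bounded_linear_imp_has_derivative bounded_linear_vec_nth
          simp: N_def field_simps)
      then show ?thesis using True by (simp add: i inner_axis P_def P'_def)
    next
      case False
      then show ?thesis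
        by (simp add: i inner_axis P_def P'_def bounded_linear_imp_has_derivative bounded_linear_vec_nth)
    qed
  qed
  have fP: "frechet_derivative P (at y) = P' y" if "y \<in> N" for y
    using frechet_derivative_at[OF DP[OF that]] by simp
  have smP: "smooth_on N P"
  proof (rule smooth_on_vec[OF N])
    fix i
    have nth: "smooth_on N (\<lambda>y. y $ j)" for j :: 4
      by (intro smooth_on_bounded_linear N bounded_linear_vec_nth)
    have "smooth_on N (\<lambda>y. ln (y $ 4))"
      by (rule smooth_on_compose[OF N smooth_on_ln nth]) (simp add: N_def)
    then have "smooth_on N (\<lambda>y. (1/2) * ln (y $ 4))" by (intro smooth_on_mult N smooth_on_const)
    then show "smooth_on N (\<lambda>y. P y $ i)" using nth[of i] by (cases "i = 4") (simp_all add: P_def)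
  qed
  have inj: "inj (frechet_derivative P (at y0))"
    unfolding fP[OF y0]
  proof (rule injI)
    fix u v assume eq: "P' y0 u = P' y0 v"
    have "u $ i = v $ i" for i
      using arg_cong[OF eq, of "\<lambda>z. z $ i"] by (cases "i = 4") (simp_all add: P'_def y0_def axis_def)
    then show "u = v" by (simp add: vec_eq_iff)
  qed
  have Py0: "P y0 = chart_map (V0, \<phi>0) p0"
    using V0(4) by (simp add: vec_eq_iff P_def y0_def axis_def)
  have p00: "p0 \<in> chart_dom (V0, \<phi>0)" using V0(2) by simp
  obtain V1 \<phi> where V1: "(V1, \<phi>) \<in> A" "p0 \<in> V1" "V1 \<subseteq> chart_dom (V0, \<phi>0) \<inter> W" "\<phi> p0 = y0" "\<phi> ` V1 \<subseteq> N"
    "\<And>p. p \<in> V1 \<Longrightarrow> P (\<phi> p) = chart_map (V0, \<phi>0) p"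
    by (rule chart_reparam[OF A V0(1) p00 W(2,1) N y0 smP Py0 inj that])
  have "is_chart (V1, \<phi>)" using A V1(1) by (rule smooth_structure_is_chart)
  then have "open (\<phi> ` V1)" by (simp add: is_chart_def)
  moreover have "y0 \<in> \<phi> ` V1" using V1(2,4) by (metis imageI)
  ultimately obtain e where e: "e > 0" "ball y0 e \<subseteq> \<phi> ` V1" using openE by metis
  \<comment> \<open>A box is convex, contains the coordinate segments between suitable points and
    projects onto intervals, all of which the integration in coordinates relies on.\<close>
  obtain a b where ab: "y0 \<in> box a b" "box a b \<subseteq> ball y0 e" using rational_boxes[OF e(1), of y0] by blast
  define V where "V = V1 \<inter> \<phi> -` box a b"
  have "box a b \<subseteq> \<phi> ` V1" using ab e by blast
  then have VA: "(V, \<phi>) \<in> A" "\<phi> ` V = box a b"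
    using chart_restrict[OF A V1(1), of "box a b"] by (auto simp: V_def open_box)
  have VV: "V \<subseteq> chart_dom (V0, \<phi>0)" "p \<in> V \<Longrightarrow> p \<in> V0" "p \<in> V \<Longrightarrow> \<phi> p \<in> N" for p using V1 by (auto simp: V_def)
  have form: "\<omega> i (V, \<phi>) p v = \<omega> i (V0, \<phi>0) p (P' (\<phi> p) v)" if p: "p \<in> V" for i p v
    using form1_reparam[OF A coframe_smooth_form1[OF \<omega>] V0(1) VA(1) VV(1), of P p i v] V1(6) p
    by (simp add: fP[OF VV(3)[OF p]] V_def)
  have P'3: "P' y (axis 3 1) = axis 3 1" for y by (simp add: P'_def vec_eq_iff axis_def)
  have P'4: "P' y (axis 4 1) = (1 / (2 * y $ 4)) *\<^sub>R axis 4 1" for y by (simp add: P'_def vec_eq_iff axis_def)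
  have lin: "linear (\<omega> i (V0, \<phi>0) p)" if "p \<in> V" for i p
    using coframe_linear[OF \<omega> V0(1)] VV(2)[OF that] by simp
  show ?thesis
  proof (rule that[OF VA(1) _ _ VA(2)])
    show "p0 \<in> V" using V1 ab by (simp add: V_def)
    show "V \<subseteq> W" using V1 by (auto simp: V_def)
    fix p assume p: "p \<in> V"
    show "\<phi> p $ 4 > 0" using VV(3)[OF p] by (simp add: N_def)
    have "P' (\<phi> p) v $ 3 = v $ 3" for v by (simp add: P'_def)
    then show "adapted_at \<omega> (V, \<phi>) p (1 / (2 * \<phi> p $ 4))"
      using V0(5)[OF VV(2)[OF p]]
      by (simp add: adapted_at_def form[OF p] P'3 P'4 linear_scale[OF lin[OF p]])
  qed
qed

end

section \<open>The normal form in adapted coordinates\<close>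

lemma pderiv_at_zero:
  assumes "open S" "q \<in> S" "\<And>q. q \<in> S \<Longrightarrow> F q = 0"
  shows "pderiv_at i F q = 0"
  unfolding pderiv_at_def using frechet_derivative_cong_open[OF assms(1,2), of F "\<lambda>_. 0"] assms(3) by simp

definition coord_line :: "'n \<Rightarrow> real^'n \<Rightarrow> real \<Rightarrow> real^'n" where
  "coord_line i q z = (\<chi> j. if j = i then z else q $ j)"

lemma coord_line_nth [simp]: "coord_line i q z $ j = (if j = i then z else q $ j)"
  by (simp add: coord_line_def)

lemma coord_line_self [simp]: "coord_line i q (q $ i) = q"
  by (simp add: vec_eq_iff)

lemma coord_line_in_box:
  "q \<in> box a b \<Longrightarrow> coord_line i q z \<in> box a b \<longleftrightarrow> a $ i < z \<and> z < b $ i"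
  by (auto simp: mem_box_cart)

lemma coord_line_DERIV:
  assumes F: "(F has_derivative D) (at (coord_line i q z))"
  shows "((\<lambda>z. F (coord_line i q z)) has_real_derivative D (axis i 1)) (at z)"
proof -
  have eq: "coord_line i q z = (q - (q $ i) *\<^sub>R axis i 1) + z *\<^sub>R axis i 1" for z
    by (simp add: vec_eq_iff axis_def)
  show ?thesis
    using has_derivative_along_line[of F D _ z "axis i 1" UNIV] F
    unfolding eq has_real_derivative_iff_has_vector_derivative by blast
qed

lemma smooth_on_coord_line_DERIV:
  assumes "smooth_on S F" "coord_line i q z \<in> S"
  shows "((\<lambda>z. F (coord_line i q z)) has_real_derivative pderiv_at i F (coord_line i q z)) (at z)"
  unfolding pderiv_at_def by (rule coord_line_DERIV[OF smooth_on_has_derivative[OF assms]])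

lemma smooth_on_pderiv_at: "smooth_on S F \<Longrightarrow> smooth_on S (pderiv_at i F)"
  unfolding pderiv_at_def by (rule smooth_on_frechet_derivative)

text \<open>The derivative along the segment from \<open>q\<close> to \<open>q'\<close> only
  involves the coordinates in which the two points differ.\<close>

lemma pderiv_zero_imp_eq:
  fixes F :: "real^'n \<Rightarrow> real"
  assumes F: "smooth_on S F" and S: "convex S" and q: "q \<in> S" "q' \<in> S"
    and z: "\<And>r i. r \<in> S \<Longrightarrow> q $ i \<noteq> q' $ i \<Longrightarrow> pderiv_at i F r = 0"
  shows "F q = F q'"
proof -
  let ?x = "\<lambda>s. q + s *\<^sub>R (q' - q)"
  have in_S: "?x s \<in> S" if "s \<in> {0..1}" for s
    using convexD_alt[OF S q, of s] that by (simp add: algebra_simps)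
  have "((\<lambda>s. F (?x s)) has_real_derivative 0) (at s within {0..1})" if s: "s \<in> {0..1}" for s
  proof -
    let ?D = "frechet_derivative F (at (?x s))"
    have D: "(F has_derivative ?D) (at (?x s))" by (rule smooth_on_has_derivative[OF F in_S[OF s]])
    have "?D (q' - q) = (\<Sum>i\<in>UNIV. (q' - q) $ i * pderiv_at i F (?x s))"
      unfolding pderiv_at_def using linear_axis_expand[OF has_derivative_linear[OF D], of "q' - q"] by simp
    also have "\<dots> = 0"
    proof (intro sum.neutral ballI)
      fix i show "(q' - q) $ i * pderiv_at i F (?x s) = 0"
        using z[OF in_S[OF s], of i] by (cases "q $ i = q' $ i") auto
    qed
    finally show ?thesis
      using has_derivative_along_line[OF D, of "{0..1}"] by (simp add: has_real_derivative_iff_has_vector_derivative)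
  qed
  from real_derivative_const_increment[OF this] show ?thesis by simp
qed

lemma DERIV_zero_interval_eq:
  fixes F :: "real \<Rightarrow> real"
  assumes "\<And>z. z \<in> {a<..<b} \<Longrightarrow> (F has_real_derivative 0) (at z)" "x \<in> {a<..<b}" "y \<in> {a<..<b}"
  shows "F x = F y"
proof -
  have "\<exists>c. \<forall>z\<in>{a<..<b}. F z = c"
    by (rule has_field_derivative_zero_constant) (use assms(1) in \<open>auto intro: has_field_derivative_at_within\<close>)
  then show ?thesis using assms by auto
qed

text \<open>The calculus on a box, separated from the manifold. No existence theorem for the second
  order equation is needed: \<open>K\<close> and \<open>L\<close> restricted to one z-line serve as
  fundamental system, and independence of the coframe makes their Wronskian nonzero.\<close>

lemma normal_form_coordinates:
  fixes K L M N \<alpha> \<beta> G :: "real^4 \<Rightarrow> real" and a b q0 :: "real^4"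
  defines "B \<equiv> box a b" and "I \<equiv> {a$3<..<b$3}" and "D \<equiv> {a$1<..<b$1} \<times> {a$2<..<b$2}"
  assumes sm: "smooth_on B K" "smooth_on B L" "smooth_on B M" "smooth_on B N"
    "smooth_on B \<alpha>" "smooth_on B \<beta>" "smooth_on B G"
    and pos: "\<And>q. q \<in> B \<Longrightarrow> q $ 4 > 0" and q0: "q0 \<in> B"
    and G: "\<And>q i. q \<in> B \<Longrightarrow> i \<noteq> 3 \<Longrightarrow> pderiv_at i G q = 0"
    and K4: "\<And>q. q \<in> B \<Longrightarrow> pderiv_at 4 K q = - K q / (2 * q $ 4)"
    and L4: "\<And>q. q \<in> B \<Longrightarrow> pderiv_at 4 L q = - L q / (2 * q $ 4)"
    and K3: "\<And>q. q \<in> B \<Longrightarrow> pderiv_at 3 K q = G q * K q - M q"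
    and L3: "\<And>q. q \<in> B \<Longrightarrow> pderiv_at 3 L q = G q * L q - N q"
    and M3: "\<And>q. q \<in> B \<Longrightarrow> pderiv_at 3 M q = - G q * M q - \<epsilon> * K q"
    and N3: "\<And>q. q \<in> B \<Longrightarrow> pderiv_at 3 N q = - G q * N q - \<epsilon> * L q"
    and F: "\<And>q. q \<in> B \<Longrightarrow> pderiv_at 1 L q - pderiv_at 2 K q = K q * \<beta> q - L q * \<alpha> q"
    and \<alpha>3: "\<And>q. q \<in> B \<Longrightarrow> pderiv_at 3 \<alpha> q = 0"
    and \<beta>3: "\<And>q. q \<in> B \<Longrightarrow> pderiv_at 3 \<beta> q = 0"
    and det: "\<And>q. q \<in> B \<Longrightarrow> K q * N q - L q * M q \<noteq> 0"
  obtains h :: "real \<times> real \<Rightarrow> real^2^2" and Q1 Q2 \<gamma> W0 f where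
    "\<And>i j. smooth_on D (\<lambda>s. h s $ i $ j)" "\<And>s. s \<in> D \<Longrightarrow> invertible (h s)"
    "smooth_on I \<gamma>" "\<And>q. q \<in> B \<Longrightarrow> G q = \<gamma> (q $ 3)"
    "solves_ode2 I (\<lambda>z. (\<gamma> z)\<^sup>2 + \<epsilon> + deriv \<gamma> z) Q1"
    "solves_ode2 I (\<lambda>z. (\<gamma> z)\<^sup>2 + \<epsilon> + deriv \<gamma> z) Q2"
    "lin_indep_on I Q1 Q2" "W0 \<noteq> 0" "\<And>z. z \<in> I \<Longrightarrow> wronskian Q1 Q2 z = W0"
    "\<And>q. q \<in> B \<Longrightarrow> K q = 1 / sqrt (q $ 4) *
        (h (q $ 1, q $ 2) $ 1 $ 1 * Q1 (q $ 3) + h (q $ 1, q $ 2) $ 1 $ 2 * Q2 (q $ 3))"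
    "\<And>q. q \<in> B \<Longrightarrow> L q = 1 / sqrt (q $ 4) *
        (h (q $ 1, q $ 2) $ 2 $ 1 * Q1 (q $ 3) + h (q $ 1, q $ 2) $ 2 $ 2 * Q2 (q $ 3))"
    "\<And>q. q \<in> B \<Longrightarrow> f q = q $ 4 / (W0 * det (h (q $ 1, q $ 2))) * (pderiv_at 1 L q - pderiv_at 2 K q)"
    "\<And>q. q \<in> B \<Longrightarrow> \<alpha> q = - (K q * pderiv_at 3 f q - f q * pderiv_at 3 K q)"
    "\<And>q. q \<in> B \<Longrightarrow> \<beta> q = - (L q * pderiv_at 3 f q - f q * pderiv_at 3 L q)"
proof -
  have oB: "open B" by (simp add: B_def open_box)
  have cB: "convex B" by (simp add: B_def convex_box)
  have oI: "open I" by (simp add: I_def)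
  have oD: "open D" by (simp add: D_def open_Times)
  have line: "coord_line 3 q z \<in> B" if "q \<in> B" "z \<in> I" for q z
    using coord_line_in_box[of q a b 3 z] that by (simp add: B_def I_def)
  have q3: "q $ 3 \<in> I" "(q $ 1, q $ 2) \<in> D" if "q \<in> B" for q
    using that by (auto simp: B_def I_def D_def mem_box_cart)

  \<comment> \<open>As \<open>G\<close> depends on the third coordinate alone, its restriction to
    the z-line through \<open>q0\<close> represents it on the whole box.\<close>
  define \<gamma> where "\<gamma> z = G (coord_line 3 q0 z)" for z
  have G\<gamma>: "G q = \<gamma> (q $ 3)" if "q \<in> B" for q
    unfolding \<gamma>_def
  proof (rule pderiv_zero_imp_eq[OF sm(7) cB that line[OF q0 q3(1)[OF that]]])
    fix r and i :: 4 assume "r \<in> B" "q $ i \<noteq> coord_line 3 q0 (q $ 3) $ i"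
    then show "pderiv_at i G r = 0" by (intro G) auto
  qed
  have sm\<gamma>: "smooth_on I \<gamma>"
    unfolding \<gamma>_def
  proof (rule smooth_on_compose[OF oI sm(7)])
    show "smooth_on I (coord_line 3 q0)"
    proof (rule smooth_on_vec[OF oI])
      fix i :: 4
      show "smooth_on I (\<lambda>z. coord_line 3 q0 z $ i)"
        by (cases "i = 3") (simp_all add: smooth_on_const smooth_on_bounded_linear[OF oI bounded_linear_ident])
    qed
  qed (rule line[OF q0])
  define g where "g z = (\<gamma> z)\<^sup>2 + \<epsilon> + deriv \<gamma> z" for z
  have d\<gamma>: "(\<gamma> has_real_derivative deriv \<gamma> z) (at z)" if z: "z \<in> I" for z
  proof -
    have "(\<gamma> has_real_derivative pderiv_at 3 G (coord_line 3 q0 z)) (at z)"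
      unfolding \<gamma>_def by (rule smooth_on_coord_line_DERIV[OF sm(7) line[OF q0 z]])
    then show ?thesis by (metis DERIV_imp_deriv)
  qed

  define sol where "sol k k' \<longleftrightarrow> (\<forall>z\<in>I. (k has_real_derivative k' z) (at z) \<and> (k' has_real_derivative g z * k z) (at z))"
    for k k' :: "real \<Rightarrow> real"
  \<comment> \<open>Differentiating the first equation and eliminating \<open>R\<close> by the
    second turns the first order system for \<open>P\<close> and \<open>R\<close> into P'' =
    (\<gamma>^2 + \<epsilon> + \<gamma>') P; the mixed terms in \<open>R\<close> cancel.\<close>
  have sol_line: "sol (\<lambda>z. P (coord_line 3 q z)) (\<lambda>z. pderiv_at 3 P (coord_line 3 q z))"
    if q: "q \<in> B" and P: "smooth_on B P" and R: "smooth_on B R"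
      and P3: "\<And>q. q \<in> B \<Longrightarrow> pderiv_at 3 P q = G q * P q - R q"
      and R3: "\<And>q. q \<in> B \<Longrightarrow> pderiv_at 3 R q = - G q * R q - \<epsilon> * P q" for q P R
    unfolding sol_def
  proof (intro ballI conjI)
    fix z assume z: "z \<in> I"
    note lB = line[OF q z]
    show dP: "((\<lambda>z. P (coord_line 3 q z)) has_real_derivative pderiv_at 3 P (coord_line 3 q z)) (at z)"
      by (rule smooth_on_coord_line_DERIV[OF P lB])
    have dR: "((\<lambda>z. R (coord_line 3 q z)) has_real_derivative pderiv_at 3 R (coord_line 3 q z)) (at z)"
      by (rule smooth_on_coord_line_DERIV[OF R lB])
    have "((\<lambda>z. \<gamma> z * P (coord_line 3 q z) - R (coord_line 3 q z)) has_real_derivative g z * P (coord_line 3 q z)) (at z)"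
      by (rule DERIV_cong[OF DERIV_diff[OF DERIV_mult[OF d\<gamma>[OF z] dP] dR]])
        (simp add: P3[OF lB] R3[OF lB] G\<gamma>[OF lB] g_def algebra_simps power2_eq_square)
    then show "((\<lambda>z. pderiv_at 3 P (coord_line 3 q z)) has_real_derivative g z * P (coord_line 3 q z)) (at z)"
    proof (rule has_field_derivative_transform_within_open[OF _ oI z])
      fix z assume "z \<in> I"
      from line[OF q this] show "\<gamma> z * P (coord_line 3 q z) - R (coord_line 3 q z) = pderiv_at 3 P (coord_line 3 q z)"
        using P3[of "coord_line 3 q z"] G\<gamma>[of "coord_line 3 q z"] by simp
    qed
  qed
  \<comment> \<open>The equation has no first order term, so Wronskians are constant.\<close>
  have wr_const: "k x * l' x - l x * k' x = k y * l' y - l y * k' y"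
    if kl: "sol k k'" "sol l l'" and xy: "x \<in> I" "y \<in> I" for k k' l l' x y
  proof (rule DERIV_zero_interval_eq[OF _ xy[unfolded I_def]])
    fix z assume "z \<in> {a $ 3<..<b $ 3}"
    then have z: "z \<in> I" by (simp add: I_def)
    have k: "(k has_real_derivative k' z) (at z)" "(k' has_real_derivative g z * k z) (at z)"
      and l: "(l has_real_derivative l' z) (at z)" "(l' has_real_derivative g z * l z) (at z)"
      using kl z by (auto simp: sol_def)
    show "((\<lambda>z. k z * l' z - l z * k' z) has_real_derivative 0) (at z)"
      by (rule DERIV_cong[OF DERIV_diff[OF DERIV_mult[OF k(1) l(2)] DERIV_mult[OF l(1) k(2)]]]) simp
  qed

  \<comment> \<open>The fundamental system is read off from the forms on the z-line through
    \<open>q0\<close>.\<close>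
  define Q1 where "Q1 z = K (coord_line 3 q0 z)" for z
  define Q2 where "Q2 z = L (coord_line 3 q0 z)" for z
  define Q1' where "Q1' z = pderiv_at 3 K (coord_line 3 q0 z)" for z
  define Q2' where "Q2' z = pderiv_at 3 L (coord_line 3 q0 z)" for z
  have sK: "sol (\<lambda>z. K (coord_line 3 q z)) (\<lambda>z. pderiv_at 3 K (coord_line 3 q z))"
    and sL: "sol (\<lambda>z. L (coord_line 3 q z)) (\<lambda>z. pderiv_at 3 L (coord_line 3 q z))" if "q \<in> B" for q
    using sol_line[OF that sm(1,3) K3 M3] sol_line[OF that sm(2,4) L3 N3] by auto
  have sQ: "sol Q1 Q1'" "sol Q2 Q2'"
    using sK[OF q0] sL[OF q0] unfolding Q1_def[abs_def] Q2_def[abs_def] Q1'_def[abs_def] Q2'_def[abs_def] by auto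
  have derivQ: "deriv Q1 z = Q1' z" "deriv Q2 z = Q2' z" if "z \<in> I" for z
    using sQ that by (auto simp: sol_def intro!: DERIV_imp_deriv)
  have ode: "solves_ode2 I g k" if "sol k k'" for k k'
    unfolding solves_ode2_def
  proof (intro ballI conjI)
    have dk: "deriv k z = k' z" if "z \<in> I" for z
      using \<open>sol k k'\<close> that by (auto simp: sol_def intro!: DERIV_imp_deriv)
    fix z assume z: "z \<in> I"
    show "(k has_real_derivative deriv k z) (at z)" using \<open>sol k k'\<close> z by (auto simp: sol_def dk)
    have "(k' has_real_derivative g z * k z) (at z)" using \<open>sol k k'\<close> z by (auto simp: sol_def)
    then show "(deriv k has_real_derivative g z * k z) (at z)"
      by (rule has_field_derivative_transform_within_open[OF _ oI z]) (simp add: dk)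
  qed
  \<comment> \<open>Inserting the first order equations, the terms with \<open>G\<close> cancel and
    minus the determinant from \<open>det\<close> remains.\<close>
  have KL: "K q * pderiv_at 3 L q - L q * pderiv_at 3 K q \<noteq> 0" if "q \<in> B" for q
    using det[OF that] by (simp add: K3[OF that] L3[OF that] algebra_simps)
  define z0 where "z0 = q0 $ 3"
  have z0: "z0 \<in> I" using q3(1)[OF q0] by (simp add: z0_def)
  define W0 where "W0 = Q1 z0 * Q2' z0 - Q2 z0 * Q1' z0"
  have W0: "W0 \<noteq> 0" using KL[OF q0] by (simp add: W0_def Q1_def Q2_def Q1'_def Q2'_def z0_def)
  have W: "Q1 z * Q2' z - Q2 z * Q1' z = W0" if "z \<in> I" for z
    unfolding W0_def by (rule wr_const[OF sQ that z0])

  define w0 where "w0 = q0 $ 4"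
  \<comment> \<open>Embeds the (x, y)-rectangle into the box as the slice at height z0 and w0, where
    the coefficients are going to be computed.\<close>
  define e where "e s = (\<chi> i. if i = 1 then fst s else if i = 2 then snd s else q0 $ i)" for s :: "real \<times> real"
  have eB: "e s \<in> B" if "s \<in> D" for s
    using that q0 by (auto simp: e_def B_def D_def mem_box_cart)
  have sme: "smooth_on D e"
  proof (rule smooth_on_vec[OF oD])
    fix i :: 4
    have "smooth_on D fst" "smooth_on D snd"
      by (intro smooth_on_bounded_linear[OF oD] bounded_linear_fst bounded_linear_snd)+
    then show "smooth_on D (\<lambda>s. e s $ i)"
      by (cases "i = 1"; cases "i = 2") (simp_all add: e_def smooth_on_const)
  qed
  \<comment> \<open>From k W(Q1, Q2) = Q1 W(k, Q2) - Q2 W(k, Q1) the coefficients of a solution k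
    are Wronskians divided by W0, here taken at \<open>z0\<close>. The factor \<open>sqrt w0\<close>
    accounts for the slice w = w0.\<close>
  define c1 where "c1 P s = sqrt w0 / W0 * (P (e s) * Q2' z0 - Q2 z0 * pderiv_at 3 P (e s))" for P s
  define c2 where "c2 P s = - sqrt w0 / W0 * (P (e s) * Q1' z0 - Q1 z0 * pderiv_at 3 P (e s))" for P s
  have smc: "smooth_on D (c1 P)" "smooth_on D (c2 P)" if P: "smooth_on B P" for P
  proof -
    have c: "smooth_on D (\<lambda>s. r * (P (e s) * x - y * pderiv_at 3 P (e s)))" for r x y
      by (intro smooth_on_mult[OF oD] smooth_on_diff[OF oD] smooth_on_const
        smooth_on_compose[OF oD P sme eB] smooth_on_compose[OF oD smooth_on_pderiv_at[OF P] sme eB])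
    show "smooth_on D (c1 P)" "smooth_on D (c2 P)"
      unfolding c1_def c2_def by (rule c)+
  qed
  \<comment> \<open>By \<open>P4\<close> the product of sqrt w and \<open>P\<close> is constant
    along w-lines, which moves the point to w = w0; along the z-line there the Wronskians with
    \<open>Q1\<close> and \<open>Q2\<close> may be evaluated at \<open>z0\<close>.\<close>
  have repr: "P q = 1 / sqrt (q $ 4) * (c1 P (q $ 1, q $ 2) * Q1 (q $ 3) + c2 P (q $ 1, q $ 2) * Q2 (q $ 3))"
    if q: "q \<in> B" and P: "smooth_on B P" and P4: "\<And>q. q \<in> B \<Longrightarrow> pderiv_at 4 P q = - P q / (2 * q $ 4)"
      and sP: "\<And>q. q \<in> B \<Longrightarrow> sol (\<lambda>z. P (coord_line 3 q z)) (\<lambda>z. pderiv_at 3 P (coord_line 3 q z))" for q P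
  proof -
    have w0I: "w0 \<in> {a$4<..<b$4}" "q $ 4 \<in> {a$4<..<b$4}"
      using q0 q by (auto simp: w0_def B_def mem_box_cart)
    have l4: "coord_line 4 q w \<in> B" if "w \<in> {a$4<..<b$4}" for w
      using coord_line_in_box[of q a b 4 w] q that by (simp add: B_def)
    have "sqrt (q $ 4) * P (coord_line 4 q (q $ 4)) = sqrt w0 * P (coord_line 4 q w0)"
    proof (rule DERIV_zero_interval_eq[OF _ w0I(2,1)])
      fix w assume w: "w \<in> {a$4<..<b$4}"
      have wpos: "w > 0" using pos[OF l4[OF w]] by simp
      show "((\<lambda>w. sqrt w * P (coord_line 4 q w)) has_real_derivative 0) (at w)"
      proof (rule DERIV_cong[OF DERIV_mult[OF DERIV_real_sqrt[OF wpos] smooth_on_coord_line_DERIV[OF P l4[OF w]]]])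
        have "sqrt w * sqrt w = w" "sqrt w > 0" using wpos by auto
        then show "inverse (sqrt w) / 2 * P (coord_line 4 q w) + pderiv_at 4 P (coord_line 4 q w) * sqrt w = 0"
          using wpos unfolding P4[OF l4[OF w]] by (simp add: field_simps)
      qed
    qed
    then have Pq: "P q = sqrt w0 * P (coord_line 4 q w0) / sqrt (q $ 4)"
      using pos[OF q] by (simp add: field_simps)
    define q' where "q' = coord_line 4 q w0"
    have q': "q' \<in> B" unfolding q'_def by (rule l4[OF w0I(1)])
    have e: "coord_line 3 q' z0 = e (q $ 1, q $ 2)"
      using exhaust_4 by (auto simp: vec_eq_iff q'_def e_def z0_def w0_def)
    have z: "q $ 3 \<in> I" by (rule q3(1)[OF q])
    let ?k = "\<lambda>z. P (coord_line 3 q' z)" and ?k' = "\<lambda>z. pderiv_at 3 P (coord_line 3 q' z)"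
    define A1 where "A1 = P (e (q $ 1, q $ 2)) * Q1' z0 - Q1 z0 * pderiv_at 3 P (e (q $ 1, q $ 2))"
    define A2 where "A2 = P (e (q $ 1, q $ 2)) * Q2' z0 - Q2 z0 * pderiv_at 3 P (e (q $ 1, q $ 2))"
    have A: "?k (q $ 3) * Q1' (q $ 3) - Q1 (q $ 3) * ?k' (q $ 3) = A1"
      "?k (q $ 3) * Q2' (q $ 3) - Q2 (q $ 3) * ?k' (q $ 3) = A2"
      using wr_const[OF sP[OF q'] sQ(1) z z0] wr_const[OF sP[OF q'] sQ(2) z z0] by (simp_all add: e A1_def A2_def)
    have "?k (q $ 3) * (Q1 (q $ 3) * Q2' (q $ 3) - Q2 (q $ 3) * Q1' (q $ 3)) = Q1 (q $ 3) * A2 - Q2 (q $ 3) * A1"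
      unfolding A[symmetric] by (simp add: algebra_simps)
    then have "?k (q $ 3) * W0 = Q1 (q $ 3) * A2 - Q2 (q $ 3) * A1" by (simp add: W[OF z])
    then have "?k (q $ 3) = (Q1 (q $ 3) * A2 - Q2 (q $ 3) * A1) / W0" using W0 by (simp add: field_simps)
    moreover have "coord_line 3 q' (q $ 3) = coord_line 4 q w0" by (simp add: q'_def vec_eq_iff)
    ultimately have X: "P (coord_line 4 q w0) = (Q1 (q $ 3) * A2 - Q2 (q $ 3) * A1) / W0" by simp
    show ?thesis
      unfolding Pq X c1_def c2_def A1_def[symmetric] A2_def[symmetric] by (simp add: diff_divide_distrib algebra_simps)
  qed

  define h :: "real \<times> real \<Rightarrow> real^2^2" where
    "h s = (\<chi> i j. if i = 1 then (if j = 1 then c1 K s else c2 K s) else (if j = 1 then c1 L s else c2 L s))" for s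
  have h: "h s $ 1 $ 1 = c1 K s" "h s $ 1 $ 2 = c2 K s" "h s $ 2 $ 1 = c1 L s" "h s $ 2 $ 2 = c2 L s" for s
    by (simp_all add: h_def)
  have K_repr: "K q = 1 / sqrt (q $ 4) * (c1 K (q $ 1, q $ 2) * Q1 (q $ 3) + c2 K (q $ 1, q $ 2) * Q2 (q $ 3))"
    and L_repr: "L q = 1 / sqrt (q $ 4) * (c1 L (q $ 1, q $ 2) * Q1 (q $ 3) + c2 L (q $ 1, q $ 2) * Q2 (q $ 3))"
    if "q \<in> B" for q
    using repr[OF that sm(1) K4 sK] repr[OF that sm(2) L4 sL] by auto
  have repr3: "pderiv_at 3 P q = 1 / sqrt (q $ 4) * (x * Q1' (q $ 3) + y * Q2' (q $ 3))"
    if q: "q \<in> B" and P: "smooth_on B P" 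
      and r: "\<And>z. z \<in> I \<Longrightarrow> P (coord_line 3 q z) = 1 / sqrt (q $ 4) * (x * Q1 z + y * Q2 z)" for P q x y
  proof -
    have z: "q $ 3 \<in> I" by (rule q3(1)[OF q])
    have dQ: "(Q1 has_real_derivative Q1' (q $ 3)) (at (q $ 3))" "(Q2 has_real_derivative Q2' (q $ 3)) (at (q $ 3))"
      using sQ z by (auto simp: sol_def)
    have "((\<lambda>z. 1 / sqrt (q $ 4) * (x * Q1 z + y * Q2 z)) has_real_derivative
       1 / sqrt (q $ 4) * (x * Q1' (q $ 3) + y * Q2' (q $ 3))) (at (q $ 3))"
      by (intro DERIV_cmult DERIV_add dQ)
    then have "((\<lambda>z. P (coord_line 3 q z)) has_real_derivative
       1 / sqrt (q $ 4) * (x * Q1' (q $ 3) + y * Q2' (q $ 3))) (at (q $ 3))"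
      by (rule has_field_derivative_transform_within_open[OF _ oI z]) (simp add: r)
    moreover have "((\<lambda>z. P (coord_line 3 q z)) has_real_derivative pderiv_at 3 P q) (at (q $ 3))"
      using smooth_on_coord_line_DERIV[OF P, of 3 q "q $ 3"] q by simp
    ultimately show ?thesis by (rule DERIV_unique[symmetric])
  qed
  \<comment> \<open>\<open>K\<close> and \<open>L\<close> are combinations of \<open>Q1\<close> and
    \<open>Q2\<close> with coefficient matrix h / sqrt w, so their Wronskian acquires the factor
    \<open>det h\<close> and, from the two square roots, 1 / w.\<close>
  have det_h: "K q * pderiv_at 3 L q - L q * pderiv_at 3 K q = W0 * det (h (q $ 1, q $ 2)) / (q $ 4)" if q: "q \<in> B" for q
  proof -
    let ?s = "(q $ 1, q $ 2)"
    have K3r: "pderiv_at 3 K q = 1 / sqrt (q $ 4) * (c1 K ?s * Q1' (q $ 3) + c2 K ?s * Q2' (q $ 3))"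
      by (rule repr3[OF q sm(1)]) (use K_repr[OF line[OF q]] in simp)
    have L3r: "pderiv_at 3 L q = 1 / sqrt (q $ 4) * (c1 L ?s * Q1' (q $ 3) + c2 L ?s * Q2' (q $ 3))"
      by (rule repr3[OF q sm(2)]) (use L_repr[OF line[OF q]] in simp)
    have sq: "1 / sqrt (q $ 4) * (1 / sqrt (q $ 4)) = 1 / (q $ 4)" using pos[OF q] by simp
    have "(r * (k1 * u + k2 * v)) * (r * (l1 * u' + l2 * v')) - (r * (l1 * u + l2 * v)) * (r * (k1 * u' + k2 * v'))
      = (r * r) * ((u * v' - v * u') * (k1 * l2 - k2 * l1))" for r k1 k2 l1 l2 u v u' v' :: real
      by (simp add: algebra_simps)
    note this[of "1 / sqrt (q $ 4)" "c1 K ?s" "Q1 (q $ 3)" "c2 K ?s" "Q2 (q $ 3)" "c1 L ?s" "Q1' (q $ 3)" "c2 L ?s" "Q2' (q $ 3)"]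
    then have "K q * pderiv_at 3 L q - L q * pderiv_at 3 K q =
       (1 / (q $ 4)) * (W0 * (c1 K ?s * c2 L ?s - c2 K ?s * c1 L ?s))"
      unfolding K3r L3r sq W[OF q3(1)[OF q]] using K_repr[OF q] L_repr[OF q] by simp
    then show ?thesis by (simp add: det_2 h)
  qed
  \<comment> \<open>\<open>h\<close> depends on x and y only, so it can be tested at the point
    \<open>e s\<close> of the box, where the Wronskian of \<open>K\<close> and \<open>L\<close> is
    nonzero.\<close>
  have det_ne: "det (h s) \<noteq> 0" if "s \<in> D" for s
  proof -
    have "(e s $ 1, e s $ 2) = s" by (simp add: e_def)
    then show ?thesis using KL[OF eB[OF that]] det_h[OF eB[OF that]] by auto
  qed

  define f where "f q = q $ 4 / (W0 * det (h (q $ 1, q $ 2))) * (pderiv_at 1 L q - pderiv_at 2 K q)" for q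
  have smh: "smooth_on D (\<lambda>s. h s $ i $ j)" for i j
    using smc[OF sm(1)] smc[OF sm(2)] by (cases "i = 1"; cases "j = 1") (simp_all add: h_def)
  \<comment> \<open>\<open>F\<close> replaces the curl in \<open>f\<close> by K \<beta> - L
    \<alpha>. The prefactor, \<alpha> and \<beta> are independent of z, so only \<open>K\<close> and
    \<open>L\<close> are differentiated.\<close>
  have f3: "pderiv_at 3 f q = q $ 4 / (W0 * det (h (q $ 1, q $ 2))) * (pderiv_at 3 K q * \<beta> q - pderiv_at 3 L q * \<alpha> q)"
    if q: "q \<in> B" for q
  proof -
    have smd: "smooth_on B (\<lambda>q. det (h (q $ 1, q $ 2)))"
    proof -
      have "pcd k {0} D (\<lambda>t s. det (h s))" for k
        by (rule pcd_det[OF oD]) (rule smooth_on_imp_pcd[OF smh])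
      then have 1: "smooth_on D (\<lambda>s. det (h s))" by (simp add: smooth_on_iff_pcd)
      have 2: "smooth_on B (\<lambda>q. (q $ 1, q $ 2))"
        by (intro smooth_on_bounded_linear[OF oB] bounded_linear_Pair bounded_linear_vec_nth)
      show ?thesis by (rule smooth_on_compose[OF oB 1 2 q3(2)])
    qed
    have "smooth_on B (\<lambda>q. q $ 4 * inverse (W0 * det (h (q $ 1, q $ 2))) * (pderiv_at 1 L q - pderiv_at 2 K q))"
      by (intro smooth_on_mult[OF oB] smooth_on_inverse[OF oB] smooth_on_diff[OF oB] smooth_on_const smd
        smooth_on_pderiv_at sm smooth_on_bounded_linear[OF oB] bounded_linear_vec_nth)
        (use W0 det_ne q3(2) in auto)
    then have smf: "smooth_on B f" by (simp add: f_def[abs_def] divide_inverse)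
    let ?c = "q $ 4 / (W0 * det (h (q $ 1, q $ 2)))"
    have z: "q $ 3 \<in> I" by (rule q3(1)[OF q])
    have d: "((\<lambda>z. P (coord_line 3 q z)) has_real_derivative pderiv_at 3 P q) (at (q $ 3))" if "smooth_on B P" for P
      using smooth_on_coord_line_DERIV[OF that, of 3 q "q $ 3"] q by simp
    have "((\<lambda>z. ?c * (K (coord_line 3 q z) * \<beta> (coord_line 3 q z) - L (coord_line 3 q z) * \<alpha> (coord_line 3 q z)))
      has_real_derivative ?c * (pderiv_at 3 K q * \<beta> q - pderiv_at 3 L q * \<alpha> q)) (at (q $ 3))"
      by (rule DERIV_cong[OF DERIV_cmult[OF DERIV_diff[OF DERIV_mult[OF d[OF sm(1)] d[OF sm(6)]] DERIV_mult[OF d[OF sm(2)] d[OF sm(5)]]]]])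
        (simp add: \<alpha>3[OF q] \<beta>3[OF q])
    then have "((\<lambda>z. f (coord_line 3 q z)) has_real_derivative ?c * (pderiv_at 3 K q * \<beta> q - pderiv_at 3 L q * \<alpha> q)) (at (q $ 3))"
      by (rule has_field_derivative_transform_within_open[OF _ oI z]) (simp add: f_def F line[OF q])
    then show ?thesis using DERIV_unique d[OF smf] by blast
  qed
  \<comment> \<open>Cramer's rule for \<alpha> and \<beta>, the two equations being those for
    \<open>f\<close> and its z-derivative; \<open>c\<close> is the reciprocal of the
    determinant.\<close>
  have final: "\<alpha> q = - (K q * pderiv_at 3 f q - f q * pderiv_at 3 K q) \<and>
     \<beta> q = - (L q * pderiv_at 3 f q - f q * pderiv_at 3 L q)" if q: "q \<in> B" for q
  proof -
    define c where "c = q $ 4 / (W0 * det (h (q $ 1, q $ 2)))"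
    have c: "c * (K q * pderiv_at 3 L q - L q * pderiv_at 3 K q) = 1"
      unfolding c_def det_h[OF q] using W0 det_ne[OF q3(2)[OF q]] pos[OF q] by simp
    have f: "f q = c * (K q * \<beta> q - L q * \<alpha> q)" by (simp add: f_def c_def F[OF q])
    have f3': "pderiv_at 3 f q = c * (pderiv_at 3 K q * \<beta> q - pderiv_at 3 L q * \<alpha> q)"
      using f3[OF q] by (simp add: c_def)
    have "- (K q * pderiv_at 3 f q - f q * pderiv_at 3 K q) =
        c * (K q * pderiv_at 3 L q - L q * pderiv_at 3 K q) * \<alpha> q"
      "- (L q * pderiv_at 3 f q - f q * pderiv_at 3 L q) =
        c * (K q * pderiv_at 3 L q - L q * pderiv_at 3 K q) * \<beta> q"
      unfolding f f3' by (simp_all add: algebra_simps)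
    then show ?thesis unfolding c by simp
  qed
  have wr: "wronskian Q1 Q2 z = W0" if "z \<in> I" for z
    unfolding wronskian_def derivQ[OF that] by (rule W[OF that])
  \<comment> \<open>A linear relation and its derivative at \<open>z0\<close> form a homogeneous
    system with determinant \<open>W0\<close>.\<close>
  have indep: "lin_indep_on I Q1 Q2"
    unfolding lin_indep_on_def
  proof (intro allI impI)
    fix x y assume eq: "\<forall>t\<in>I. x * Q1 t + y * Q2 t = 0"
    have dQ: "(Q1 has_real_derivative Q1' z0) (at z0)" "(Q2 has_real_derivative Q2' z0) (at z0)"
      using sQ z0 by (auto simp: sol_def)
    have "((\<lambda>t. x * Q1 t + y * Q2 t) has_real_derivative x * Q1' z0 + y * Q2' z0) (at z0)"
      by (intro DERIV_add DERIV_cmult dQ)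
    moreover have "((\<lambda>t. x * Q1 t + y * Q2 t) has_real_derivative 0) (at z0)"
      by (rule has_field_derivative_transform_within_open[OF DERIV_const oI z0]) (use eq in simp)
    ultimately have 2: "x * Q1' z0 + y * Q2' z0 = 0" by (rule DERIV_unique)
    have 1: "x * Q1 z0 + y * Q2 z0 = 0" using eq z0 by blast
    have "x * W0 = Q2' z0 * (x * Q1 z0 + y * Q2 z0) - Q2 z0 * (x * Q1' z0 + y * Q2' z0)"
      by (simp add: W0_def algebra_simps)
    then have x: "x * W0 = 0" unfolding 1 2 by simp
    have "y * W0 = Q1 z0 * (x * Q1' z0 + y * Q2' z0) - Q1' z0 * (x * Q1 z0 + y * Q2 z0)"
      by (simp add: W0_def algebra_simps)
    then have "y * W0 = 0" unfolding 1 2 by simp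
    with x W0 show "x = 0 \<and> y = 0" by simp
  qed
  show ?thesis
    by (rule that[of h \<gamma> Q1 Q2 W0 f])
      (use smh det_ne sm\<gamma> G\<gamma> ode[OF sQ(1)] ode[OF sQ(2)] indep W0 wr K_repr L_repr final
        in \<open>simp_all add: h invertible_det_nz g_def[abs_def] f_def\<close>)
qed

section \<open>The structure equations read off in the adapted chart\<close>

theorem theorem5:
  fixes A :: "('m::{t2_space, second_countable_topology}, 4) chart set"
    and \<omega> :: "4 \<Rightarrow> ('m, 4) form1"
    and \<epsilon> :: real
    and C C3 E :: "'m \<Rightarrow> real"
    and U :: "'m set"
  assumes "smooth_structure A"
    and "coframe A \<omega>"
    and "\<epsilon> = 1 \<or> \<epsilon> = -1"
    and "smooth_function A C" and "smooth_function A C3" and "smooth_function A E"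
    and dC: "\<forall>c\<in>A. \<forall>p\<in>chart_dom c. \<forall>v. d_fun C c p v = C3 p * \<omega> 3 c p v"
    and C3_nonzero: "\<forall>p. C3 p \<noteq> 0"
    and dC3: "\<forall>c\<in>A. \<forall>p\<in>chart_dom c. \<forall>u v. wedge (d_fun C3) (\<omega> 3) c p u v = 0"
    and d1: "\<forall>c\<in>A. \<forall>p\<in>chart_dom c. \<forall>u v.
      d_form1 (\<omega> 1) c p u v =
        wedge (\<omega> 1) (\<omega> 4) c p u v - C p * wedge (\<omega> 1) (\<omega> 3) c p u v + wedge (\<omega> 2) (\<omega> 3) c p u v"
    and d2: "\<forall>c\<in>A. \<forall>p\<in>chart_dom c. \<forall>u v.
      d_form1 (\<omega> 2) c p u v =
        wedge (\<omega> 2) (\<omega> 4) c p u v + C p * wedge (\<omega> 2) (\<omega> 3) c p u v + \<epsilon> * wedge (\<omega> 1) (\<omega> 3) c p u v"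
    and d3: "\<forall>c\<in>A. \<forall>p\<in>chart_dom c. \<forall>u v. d_form1 (\<omega> 3) c p u v = 0"
    and d4: "\<forall>c\<in>A. \<forall>p\<in>chart_dom c. \<forall>u v.
      d_form1 (\<omega> 4) c p u v = E p * wedge (\<omega> 1) (\<omega> 2) c p u v"
    and "open U" and E_pos: "\<forall>p\<in>U. E p > 0"
  shows "\<forall>p0\<in>U. \<exists>V \<phi>. (V, \<phi>) \<in> A \<and> p0 \<in> V \<and> V \<subseteq> U \<and>
    (\<exists>(h :: real \<times> real \<Rightarrow> real ^ 2 ^ 2) D Q1 Q2 \<gamma> a b W0 K L f.
       open D \<and> (\<lambda>p. (\<phi> p $ 1, \<phi> p $ 2)) ` V = D \<and>
       a < b \<and> (\<lambda>p. \<phi> p $ 3) ` V = {a<..<b} \<and>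
       (\<forall>p\<in>V. \<phi> p $ 4 > 0) \<and>
       (\<forall>i j. smooth_on D (\<lambda>s. h s $ i $ j)) \<and> (\<forall>s\<in>D. invertible (h s)) \<and>
       smooth_on {a<..<b} \<gamma> \<and> (\<forall>p\<in>V. C p = \<gamma> (\<phi> p $ 3)) \<and>
       solves_ode2 {a<..<b} (\<lambda>z. (\<gamma> z)\<^sup>2 + \<epsilon> + deriv \<gamma> z) Q1 \<and>
       solves_ode2 {a<..<b} (\<lambda>z. (\<gamma> z)\<^sup>2 + \<epsilon> + deriv \<gamma> z) Q2 \<and>
       lin_indep_on {a<..<b} Q1 Q2 \<and>
       W0 \<noteq> 0 \<and> (\<forall>z\<in>{a<..<b}. wronskian Q1 Q2 z = W0) \<and>
       (\<forall>q\<in>\<phi> ` V.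
          K q = 1 / sqrt (q $ 4) *
            (h (q $ 1, q $ 2) $ 1 $ 1 * Q1 (q $ 3) + h (q $ 1, q $ 2) $ 1 $ 2 * Q2 (q $ 3)) \<and>
          L q = 1 / sqrt (q $ 4) *
            (h (q $ 1, q $ 2) $ 2 $ 1 * Q1 (q $ 3) + h (q $ 1, q $ 2) $ 2 $ 2 * Q2 (q $ 3)) \<and>
          f q = q $ 4 / (W0 * det (h (q $ 1, q $ 2))) * (pderiv_at 1 L q - pderiv_at 2 K q)) \<and>
       (\<forall>p\<in>V. \<forall>v.
          let q = \<phi> p;
              dx = d_fun (\<lambda>p. \<phi> p $ 1) (V, \<phi>) p v;
              dy = d_fun (\<lambda>p. \<phi> p $ 2) (V, \<phi>) p v;
              dz = d_fun (\<lambda>p. \<phi> p $ 3) (V, \<phi>) p v;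
              dw = d_fun (\<lambda>p. \<phi> p $ 4) (V, \<phi>) p v
          in \<omega> 1 (V, \<phi>) p v = K q * dx + L q * dy \<and>
             \<omega> 2 (V, \<phi>) p v = C p * \<omega> 1 (V, \<phi>) p v
               - (pderiv_at 3 K q * dx + pderiv_at 3 L q * dy) \<and>
             \<omega> 3 (V, \<phi>) p v = dz \<and>
             \<omega> 4 (V, \<phi>) p v = 1 / (2 * q $ 4) * dw
               - (K q * pderiv_at 3 f q - f q * pderiv_at 3 K q) * dx
               - (L q * pderiv_at 3 f q - f q * pderiv_at 3 L q) * dy))"
proof (rule ballI, goal_cases)
  case (1 p0)
  then have p0: "p0 \<in> U" .
  note A = \<open>smooth_structure A\<close> and \<omega> = \<open>coframe A \<omega>\<close>
  obtain V \<phi> a b where V: "(V, \<phi>) \<in> A" "p0 \<in> V" "V \<subseteq> U" "\<phi> ` V = box a b"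
    and pos: "\<And>p. p \<in> V \<Longrightarrow> \<phi> p $ 4 > 0"
    and ad: "\<And>p. p \<in> V \<Longrightarrow> adapted_at \<omega> (V, \<phi>) p (1 / (2 * \<phi> p $ 4))"
    by (rule adapted_chart[OF A \<omega> \<open>smooth_function A C\<close> d1[rule_format] d2[rule_format] d3[rule_format]
        d4[rule_format] \<open>open U\<close> p0 that])
  define B where "B = box a b"
  have oB: "open B" by (simp add: B_def open_box)
  have inv\<phi>: "inv_into V \<phi> (\<phi> p) = p" if "p \<in> V" for p
    using is_chart_inj_on[OF smooth_structure_is_chart[OF A V(1)]] that by simp
  have \<phi>B: "\<phi> p \<in> B" if "p \<in> V" for p using that V(4) by (auto simp: B_def)
  have invV: "inv_into V \<phi> q \<in> V" "\<phi> (inv_into V \<phi> q) = q" if "q \<in> B" for q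
    using that V(4) unfolding B_def by (metis inv_into_into, metis f_inv_into_f)
  have dom: "p \<in> chart_dom (V, \<phi>)" if "p \<in> V" for p using that by simp
  \<comment> \<open>The coefficients as functions of the coordinates: on two coordinate vectors the
    exterior derivative becomes a difference of two partial derivatives of such functions.\<close>
  define c where "c i v q = \<omega> i (V, \<phi>) (inv_into V \<phi> q) v" for i v q
  have smc: "smooth_on B (c i v)" for i v
  proof -
    have "\<forall>c\<in>A. \<forall>v. smooth_on (chart_map c ` chart_dom c) (\<lambda>q. \<omega> i c (chart_inv c q) v)"
      using coframe_smooth_form1[OF \<omega>, of i] by (simp add: smooth_form1_def)
    from this[rule_format, OF V(1), of v] show ?thesis by (simp add: V(4) B_def c_def[abs_def])
  qed
  define K where "K = c 1 (axis 1 1)"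
  define L where "L = c 1 (axis 2 1)"
  define M where "M = c 2 (axis 1 1)"
  define N where "N = c 2 (axis 2 1)"
  define \<alpha> where "\<alpha> = c 4 (axis 1 1)"
  define \<beta> where "\<beta> = c 4 (axis 2 1)"
  define G where "G = C \<circ> inv_into V \<phi>"
  have smG: "smooth_on B G"
  proof -
    have "\<forall>c\<in>A. smooth_on (chart_map c ` chart_dom c) (C \<circ> chart_inv c)"
      using \<open>smooth_function A C\<close> by (simp add: smooth_function_def)
    from this[rule_format, OF V(1)] show ?thesis by (simp add: V(4) B_def G_def)
  qed
  have lin: "linear (\<omega> i (V, \<phi>) p)" if "p \<in> V" for i p
    using coframe_linear[OF \<omega> V(1)] that by simp
  have expand: "\<omega> i (V, \<phi>) p v = (\<Sum>k\<in>UNIV. v $ k * \<omega> i (V, \<phi>) p (axis k 1))" if "p \<in> V" for i p v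
    using linear_axis_expand[OF lin[OF that], of i v] by simp
  have d: "d_form1 (\<omega> i) (V, \<phi>) (inv_into V \<phi> q) (axis j 1) (axis k 1) =
      pderiv_at j (c i (axis k 1)) q - pderiv_at k (c i (axis j 1)) q" if "q \<in> B" for i j k q
    by (simp add: d_form1_def pderiv_at_def c_def[abs_def] invV(2)[OF that])
  have vals: "c 1 (axis 3 1) q = 0" "c 1 (axis 4 1) q = 0" "c 2 (axis 3 1) q = 0" "c 2 (axis 4 1) q = 0"
    "c 3 v q = v $ 3" "c 4 (axis 3 1) q = 0" "c 4 (axis 4 1) q = 1 / (2 * q $ 4)" if "q \<in> B" for q v
    using ad[OF invV(1)[OF that]] by (simp_all add: adapted_at_def c_def invV(2)[OF that])
  have z: "pderiv_at k (c 1 (axis 3 1)) q = 0" "pderiv_at k (c 1 (axis 4 1)) q = 0"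
    "pderiv_at k (c 2 (axis 3 1)) q = 0" "pderiv_at k (c 4 (axis 3 1)) q = 0" if "q \<in> B" for k q
    using vals by (auto intro!: pderiv_at_zero[OF oB that])
  have nth: "axis (1::4) (1::real) $ 3 = 0" "axis (2::4) (1::real) $ 3 = 0" "axis (4::4) (1::real) $ 3 = 0"
    "axis (3::4) (1::real) $ 3 = 1" by (simp_all add: axis_def)
  have D1: "pderiv_at j (c 1 (axis k 1)) q - pderiv_at k (c 1 (axis j 1)) q =
      c 1 (axis j 1) q * c 4 (axis k 1) q - c 1 (axis k 1) q * c 4 (axis j 1) q
      - G q * (c 1 (axis j 1) q * c 3 (axis k 1) q - c 1 (axis k 1) q * c 3 (axis j 1) q)
      + (c 2 (axis j 1) q * c 3 (axis k 1) q - c 2 (axis k 1) q * c 3 (axis j 1) q)" if "q \<in> B" for j k q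
    unfolding d[OF that, symmetric] d1[rule_format, OF V(1) dom[OF invV(1)[OF that]]]
    by (simp add: wedge_def c_def G_def)
  have D2: "pderiv_at j (c 2 (axis k 1)) q - pderiv_at k (c 2 (axis j 1)) q =
      c 2 (axis j 1) q * c 4 (axis k 1) q - c 2 (axis k 1) q * c 4 (axis j 1) q
      + G q * (c 2 (axis j 1) q * c 3 (axis k 1) q - c 2 (axis k 1) q * c 3 (axis j 1) q)
      + \<epsilon> * (c 1 (axis j 1) q * c 3 (axis k 1) q - c 1 (axis k 1) q * c 3 (axis j 1) q)" if "q \<in> B" for j k q
    unfolding d[OF that, symmetric] d2[rule_format, OF V(1) dom[OF invV(1)[OF that]]]
    by (simp add: wedge_def c_def G_def)
  have D4: "pderiv_at j (c 4 (axis k 1)) q - pderiv_at k (c 4 (axis j 1)) q =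
      E (inv_into V \<phi> q) * (c 1 (axis j 1) q * c 2 (axis k 1) q - c 1 (axis k 1) q * c 2 (axis j 1) q)" if "q \<in> B" for j k q
    unfolding d[OF that, symmetric] d4[rule_format, OF V(1) dom[OF invV(1)[OF that]]]
    by (simp add: wedge_def c_def)
  \<comment> \<open>Only \<open>\<omega> 1\<close> and \<open>\<omega> 2\<close> enter, each with dx
    and dy components alone. If the determinant vanished, (N, -L) and (M, -K) would be coefficients
    of relations between them, so all four entries would be 0 and (1, 0) would be a nontrivial
    relation.\<close>
  have indep: "K q * N q - L q * M q \<noteq> 0" if q: "q \<in> B" for q
  proof
    assume eq: "K q * N q - L q * M q = 0"
    let ?p = "inv_into V \<phi> q"
    have "\<forall>c\<in>A. \<forall>p\<in>chart_dom c. \<forall>a :: 4 \<Rightarrow> real.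
        (\<forall>v. (\<Sum>i\<in>UNIV. a i * \<omega> i c p v) = 0) \<longrightarrow> (\<forall>i. a i = 0)"
      using \<omega> by (simp add: coframe_def)
    note ind = this[rule_format, OF V(1) dom[OF invV(1)[OF q]]]
    have w: "\<omega> 1 (V, \<phi>) ?p v = v $ 1 * K q + v $ 2 * L q" "\<omega> 2 (V, \<phi>) ?p v = v $ 1 * M q + v $ 2 * N q" for v
      using expand[OF invV(1)[OF q], of _ v] vals[OF q] by (simp_all add: sum_4 K_def L_def M_def N_def c_def)
    have rel: "x = 0 \<and> y = 0" if "x * K q + y * M q = 0" "x * L q + y * N q = 0" for x y
    proof -
      define a :: "4 \<Rightarrow> real" where "a i = (if i = 1 then x else if i = 2 then y else 0)" for i
      have "(\<Sum>i\<in>UNIV. a i * \<omega> i (V, \<phi>) ?p v) = v $ 1 * (x * K q + y * M q) + v $ 2 * (x * L q + y * N q)" for v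
        by (simp add: sum_4 a_def w algebra_simps)
      then have "\<forall>i. a i = 0" using ind[of a] that by simp
      then have "a 1 = 0" "a 2 = 0" by blast+
      then show ?thesis by (simp add: a_def)
    qed
    have "N q = 0 \<and> - L q = 0" by (rule rel) (use eq in \<open>simp_all add: algebra_simps\<close>)
    moreover have "M q = 0 \<and> - K q = 0" by (rule rel) (use eq in \<open>simp_all add: algebra_simps\<close>)
    ultimately show False using rel[of 1 0] by simp
  qed
  \<comment> \<open>dC is a multiple of \<open>\<omega> 3\<close>, which is dz in this
    chart.\<close>
  have dG: "pderiv_at i G q = 0" if "q \<in> B" "i \<noteq> 3" for q i
  proof -
    have "pderiv_at i G q = d_fun C (V, \<phi>) (inv_into V \<phi> q) (axis i 1)"
      by (simp add: pderiv_at_def G_def d_fun_def invV(2)[OF that(1)])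
    also have "\<dots> = C3 (inv_into V \<phi> q) * axis i 1 $ 3"
      using dC[rule_format, OF V(1) dom[OF invV(1)[OF that(1)]]] vals(5)[OF that(1)] by (simp add: c_def)
    finally show ?thesis using that(2) by (simp add: axis_def)
  qed
  have smB: "smooth_on B K" "smooth_on B L" "smooth_on B M" "smooth_on B N" "smooth_on B \<alpha>" "smooth_on B \<beta>"
    unfolding K_def L_def M_def N_def \<alpha>_def \<beta>_def by (rule smc)+
  have posB: "q $ 4 > 0" if q: "q \<in> B" for q using pos[OF invV(1)[OF q]] invV(2)[OF q] by simp
  \<comment> \<open>The pairs of coordinate vectors (4, 1) and (4, 2) give the w-derivatives; below,
    (3, 1) and (3, 2) give the z-derivatives and (1, 2) the curl identity.\<close>
  have K4: "pderiv_at 4 K q = - K q / (2 * q $ 4)" and L4: "pderiv_at 4 L q = - L q / (2 * q $ 4)" if q: "q \<in> B" for q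
    using D1[OF q, of 4 1] D1[OF q, of 4 2] by (simp_all add: K_def L_def vals[OF q] z[OF q] nth)
  have K3: "pderiv_at 3 K q = G q * K q - M q" and L3: "pderiv_at 3 L q = G q * L q - N q" if q: "q \<in> B" for q
    using D1[OF q, of 3 1] D1[OF q, of 3 2] by (simp_all add: K_def L_def M_def N_def vals[OF q] z[OF q] nth)
  have M3: "pderiv_at 3 M q = - G q * M q - \<epsilon> * K q" and N3: "pderiv_at 3 N q = - G q * N q - \<epsilon> * L q"
    if q: "q \<in> B" for q
    using D2[OF q, of 3 1] D2[OF q, of 3 2] by (simp_all add: K_def L_def M_def N_def vals[OF q] z[OF q] nth)
  have F: "pderiv_at 1 L q - pderiv_at 2 K q = K q * \<beta> q - L q * \<alpha> q" if q: "q \<in> B" for q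
    using D1[OF q, of 1 2] by (simp add: K_def L_def \<alpha>_def \<beta>_def vals[OF q] nth)
  have \<alpha>3: "pderiv_at 3 \<alpha> q = 0" and \<beta>3: "pderiv_at 3 \<beta> q = 0" if q: "q \<in> B" for q
    using D4[OF q, of 3 1] D4[OF q, of 3 2] by (simp_all add: \<alpha>_def \<beta>_def vals[OF q] z[OF q])
  have ab: "a $ i < b $ i" for i
    using \<phi>B[OF V(2)] unfolding B_def mem_box_cart by (meson less_trans)
  have imD: "(\<lambda>p. (\<phi> p $ 1, \<phi> p $ 2)) ` V = {a$1<..<b$1} \<times> {a$2<..<b$2}"
  proof -
    have "(\<lambda>p. (\<phi> p $ 1, \<phi> p $ 2)) ` V = (\<lambda>q. (q $ 1, q $ 2)) ` box a b"
      unfolding V(4)[symmetric] image_image ..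
    also have "\<dots> = {a$1<..<b$1} \<times> {a$2<..<b$2}"
    proof (intro equalityI subsetI)
      fix s assume s: "s \<in> {a$1<..<b$1} \<times> {a$2<..<b$2}"
      \<comment> \<open>Overwriting two coordinates of a point of the box by admissible values keeps
        it in the box, so the projection is onto.\<close>
      define q where "q = coord_line 2 (coord_line 1 (\<phi> p0) (fst s)) (snd s)"
      have "q \<in> box a b" using s \<phi>B[OF V(2)] by (auto simp: q_def B_def mem_box_cart)
      then show "s \<in> (\<lambda>q. (q $ 1, q $ 2)) ` box a b"
        by (intro image_eqI[of _ _ q]) (auto simp: q_def)
    qed (auto simp: mem_box_cart)
    finally show ?thesis .
  qed
  have im3: "(\<lambda>p. \<phi> p $ 3) ` V = {a$3<..<b$3}"
  proof -
    have "(\<lambda>p. \<phi> p $ 3) ` V = (\<lambda>q. q $ 3) ` box a b"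
      unfolding V(4)[symmetric] image_image ..
    also have "\<dots> = {a$3<..<b$3}"
    proof (intro equalityI subsetI)
      fix z assume z: "z \<in> {a$3<..<b$3}"
      have "coord_line 3 (\<phi> p0) z \<in> box a b" using z \<phi>B[OF V(2)] by (auto simp: B_def mem_box_cart)
      then show "z \<in> (\<lambda>q. q $ 3) ` box a b"
        by (intro image_eqI[of _ _ "coord_line 3 (\<phi> p0) z"]) auto
    qed (auto simp: mem_box_cart)
    finally show ?thesis .
  qed
  have dcoord: "d_fun (\<lambda>p. \<phi> p $ i) (V, \<phi>) p v = v $ i" if p: "p \<in> V" for i p v
  proof -
    have "frechet_derivative ((\<lambda>p. \<phi> p $ i) \<circ> inv_into V \<phi>) (at (\<phi> p)) = frechet_derivative (\<lambda>q. q $ i) (at (\<phi> p))"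
      by (rule frechet_derivative_cong_open[OF oB \<phi>B[OF p]]) (simp add: invV(2))
    also have "\<dots> = (\<lambda>v. v $ i)"
      by (rule frechet_derivative_at[symmetric]) (intro bounded_linear_imp_has_derivative bounded_linear_vec_nth)
    finally show ?thesis by (simp add: d_fun_def)
  qed
  let ?D = "{a$1<..<b$1} \<times> {a$2<..<b$2}"
  show ?case
  proof (rule normal_form_coordinates[OF smB(1)[unfolded B_def]
        smB(2)[unfolded B_def]
        smB(3)[unfolded B_def]
        smB(4)[unfolded B_def]
        smB(5)[unfolded B_def]
        smB(6)[unfolded B_def]
        smG[unfolded B_def]
        posB[unfolded B_def]
        \<phi>B[OF V(2), unfolded B_def]
        dG[unfolded B_def]
        K4[unfolded B_def]
        L4[unfolded B_def]
        K3[unfolded B_def]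
        L3[unfolded B_def]
        M3[unfolded B_def]
        N3[unfolded B_def]
        F[unfolded B_def]
        \<alpha>3[unfolded B_def]
        \<beta>3[unfolded B_def]
        indep[unfolded B_def]
        ], assumption+, goal_cases)
    case H: (1 h Q1 Q2 \<gamma> W0 f)
    have CV: "C p = \<gamma> (\<phi> p $ 3)" if "p \<in> V" for p
      using H(4)[of "\<phi> p"] \<phi>B[OF that] by (simp add: G_def B_def inv\<phi>[OF that])
    have forms: "\<omega> 1 (V, \<phi>) p v = K (\<phi> p) * v $ 1 + L (\<phi> p) * v $ 2 \<and>
        \<omega> 2 (V, \<phi>) p v = C p * \<omega> 1 (V, \<phi>) p v
          - (pderiv_at 3 K (\<phi> p) * v $ 1 + pderiv_at 3 L (\<phi> p) * v $ 2) \<and>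
        \<omega> 3 (V, \<phi>) p v = v $ 3 \<and>
        \<omega> 4 (V, \<phi>) p v = 1 / (2 * \<phi> p $ 4) * v $ 4
          - (K (\<phi> p) * pderiv_at 3 f (\<phi> p) - f (\<phi> p) * pderiv_at 3 K (\<phi> p)) * v $ 1
          - (L (\<phi> p) * pderiv_at 3 f (\<phi> p) - f (\<phi> p) * pderiv_at 3 L (\<phi> p)) * v $ 2" if p: "p \<in> V" for p v
    proof -
      have q: "\<phi> p \<in> B" by (rule \<phi>B[OF p])
      have comps: "\<omega> i (V, \<phi>) p (axis k 1) = c i (axis k 1) (\<phi> p)" for i k by (simp add: c_def inv\<phi>[OF p])
      \<comment> \<open>Identifies the coordinate function \<open>G\<close> with \<open>C\<close>;
        with it, the z-derivatives of \<open>K\<close> and \<open>L\<close> express \<open>M\<close>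
        and \<open>N\<close>, and thereby \<open>\<omega> 2\<close>, in the asserted way.\<close>
      have G: "G (\<phi> p) = C p" by (simp add: G_def inv\<phi>[OF p])
      have w1: "\<omega> 1 (V, \<phi>) p v = K (\<phi> p) * v $ 1 + L (\<phi> p) * v $ 2"
        and w2: "\<omega> 2 (V, \<phi>) p v = M (\<phi> p) * v $ 1 + N (\<phi> p) * v $ 2"
        and w4: "\<omega> 4 (V, \<phi>) p v = \<alpha> (\<phi> p) * v $ 1 + \<beta> (\<phi> p) * v $ 2 + 1 / (2 * \<phi> p $ 4) * v $ 4"
        unfolding expand[OF p, of _ v] comps
        by (simp_all add: sum_4 vals[OF q] K_def L_def M_def N_def \<alpha>_def \<beta>_def)
      have K3: "pderiv_at 3 K (\<phi> p) = C p * K (\<phi> p) - M (\<phi> p)" "pderiv_at 3 L (\<phi> p) = C p * L (\<phi> p) - N (\<phi> p)"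
        using D1[OF q, of 3 1] D1[OF q, of 3 2] by (simp_all add: K_def L_def M_def N_def vals[OF q] z[OF q] nth G)
      show ?thesis
      proof (intro conjI)
        show "\<omega> 2 (V, \<phi>) p v = C p * \<omega> 1 (V, \<phi>) p v
          - (pderiv_at 3 K (\<phi> p) * v $ 1 + pderiv_at 3 L (\<phi> p) * v $ 2)"
          unfolding w1 w2 K3 by (simp add: algebra_simps)
        show "\<omega> 4 (V, \<phi>) p v = 1 / (2 * \<phi> p $ 4) * v $ 4
          - (K (\<phi> p) * pderiv_at 3 f (\<phi> p) - f (\<phi> p) * pderiv_at 3 K (\<phi> p)) * v $ 1
          - (L (\<phi> p) * pderiv_at 3 f (\<phi> p) - f (\<phi> p) * pderiv_at 3 L (\<phi> p)) * v $ 2"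
          unfolding w4 H(13)[OF q[unfolded B_def]] H(14)[OF q[unfolded B_def]] by (simp add: algebra_simps)
      qed (rule w1, use ad[OF p] in \<open>simp add: adapted_at_def\<close>)
    qed
    show ?case
    proof (rule exI[of _ V], rule exI[of _ \<phi>], intro conjI V(1-3), rule exI[of _ h], rule exI[of _ ?D],
        rule exI[of _ Q1], rule exI[of _ Q2], rule exI[of _ \<gamma>], rule exI[of _ "a $ 3"], rule exI[of _ "b $ 3"],
        rule exI[of _ W0], rule exI[of _ K], rule exI[of _ L], rule exI[of _ f], intro conjI)
      show "open ?D" by (intro open_Times) auto
      show "(\<lambda>p. (\<phi> p $ 1, \<phi> p $ 2)) ` V = ?D" by (rule imD)
      show "a $ 3 < b $ 3" by (rule ab)
      show "(\<lambda>p. \<phi> p $ 3) ` V = {a $ 3<..<b $ 3}" by (rule im3)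
    qed (use pos H V(4) CV in \<open>auto simp: Let_def dcoord forms\<close>)
  qed
qed

end
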